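(* Let $u_{\max}:=\max_{Q}|u|$ and let $\delta_\star>0$ satisfy $\delta_\star\ge 2\,u_{\max}$. Let ${\sf L}:=\left[\frac{(a_2-a_1)(b_2-b_1)}{\min\{a_2-a_1,\,b_2-b_1\}}\right]^{1/2}$. There exist positive constants $C_1,C_2,C_3$ (depending on $\delta_\star$ and on the data and solution of the continuous problem, but independent of $N,J_1,J_2$, i.e. of $\tau,h_1,h_2$) with the following property (P) for the modified scheme with parameter $\delta=\delta_\star$. (P) For all $N,J_1,J_2\in\mathbb{N}$ with $\tau\,C_1\le\frac12$, $$|u^{1/2}-V_{\delta_\star}^{1/2}|_{1,{\sf H}}\le C_2\left(\tau^{3/2}+\tau^{1/2}h_1^2+\tau^{1/2}h_2^2\right)$$ and $$\max_{0\le m\le N-1}\|g(u^{m+\frac12})-\Phi_{\delta_\star}^{m+\frac12}\|_{0,{\sf H}}+\max_{0\le m\le N}|u^m-V_{\delta_\star}^m|_{1,{\sf H}}\le C_3\left(\tau^2+h_1^2+h_2^2\right).$$ Moreover, for any such constants $C_1,C_2,C_3$ with property (P), if $N,J_1,J_2\in\mathbb{N}$ are such that $$\tau\,C_1\le\tfrac12,\qquad C_3\,{\sf L}\,\frac{\tau^2+h_1^2+h_2^2}{\sqrt{h_1+h_2}}\le\frac{\delta_\star}{2},\qquad C_2\,{\sf L}\,\frac{\tau^{3/2}+\tau^{1/2}h_1^2+\tau^{1/2}h_2^2}{\sqrt{h_1+h_2}}\le\frac{\delta_\star}{2},$$ then the approximations $U^m$, $\Phi^{m+\frac12}$ of the Relaxation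 Finite Difference (RFD) method satisfy $$\max_{0\le m\le N-1}\|g(u^{m+\frac12})-\Phi^{m+\frac12}\|_{0,{\sf H}}+\max_{0\le m\le N}|u^m-U^m|_{1,{\sf H}}\le C_3\left(\tau^2+h_1^2+h_2^2\right).$$
   Context: **Continuous problem.** Let $T>0$, $a_1<a_2$, $b_1<b_2$ be real, $\mathcal D:=[a_1,a_2]\times[b_1,b_2]$, $Q:=[0,T]\times\mathcal D$. Let $g\in C(\mathbb R,\mathbb R)$ with $g(0)=0$, $f\in C(Q,\mathbb R)$, $u_0\in C(\mathcal D,\mathbb R)$ with $u_0|_{\partial\mathcal D}=0$. Let $u\in C^{1,2,2}_{t,x_1,x_2}(Q,\mathbb R)$ solve $u_t=\Delta u+g(u)+f$ on $Q$, $u(t,x)=0$ for $(t,x)\in[0,T]\times\partial\mathcal D$, $u(0,x)=u_0(x)$ for $x\in\mathcal D$. Smoothness assumptions: $g\in C^2(\mathbb R,\mathbb R)$ and, with $\zeta(t,x):=g(u(t,x))$, the derivatives $u_{tt},u_{ttt},\partial_{x_1}^4u,\partial_{x_2}^4u,\zeta_t,\zeta_{tt},\zeta_{ttt}$ exist and are continuous on $Q$. **Mesh and discrete space.** For $N\in\mathbb N=\{1,2,\dots\}$: $\tau:=T/N$, $t_n:=n\tau$ ($0\le n\le N$), $t^{n+\frac12}:=t_n+\frac\tau2$ ($0\le n\le N-1$). For $J_1,J_2\in\mathbb N$: $h_1:=\frac{a_2-a_1}{J_1+1}$, $x_{1,i}:=a_1+ih_1$ ($0\le i\le J_1+1$),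 $h_2:=\frac{b_2-b_1}{J_2+1}$, $x_{2,j}:=b_1+jh_2$ ($0\le j\le J_2+1$). Let $\mathbb I:=\{0,\dots,J_1+1\}\times\{0,\dots,J_2+1\}$, $\mathbb I^\circ:=\{1,\dots,J_1\}\times\{1,\dots,J_2\}$, and let ${\sf X}^\circ_{\sf H}$ be the space of real arrays $V=(V_{i,j})_{(i,j)\in\mathbb I}$ with $V_{i,j}=0$ for $(i,j)\in\mathbb I\setminus\mathbb I^\circ$. The discrete Laplacian $\Delta_{\sf H}:{\sf X}^\circ_{\sf H}\to{\sf X}^\circ_{\sf H}$ is $$(\Delta_{\sf H}V)_{i,j}:=\tfrac{V_{i-1,j}-2V_{i,j}+V_{i+1,j}}{h_1^2}+\tfrac{V_{i,j-1}-2V_{i,j}+V_{i,j+1}}{h_2^2},\quad (i,j)\in\mathbb I^\circ.$$ For $z\in C(\mathcal D)$, ${\sf I}^\circ_{\sf H}[z]\in{\sf X}^\circ_{\sf H}$ is given by $({\sf I}^\circ_{\sf H}[z])_{i,j}:=z(x_{1,i},x_{2,j})$ for $(i,j)\in\mathbb I^\circ$. For $W\in{\sf X}^\circ_{\sf H}$ and a real function $\phi$ with $\phi(0)=0$, $\phi(W)\in{\sf X}^\circ_{\sf H}$ is defined entrywise. Write $u^n:={\sf I}^\circ_{\sf H}[u(t_n,\cdot)]$ for $0\le n\le N$ and $u^{n+\frac12}:={\sf I}^\circ_{\sf H}[u(t^{n+\frac12},\cdot)]$ for $0\le n\le N-1$. **Norms on ${\sf X}^\circ_{\sf H}$.** $\|V\|_{0,{\sf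 H}}:=\big[h_1h_2\sum_{(i,j)\in\mathbb I^\circ}V_{i,j}^2\big]^{1/2}$ and $$|V|_{1,{\sf H}}:=\Big[h_1h_2\sum_{j=1}^{J_2}\sum_{i=0}^{J_1}\big|\tfrac{V_{i+1,j}-V_{i,j}}{h_1}\big|^2+h_1h_2\sum_{i=1}^{J_1}\sum_{j=0}^{J_2}\big|\tfrac{V_{i,j+1}-V_{i,j}}{h_2}\big|^2\Big]^{1/2}.$$ **(RFD) method.** All unknowns lie in ${\sf X}^\circ_{\sf H}$. Set $U^0:={\sf I}^\circ_{\sf H}[u_0]$ and find $U^{1/2}$ with $$\tfrac{U^{1/2}-U^0}{\tau/2}=\Delta_{\sf H}U^{1/2}+g(u^0)+{\sf I}^\circ_{\sf H}[f(t^{1/2},\cdot)].$$ Set $\Phi^{1/2}:=g(U^{1/2})$, and for $n=1,\dots,N-1$ set $\Phi^{n+\frac12}:=2g(U^n)-\Phi^{n-\frac12}$. For $n=0,\dots,N-1$ find $U^{n+1}$ with $$\tfrac{U^{n+1}-U^n}{\tau}=\Delta_{\sf H}\big(\tfrac{U^{n+1}+U^n}{2}\big)+\Phi^{n+\frac12}+{\sf I}^\circ_{\sf H}\big[\tfrac{f(t_{n+1},\cdot)+f(t_n,\cdot)}{2}\big].$$ **Mollifier.** For $\delta>0$, $\mathfrak n_\delta\in C^3(\mathbb R;\mathbb R)$ is the odd function with $\mathfrak n_\delta(x)=x$ for $x\in[0,\delta]$, $\mathfrak n_\delta(x)=p_\delta(x)$ for $x\in(\delta,2\delta]$, $\mathfrak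 n_\delta(x)=2\delta$ for $x>2\delta$, where $p_\delta$ is the unique polynomial of degree at most $7$ with $p_\delta(\delta)=\delta$, $p_\delta'(\delta)=1$, $p_\delta''(\delta)=p_\delta'''(\delta)=0$, $p_\delta(2\delta)=2\delta$, $p_\delta'(2\delta)=p_\delta''(2\delta)=p_\delta'''(2\delta)=0$. **Modified scheme with parameter $\delta>0$.** Set $V^0_\delta:=U^0$, $V^{1/2}_\delta:=U^{1/2}$, $\Phi^{1/2}_\delta:=g(\mathfrak n_\delta(V^{1/2}_\delta))$, and for $n=1,\dots,N-1$ set $\Phi^{n+\frac12}_\delta:=2g(\mathfrak n_\delta(V^n_\delta))-\Phi^{n-\frac12}_\delta$. For $n=0,\dots,N-1$ find $V^{n+1}_\delta\in{\sf X}^\circ_{\sf H}$ with $$\tfrac{V^{n+1}_\delta-V^n_\delta}{\tau}=\Delta_{\sf H}\big(\tfrac{V^{n+1}_\delta+V^n_\delta}{2}\big)+\Phi^{n+\frac12}_\delta+{\sf I}^\circ_{\sf H}\big[\tfrac{f(t_{n+1},\cdot)+f(t_n,\cdot)}{2}\big].$$ *)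

theory Defs
  imports "HOL-Analysis.Analysis" "HOL-Computational_Algebra.Polynomial"
begin

text \<open>Functions on \<open>Q\<close> have type \<open>real \<Rightarrow> real \<times> real \<Rightarrow> real\<close> (time, then space). Derivatives are
  taken within the corresponding section of \<open>Q\<close>, hence are one-sided at its end points.\<close>

definition has_partial_t ::
  "(real \<times> real \<times> real) set \<Rightarrow> (real \<Rightarrow> real \<times> real \<Rightarrow> real) \<Rightarrow> (real \<Rightarrow> real \<times> real \<Rightarrow> real) \<Rightarrow> bool"
  where "has_partial_t Q F F' \<longleftrightarrow> (\<forall>(t, x1, x2)\<in>Q.
    ((\<lambda>s. F s (x1, x2)) has_real_derivative F' t (x1, x2)) (at t within {s. (s, x1, x2) \<in> Q}))"

definition has_partial_x1 ::
  "(real \<times> real \<times> real) set \<Rightarrow> (real \<Rightarrow> real \<times> real \<Rightarrow> real) \<Rightarrow> (real \<Rightarrow> real \<times> real \<Rightarrow> real) \<Rightarrow> bool"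
  where "has_partial_x1 Q F F' \<longleftrightarrow> (\<forall>(t, x1, x2)\<in>Q.
    ((\<lambda>y. F t (y, x2)) has_real_derivative F' t (x1, x2)) (at x1 within {y. (t, y, x2) \<in> Q}))"

definition has_partial_x2 ::
  "(real \<times> real \<times> real) set \<Rightarrow> (real \<Rightarrow> real \<times> real \<Rightarrow> real) \<Rightarrow> (real \<Rightarrow> real \<times> real \<Rightarrow> real) \<Rightarrow> bool"
  where "has_partial_x2 Q F F' \<longleftrightarrow> (\<forall>(t, x1, x2)\<in>Q.
    ((\<lambda>y. F t (x1, y)) has_real_derivative F' t (x1, x2)) (at x2 within {y. (t, x1, y) \<in> Q}))"

type_synonym grid_fun = "nat \<Rightarrow> nat \<Rightarrow> real"

definition mesh_width :: "real \<Rightarrow> real \<Rightarrow> nat \<Rightarrow> real"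
  where "mesh_width a b J = (b - a) / (real J + 1)"

definition interior_idx :: "nat \<Rightarrow> nat \<Rightarrow> (nat \<times> nat) set"
  where "interior_idx J1 J2 = {1..J1} \<times> {1..J2}"

text \<open>Arrays over \<open>{0..J1+1} \<times> {0..J2+1}\<close> are represented by functions on all of
  \<open>nat \<times> nat\<close>, extended by zero.\<close>

definition grid_space :: "nat \<Rightarrow> nat \<Rightarrow> grid_fun set"
  where "grid_space J1 J2 = {V. \<forall>i j. (i, j) \<notin> interior_idx J1 J2 \<longrightarrow> V i j = 0}"

definition discrete_laplacian :: "nat \<Rightarrow> nat \<Rightarrow> real \<Rightarrow> real \<Rightarrow> grid_fun \<Rightarrow> grid_fun"
  where "discrete_laplacian J1 J2 h1 h2 V = (\<lambda>i j.
    if (i, j) \<in> interior_idx J1 J2 then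
      (V (i - 1) j - 2 * V i j + V (i + 1) j) / h1\<^sup>2 + (V i (j - 1) - 2 * V i j + V i (j + 1)) / h2\<^sup>2
    else 0)"

definition grid_interp ::
  "real \<Rightarrow> real \<Rightarrow> real \<Rightarrow> real \<Rightarrow> nat \<Rightarrow> nat \<Rightarrow> (real \<times> real \<Rightarrow> real) \<Rightarrow> grid_fun"
  where "grid_interp a1 a2 b1 b2 J1 J2 z = (\<lambda>i j.
    if (i, j) \<in> interior_idx J1 J2
    then z (a1 + real i * mesh_width a1 a2 J1, b1 + real j * mesh_width b1 b2 J2)
    else 0)"

definition norm0H :: "nat \<Rightarrow> nat \<Rightarrow> real \<Rightarrow> real \<Rightarrow> grid_fun \<Rightarrow> real"
  where "norm0H J1 J2 h1 h2 V = sqrt (h1 * h2 * (\<Sum>(i, j)\<in>interior_idx J1 J2. (V i j)\<^sup>2))"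

definition norm1H :: "nat \<Rightarrow> nat \<Rightarrow> real \<Rightarrow> real \<Rightarrow> grid_fun \<Rightarrow> real"
  where "norm1H J1 J2 h1 h2 V = sqrt
    (h1 * h2 * (\<Sum>j=1..J2. \<Sum>i=0..J1. \<bar>(V (i + 1) j - V i j) / h1\<bar>\<^sup>2) +
     h1 * h2 * (\<Sum>i=1..J1. \<Sum>j=0..J2. \<bar>(V i (j + 1) - V i j) / h2\<bar>\<^sup>2))"

definition mollifier_poly :: "real \<Rightarrow> real poly"
  where "mollifier_poly \<delta> = (THE p. degree p \<le> 7 \<and>
    poly p \<delta> = \<delta> \<and> poly (pderiv p) \<delta> = 1 \<and>
    poly (pderiv (pderiv p)) \<delta> = 0 \<and> poly (pderiv (pderiv (pderiv p))) \<delta> = 0 \<and>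
    poly p (2 * \<delta>) = 2 * \<delta> \<and> poly (pderiv p) (2 * \<delta>) = 0 \<and>
    poly (pderiv (pderiv p)) (2 * \<delta>) = 0 \<and> poly (pderiv (pderiv (pderiv p))) (2 * \<delta>) = 0)"

definition mollifier_pos :: "real \<Rightarrow> real \<Rightarrow> real"
  where "mollifier_pos \<delta> x =
    (if x \<le> \<delta> then x else if x \<le> 2 * \<delta> then poly (mollifier_poly \<delta>) x else 2 * \<delta>)"

definition mollifier :: "real \<Rightarrow> real \<Rightarrow> real"
  where "mollifier \<delta> x = (if 0 \<le> x then mollifier_pos \<delta> x else - mollifier_pos \<delta> (- x))"

text \<open>Time levels: \<open>U n\<close> stands for $U^n$, \<open>Uh\<close> for $U^{1/2}$ and \<open>\<Phi> n\<close> for $\Phi^{n+1/2}$.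
  In the half step, $g(u^0)$ is \<open>g\<close> applied to the interpolant of the initial datum, because
  $u(0,\cdot) = u_0$.\<close>

definition half_step ::
  "real \<Rightarrow> real \<Rightarrow> real \<Rightarrow> real \<Rightarrow> real \<Rightarrow> (real \<Rightarrow> real) \<Rightarrow> (real \<Rightarrow> real \<times> real \<Rightarrow> real) \<Rightarrow>
   (real \<times> real \<Rightarrow> real) \<Rightarrow> nat \<Rightarrow> nat \<Rightarrow> nat \<Rightarrow> grid_fun \<Rightarrow> bool"
  where "half_step T a1 a2 b1 b2 g f u0 N J1 J2 Uh \<longleftrightarrow>
    (let \<tau> = T / real N; h1 = mesh_width a1 a2 J1; h2 = mesh_width b1 b2 J2;
         I = grid_interp a1 a2 b1 b2 J1 J2
     in Uh \<in> grid_space J1 J2 \<and>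
        (\<forall>(i, j)\<in>interior_idx J1 J2.
          (Uh i j - I u0 i j) / (\<tau> / 2) =
            discrete_laplacian J1 J2 h1 h2 Uh i j + g (I u0 i j) + I (f (\<tau> / 2)) i j))"

text \<open>The part common to both schemes; \<open>\<gamma>\<close> is the nonlinearity entering $\Phi$.\<close>

definition relaxation_steps ::
  "real \<Rightarrow> real \<Rightarrow> real \<Rightarrow> real \<Rightarrow> real \<Rightarrow> (real \<Rightarrow> real) \<Rightarrow> (real \<Rightarrow> real \<times> real \<Rightarrow> real) \<Rightarrow>
   (real \<times> real \<Rightarrow> real) \<Rightarrow> nat \<Rightarrow> nat \<Rightarrow> nat \<Rightarrow>
   grid_fun \<Rightarrow> (nat \<Rightarrow> grid_fun) \<Rightarrow> (nat \<Rightarrow> grid_fun) \<Rightarrow> bool"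
  where "relaxation_steps T a1 a2 b1 b2 \<gamma> f u0 N J1 J2 Uh U \<Phi> \<longleftrightarrow>
    (let \<tau> = T / real N; h1 = mesh_width a1 a2 J1; h2 = mesh_width b1 b2 J2;
         I = grid_interp a1 a2 b1 b2 J1 J2
     in U 0 = I u0 \<and> (\<forall>n\<le>N. U n \<in> grid_space J1 J2) \<and>
        \<Phi> 0 = (\<lambda>i j. \<gamma> (Uh i j)) \<and>
        (\<forall>n\<in>{1..<N}. \<Phi> n = (\<lambda>i j. 2 * \<gamma> (U n i j) - \<Phi> (n - 1) i j)) \<and>
        (\<forall>n<N. \<forall>(i, j)\<in>interior_idx J1 J2.
          (U (n + 1) i j - U n i j) / \<tau> =
            discrete_laplacian J1 J2 h1 h2 (\<lambda>k l. (U (n + 1) k l + U n k l) / 2) i j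
            + \<Phi> n i j
            + I (\<lambda>x. (f (real (n + 1) * \<tau>) x + f (real n * \<tau>) x) / 2) i j))"

definition rfd_scheme ::
  "real \<Rightarrow> real \<Rightarrow> real \<Rightarrow> real \<Rightarrow> real \<Rightarrow> (real \<Rightarrow> real) \<Rightarrow> (real \<Rightarrow> real \<times> real \<Rightarrow> real) \<Rightarrow>
   (real \<times> real \<Rightarrow> real) \<Rightarrow> nat \<Rightarrow> nat \<Rightarrow> nat \<Rightarrow>
   grid_fun \<Rightarrow> (nat \<Rightarrow> grid_fun) \<Rightarrow> (nat \<Rightarrow> grid_fun) \<Rightarrow> bool"
  where "rfd_scheme T a1 a2 b1 b2 g f u0 N J1 J2 Uh U \<Phi> \<longleftrightarrow>
    half_step T a1 a2 b1 b2 g f u0 N J1 J2 Uh \<and>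
    relaxation_steps T a1 a2 b1 b2 g f u0 N J1 J2 Uh U \<Phi>"

definition modified_scheme ::
  "real \<Rightarrow> real \<Rightarrow> real \<Rightarrow> real \<Rightarrow> real \<Rightarrow> (real \<Rightarrow> real) \<Rightarrow> (real \<Rightarrow> real \<times> real \<Rightarrow> real) \<Rightarrow>
   (real \<times> real \<Rightarrow> real) \<Rightarrow> real \<Rightarrow> nat \<Rightarrow> nat \<Rightarrow> nat \<Rightarrow>
   grid_fun \<Rightarrow> (nat \<Rightarrow> grid_fun) \<Rightarrow> (nat \<Rightarrow> grid_fun) \<Rightarrow> bool"
  where "modified_scheme T a1 a2 b1 b2 g f u0 \<delta> N J1 J2 Vh V \<Phi> \<longleftrightarrow>
    half_step T a1 a2 b1 b2 g f u0 N J1 J2 Vh \<and>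
    relaxation_steps T a1 a2 b1 b2 (\<lambda>x. g (mollifier \<delta> x)) f u0 N J1 J2 Vh V \<Phi>"

definition half_step_error ::
  "real \<Rightarrow> real \<Rightarrow> real \<Rightarrow> real \<Rightarrow> real \<Rightarrow> (real \<Rightarrow> real \<times> real \<Rightarrow> real) \<Rightarrow>
   nat \<Rightarrow> nat \<Rightarrow> nat \<Rightarrow> grid_fun \<Rightarrow> real"
  where "half_step_error T a1 a2 b1 b2 u N J1 J2 Vh =
    norm1H J1 J2 (mesh_width a1 a2 J1) (mesh_width b1 b2 J2)
      (\<lambda>i j. grid_interp a1 a2 b1 b2 J1 J2 (u (T / real N / 2)) i j - Vh i j)"

definition max_error ::
  "real \<Rightarrow> real \<Rightarrow> real \<Rightarrow> real \<Rightarrow> real \<Rightarrow> (real \<Rightarrow> real) \<Rightarrow> (real \<Rightarrow> real \<times> real \<Rightarrow> real) \<Rightarrow>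
   nat \<Rightarrow> nat \<Rightarrow> nat \<Rightarrow> (nat \<Rightarrow> grid_fun) \<Rightarrow> (nat \<Rightarrow> grid_fun) \<Rightarrow> real"
  where "max_error T a1 a2 b1 b2 g u N J1 J2 V \<Phi> =
    (let \<tau> = T / real N; h1 = mesh_width a1 a2 J1; h2 = mesh_width b1 b2 J2;
         I = grid_interp a1 a2 b1 b2 J1 J2
     in (MAX m\<in>{0..N - 1}. norm0H J1 J2 h1 h2
           (\<lambda>i j. g (I (u (real m * \<tau> + \<tau> / 2)) i j) - \<Phi> m i j)) +
        (MAX m\<in>{0..N}. norm1H J1 J2 h1 h2 (\<lambda>i j. I (u (real m * \<tau>)) i j - V m i j)))"

definition property_P ::
  "real \<Rightarrow> real \<Rightarrow> real \<Rightarrow> real \<Rightarrow> real \<Rightarrow> (real \<Rightarrow> real) \<Rightarrow> (real \<Rightarrow> real \<times> real \<Rightarrow> real) \<Rightarrow>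
   (real \<times> real \<Rightarrow> real) \<Rightarrow> (real \<Rightarrow> real \<times> real \<Rightarrow> real) \<Rightarrow> real \<Rightarrow> real \<Rightarrow> real \<Rightarrow> real \<Rightarrow> bool"
  where "property_P T a1 a2 b1 b2 g f u0 u \<delta> C1 C2 C3 \<longleftrightarrow>
    (\<forall>N\<ge>1. \<forall>J1\<ge>1. \<forall>J2\<ge>1. \<forall>Vh V \<Phi>.
      let \<tau> = T / real N; h1 = mesh_width a1 a2 J1; h2 = mesh_width b1 b2 J2
      in \<tau> * C1 \<le> 1 / 2 \<longrightarrow> modified_scheme T a1 a2 b1 b2 g f u0 \<delta> N J1 J2 Vh V \<Phi> \<longrightarrow>
         half_step_error T a1 a2 b1 b2 u N J1 J2 Vh
           \<le> C2 * (\<tau> powr (3 / 2) + \<tau> powr (1 / 2) * h1\<^sup>2 + \<tau> powr (1 / 2) * h2\<^sup>2) \<and>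
         max_error T a1 a2 b1 b2 g u N J1 J2 V \<Phi> \<le> C3 * (\<tau>\<^sup>2 + h1\<^sup>2 + h2\<^sup>2))"

end

theory Submission
  imports Defs
begin

text \<open>Write \<open>e n\<close> for the error of the modified scheme at time level \<open>n\<close> and \<open>\<theta> n\<close> for the error of
  \<open>\<Phi> n\<close>. Testing the error equation with \<open>e (n + 1) - e n\<close> bounds
  \<open>\<parallel>e (n + 1) - e n\<parallel>\<^sup>2 / \<tau> + |e (n + 1)|\<^sup>2 - |e n|\<^sup>2\<close> by \<open>\<tau> * \<parallel>\<theta> n\<parallel>\<^sup>2\<close> and the consistency error. The relation
  \<open>\<theta> n + \<theta> (n - 1) = 2 * (g (u n) - g (V n)) + O(\<tau>\<^sup>2)\<close> alone would lose a power of \<open>\<tau>\<close>; subtracting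
  it at two consecutive levels leaves \<open>\<theta> n - \<theta> (n - 2)\<close>, controlled by \<open>e n - e (n - 1)\<close> because the
  mollified nonlinearity has a Lipschitz derivative, and by a third difference in time of size
  \<open>O(\<tau>\<^sup>3)\<close>. The dissipation in the energy inequality absorbs the increments of \<open>e\<close>, and a discrete
  Gronwall argument gives the error bound. For the relaxation scheme itself, the discrete Sobolev
  inequality shows that the modified solution stays where the mollifier is the identity, so both
  schemes coincide by unique solvability of the implicit steps.\<close>

section \<open>Taylor bounds on intervals\<close>

text \<open>\<open>g\<close> is Lipschitz only on bounded sets, so no constant could be fixed before
  the numerical solution is known to be bounded. The mollifier removes this circularity: the bound
  \<delta>/2 on the exact solution leaves a margin \<delta>/2 for the error. The discrete Sobolev
  inequality pays a factor 1/sqrt(h1 + h2), which is what the mesh conditions of the theorem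
  compensate. Since \<open>property_P\<close> speaks about given solutions of the modified scheme,
  one that starts from the same half step must be constructed before the property can be applied. In
  the recursion for \<theta>, Young's inequality with weights 1 + \<tau> and 1 + 1/\<tau> keeps the
  growth factor summable and divides the squared increment of \<open>e\<close> by \<tau>, exactly
  the weight it has in the dissipation. The squared third difference contributes \<tau>^6/\<tau> per
  step, hence \<tau>^4 after \<open>N\<close> steps. The half step is only first order consistent,
  but a single step of length \<tau>/2 gains a factor \<tau> in the L2 norm, so \<theta> starts at
  second order.\<close>

lemma has_real_derivative_glue:
  fixes F G F' G' :: "real \<Rightarrow> real"
  assumes "\<And>x. (F has_real_derivative F' x) (at x)" "\<And>x. (G has_real_derivative G' x) (at x)"
    and "F c = G c" "F' c = G' c"
  shows "((\<lambda>x. if x \<le> c then F x else G x) has_real_derivative (if x \<le> c then F' x else G' x)) (at x)"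
proof -
  have un: "{..c} \<union> {c<..} = (UNIV :: real set)"
    by auto
  \<comment> \<open>The closures of the two half-lines meet only in \<open>c\<close>, so values and
    slopes have to match only there. Iterating the gluing yields functions with several pieces, such
    as the mollifier.\<close>
  have "((\<lambda>x. if x \<in> {..c} then F x else G x) has_vector_derivative
      (if x \<in> {..c} then F' x else G' x)) (at x within UNIV)"
    by (rule has_vector_derivative_If_within_closures[where T = "{c<..}"])
      (use assms un in \<open>auto simp flip: has_real_derivative_iff_has_vector_derivative
        intro: has_field_derivative_at_within\<close>)
  then show ?thesis
    by (simp flip: has_real_derivative_iff_has_vector_derivative)
qed

lemma bounded_derivative_lipschitz:
  fixes F F' :: "real \<Rightarrow> real"
  assumes "\<And>x. (F has_real_derivative F' x) (at x)" and "\<And>x. \<bar>F' x\<bar> \<le> B"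
  shows "\<bar>F x - F y\<bar> \<le> B * \<bar>x - y\<bar>"
  using field_differentiable_bound[of UNIV F F' B x y] assms by simp

text \<open>The mean value theorem is applied to the difference of \<open>F\<close> along the
  segments from \<open>b\<close> to \<open>a\<close> and from \<open>d\<close> to \<open>c\<close>;
  the derivative at the intermediate point splits into a difference of slopes times
  \<open>a - b\<close> and a slope times the difference of increments. In the application
  \<open>a\<close>, \<open>b\<close> are exact values at consecutive times and \<open>c\<close>,
  \<open>d\<close> their approximations: \<open>a - b\<close> is O(\<tau>), and
  \<open>a - b - (c - d)\<close> is the increment of the error.\<close>

lemma second_difference_bound:
  fixes F F' F'' :: "real \<Rightarrow> real"
  assumes F: "\<And>x. (F has_real_derivative F' x) (at x)"
    and F': "\<And>x. (F' has_real_derivative F'' x) (at x)"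
    and B1: "\<And>x. \<bar>F' x\<bar> \<le> B" and B2: "\<And>x. \<bar>F'' x\<bar> \<le> B"
  shows "\<bar>F a - F b - (F c - F d)\<bar> \<le> B * (\<bar>a - b - (c - d)\<bar> + (\<bar>a - c\<bar> + \<bar>b - d\<bar>) * \<bar>a - b\<bar>)"
proof -
  define H where "H s = F (b + s * (a - b)) - F (d + s * (c - d))" for s
  define H' where "H' s = F' (b + s * (a - b)) * (a - b) - F' (d + s * (c - d)) * (c - d)" for s
  have H: "(H has_real_derivative H' s) (at s)" for s
    unfolding H_def H'_def
    by (auto intro!: derivative_eq_intros DERIV_chain2[OF F])
  obtain z where z: "z > 0" "z < 1" "H 1 - H 0 = (1 - 0) * H' z"
    using MVT2[of 0 1 H H'] H by auto
  have "H' z = (F' (b + z * (a - b)) - F' (d + z * (c - d))) * (a - b)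
      + F' (d + z * (c - d)) * (a - b - (c - d))"
    unfolding H'_def by algebra
  then have "\<bar>H' z\<bar> \<le> \<bar>F' (b + z * (a - b)) - F' (d + z * (c - d))\<bar> * \<bar>a - b\<bar>
      + \<bar>F' (d + z * (c - d))\<bar> * \<bar>a - b - (c - d)\<bar>"
    by (metis abs_mult abs_triangle_ineq)
  also have "\<dots> \<le> (B * \<bar>(b + z * (a - b)) - (d + z * (c - d))\<bar>) * \<bar>a - b\<bar> + B * \<bar>a - b - (c - d)\<bar>"
    by (intro add_mono mult_right_mono bounded_derivative_lipschitz[OF F' B2] B1) auto
  also have "\<dots> \<le> (B * (\<bar>a - c\<bar> + \<bar>b - d\<bar>)) * \<bar>a - b\<bar> + B * \<bar>a - b - (c - d)\<bar>"
  proof -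
    \<comment> \<open>The distance of the two intermediate points is a convex combination of the
      distances at the end points.\<close>
    have "(b + z * (a - b)) - (d + z * (c - d)) = z * (a - c) + (1 - z) * (b - d)"
      by algebra
    then have "\<bar>(b + z * (a - b)) - (d + z * (c - d))\<bar> \<le> z * \<bar>a - c\<bar> + (1 - z) * \<bar>b - d\<bar>"
      using z by (metis abs_mult abs_of_pos abs_triangle_ineq diff_gt_0_iff_gt)
    also have "\<dots> \<le> 1 * \<bar>a - c\<bar> + 1 * \<bar>b - d\<bar>"
      using z by (intro add_mono mult_right_mono) auto
    finally have "\<bar>(b + z * (a - b)) - (d + z * (c - d))\<bar> \<le> \<bar>a - c\<bar> + \<bar>b - d\<bar>"
      by simp
    moreover have "0 \<le> B"
      using B1[of 0] by simp
    ultimately show ?thesis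
      by (intro add_mono mult_right_mono mult_left_mono) auto
  qed
  finally have "\<bar>H' z\<bar> \<le> B * (\<bar>a - b - (c - d)\<bar> + (\<bar>a - c\<bar> + \<bar>b - d\<bar>) * \<bar>a - b\<bar>)"
    by (simp add: algebra_simps)
  moreover have "H 1 - H 0 = F a - F b - (F c - F d)"
    unfolding H_def by simp
  ultimately show ?thesis
    using z(3) by simp
qed

text \<open>The remainder carries \<open>fact n\<close> and not \<open>fact (Suc n)\<close>; only
  the power of \<open>z - w\<close> matters in what follows.\<close>

lemma taylor_interval:
  fixes F :: "nat \<Rightarrow> real \<Rightarrow> real"
  assumes "\<And>i x. x \<in> {a..b} \<Longrightarrow> i \<le> n \<Longrightarrow> (F i has_real_derivative F (Suc i) x) (at x within {a..b})"
    and "\<And>x. x \<in> {a..b} \<Longrightarrow> \<bar>F (Suc n) x\<bar> \<le> M"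
    and "w \<in> {a..b}" "z \<in> {a..b}"
  shows "\<bar>F 0 z - (\<Sum>i\<le>n. F i w * (z - w) ^ i / fact i)\<bar> \<le> M * \<bar>z - w\<bar> ^ Suc n / fact n"
  using field_Taylor[of "{a..b}" n F M w z] assms by simp

lemma taylor_1:
  fixes F0 F1 :: "real \<Rightarrow> real"
  assumes "\<And>x. x \<in> {a..b} \<Longrightarrow> (F0 has_real_derivative F1 x) (at x within {a..b})"
    and "\<And>x. x \<in> {a..b} \<Longrightarrow> \<bar>F1 x\<bar> \<le> M"
    and "w \<in> {a..b}" "z \<in> {a..b}"
  shows "\<bar>F0 z - F0 w\<bar> \<le> M * \<bar>z - w\<bar>"
  using taylor_interval[where F = "\<lambda>i. [F0, F1] ! i" and n = 0, of a b M w z] assms by simp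

lemma taylor_2:
  fixes F0 F1 F2 :: "real \<Rightarrow> real"
  assumes "\<And>x. x \<in> {a..b} \<Longrightarrow> (F0 has_real_derivative F1 x) (at x within {a..b})"
    and "\<And>x. x \<in> {a..b} \<Longrightarrow> (F1 has_real_derivative F2 x) (at x within {a..b})"
    and "\<And>x. x \<in> {a..b} \<Longrightarrow> \<bar>F2 x\<bar> \<le> M"
    and "w \<in> {a..b}" "z \<in> {a..b}"
  shows "\<bar>F0 z - (F0 w + F1 w * (z - w))\<bar> \<le> M * \<bar>z - w\<bar>\<^sup>2"
proof -
  have "(([F0, F1, F2] ! i) has_real_derivative ([F0, F1, F2] ! Suc i) x) (at x within {a..b})"
    if "x \<in> {a..b}" "i \<le> 1" for i x
    using that assms(1-2)[OF that(1)] by (auto simp: le_Suc_eq)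
  from taylor_interval[where F = "\<lambda>i. [F0, F1, F2] ! i" and n = 1, of a b M w z, OF this] assms(3-)
  show ?thesis
    by (simp add: eval_nat_numeral)
qed

lemma taylor_3:
  fixes F0 F1 F2 F3 :: "real \<Rightarrow> real"
  assumes "\<And>x. x \<in> {a..b} \<Longrightarrow> (F0 has_real_derivative F1 x) (at x within {a..b})"
    and "\<And>x. x \<in> {a..b} \<Longrightarrow> (F1 has_real_derivative F2 x) (at x within {a..b})"
    and "\<And>x. x \<in> {a..b} \<Longrightarrow> (F2 has_real_derivative F3 x) (at x within {a..b})"
    and "\<And>x. x \<in> {a..b} \<Longrightarrow> \<bar>F3 x\<bar> \<le> M"
    and "w \<in> {a..b}" "z \<in> {a..b}"
  shows "\<bar>F0 z - (F0 w + F1 w * (z - w) + F2 w * (z - w)\<^sup>2 / 2)\<bar> \<le> M * \<bar>z - w\<bar> ^ 3 / 2"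
proof -
  have "(([F0, F1, F2, F3] ! i) has_real_derivative ([F0, F1, F2, F3] ! Suc i) x) (at x within {a..b})"
    if "x \<in> {a..b}" "i \<le> 2" for i x
    using that assms(1-3)[OF that(1)] by (auto simp: le_Suc_eq eval_nat_numeral)
  from taylor_interval[where F = "\<lambda>i. [F0, F1, F2, F3] ! i" and n = 2, of a b M w z, OF this] assms(4-)
  show ?thesis
    by (simp add: eval_nat_numeral)
qed

lemma taylor_4:
  fixes F0 F1 F2 F3 F4 :: "real \<Rightarrow> real"
  assumes "\<And>x. x \<in> {a..b} \<Longrightarrow> (F0 has_real_derivative F1 x) (at x within {a..b})"
    and "\<And>x. x \<in> {a..b} \<Longrightarrow> (F1 has_real_derivative F2 x) (at x within {a..b})"
    and "\<And>x. x \<in> {a..b} \<Longrightarrow> (F2 has_real_derivative F3 x) (at x within {a..b})"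
    and "\<And>x. x \<in> {a..b} \<Longrightarrow> (F3 has_real_derivative F4 x) (at x within {a..b})"
    and "\<And>x. x \<in> {a..b} \<Longrightarrow> \<bar>F4 x\<bar> \<le> M"
    and "w \<in> {a..b}" "z \<in> {a..b}"
  shows "\<bar>F0 z - (F0 w + F1 w * (z - w) + F2 w * (z - w)\<^sup>2 / 2 + F3 w * (z - w) ^ 3 / 6)\<bar>
    \<le> M * \<bar>z - w\<bar> ^ 4 / 6"
proof -
  have "(([F0, F1, F2, F3, F4] ! i) has_real_derivative ([F0, F1, F2, F3, F4] ! Suc i) x)
      (at x within {a..b})" if "x \<in> {a..b}" "i \<le> 3" for i x
    using that assms(1-4)[OF that(1)] by (auto simp: le_Suc_eq eval_nat_numeral)
  from taylor_interval[where F = "\<lambda>i. [F0, F1, F2, F3, F4] ! i" and n = 3, of a b M w z, OF this]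
    assms(5-)
  show ?thesis
    by (simp add: eval_nat_numeral fact_numeral)
qed

section \<open>Finite difference formulas in one variable\<close>

lemma midpoint_average:
  fixes F0 F1 F2 :: "real \<Rightarrow> real"
  assumes d: "\<And>x. x \<in> {a..b} \<Longrightarrow> (F0 has_real_derivative F1 x) (at x within {a..b})"
    "\<And>x. x \<in> {a..b} \<Longrightarrow> (F1 has_real_derivative F2 x) (at x within {a..b})"
    "\<And>x. x \<in> {a..b} \<Longrightarrow> \<bar>F2 x\<bar> \<le> M"
    and "0 \<le> k" "a \<le> t" "t + k \<le> b"
  shows "\<bar>(F0 t + F0 (t + k)) / 2 - F0 (t + k / 2)\<bar> \<le> M * k\<^sup>2"
proof -
  \<comment> \<open>Both end points are expanded about the midpoint, so that the linear terms cancel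
    in the average.\<close>
  have "\<bar>F0 t - (F0 (t + k / 2) + F1 (t + k / 2) * (t - (t + k / 2)))\<bar> \<le> M * \<bar>t - (t + k / 2)\<bar>\<^sup>2"
    by (rule taylor_2[OF d]) (use assms in auto)
  moreover have "\<bar>F0 (t + k) - (F0 (t + k / 2) + F1 (t + k / 2) * (t + k - (t + k / 2)))\<bar>
      \<le> M * \<bar>t + k - (t + k / 2)\<bar>\<^sup>2"
    by (rule taylor_2[OF d]) (use assms in auto)
  moreover have "0 \<le> M"
    using order_trans[OF abs_ge_zero d(3)[of t]] assms by simp
  ultimately have "\<bar>F0 t - F0 (t + k / 2) + F1 (t + k / 2) * (k / 2)\<bar> \<le> M * (k\<^sup>2 / 4)"
    "\<bar>F0 (t + k) - F0 (t + k / 2) - F1 (t + k / 2) * (k / 2)\<bar> \<le> M * (k\<^sup>2 / 4)" "0 \<le> M * k\<^sup>2"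
    by (simp_all add: power2_eq_square algebra_simps)
  then show ?thesis
    by argo
qed

text \<open>With \<open>F0\<close> and \<open>F1\<close> both expanded about the left end point, the
  contributions \<open>F2 t * k / 2\<close> cancel; each of the two remainders is at most
  \<open>M * k\<^sup>2 / 2\<close>.\<close>

lemma trapezoid_difference:
  fixes F0 F1 F2 F3 :: "real \<Rightarrow> real"
  assumes d: "\<And>x. x \<in> {a..b} \<Longrightarrow> (F0 has_real_derivative F1 x) (at x within {a..b})"
    "\<And>x. x \<in> {a..b} \<Longrightarrow> (F1 has_real_derivative F2 x) (at x within {a..b})"
    "\<And>x. x \<in> {a..b} \<Longrightarrow> (F2 has_real_derivative F3 x) (at x within {a..b})"
    "\<And>x. x \<in> {a..b} \<Longrightarrow> \<bar>F3 x\<bar> \<le> M"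
    and "0 < k" "a \<le> t" "t + k \<le> b"
  shows "\<bar>(F0 (t + k) - F0 t) / k - (F1 t + F1 (t + k)) / 2\<bar> \<le> M * k\<^sup>2"
proof -
  have "\<bar>F0 (t + k) - (F0 t + F1 t * (t + k - t) + F2 t * (t + k - t)\<^sup>2 / 2)\<bar>
      \<le> M * \<bar>t + k - t\<bar> ^ 3 / 2"
    by (rule taylor_3[OF d]) (use assms in auto)
  then have 1: "\<bar>F0 (t + k) - F0 t - F1 t * k - F2 t * k\<^sup>2 / 2\<bar> \<le> M * k ^ 3 / 2"
    using \<open>0 < k\<close> by (simp add: algebra_simps)
  have "\<bar>F1 (t + k) - (F1 t + F2 t * (t + k - t))\<bar> \<le> M * \<bar>t + k - t\<bar>\<^sup>2"
    by (rule taylor_2[OF d(2-)]) (use assms in auto)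
  then have 2: "\<bar>F1 (t + k) - F1 t - F2 t * k\<bar> \<le> M * k\<^sup>2"
    by (simp add: algebra_simps)
  have eq: "(F0 (t + k) - F0 t) / k - (F1 t + F1 (t + k)) / 2
      = (F0 (t + k) - F0 t - F1 t * k - F2 t * k\<^sup>2 / 2) / k - (F1 (t + k) - F1 t - F2 t * k) / 2"
    using \<open>0 < k\<close> by (simp add: field_simps power2_eq_square)
  have "\<bar>(F0 (t + k) - F0 t - F1 t * k - F2 t * k\<^sup>2 / 2) / k\<bar> \<le> M * k\<^sup>2 / 2"
    using 1 \<open>0 < k\<close> by (simp add: abs_divide pos_divide_le_eq power3_eq_cube power2_eq_square mult.assoc)
  with 2 show ?thesis
    unfolding eq by argo
qed

text \<open>The value at \<open>t - k\<close> cancels, and the weights 1, -2, 2, -1 left at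
  \<open>t + k\<close>, \<open>t\<close>, \<open>t - 2 * k\<close>, \<open>t - 3 * k\<close>
  annihilate quadratic polynomials. The Taylor remainders about \<open>t\<close> add up to 1/2 + 8 +
  27/2 = 22, rounded up to 24 because the formula is used with k = \<tau>/2, where the constant
  becomes 3.\<close>

lemma third_difference:
  fixes F0 F1 F2 F3 :: "real \<Rightarrow> real"
  assumes d: "\<And>x. x \<in> {a..b} \<Longrightarrow> (F0 has_real_derivative F1 x) (at x within {a..b})"
    "\<And>x. x \<in> {a..b} \<Longrightarrow> (F1 has_real_derivative F2 x) (at x within {a..b})"
    "\<And>x. x \<in> {a..b} \<Longrightarrow> (F2 has_real_derivative F3 x) (at x within {a..b})"
    "\<And>x. x \<in> {a..b} \<Longrightarrow> \<bar>F3 x\<bar> \<le> M"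
    and "0 < k" "a \<le> t - 3 * k" "t + k \<le> b"
  shows "\<bar>(F0 (t + k) + F0 (t - k) - 2 * F0 t) - (F0 (t - k) + F0 (t - 3 * k) - 2 * F0 (t - 2 * k))\<bar>
    \<le> 24 * M * k ^ 3"
proof -
  have T: "\<bar>F0 (t + m * k) - F0 t - m * (F1 t * k) - m\<^sup>2 * (F2 t * k\<^sup>2) / 2\<bar> \<le> \<bar>m\<bar> ^ 3 * (M * k ^ 3) / 2"
    if "m \<in> {-3, -2, 1}" for m
  proof -
    have "\<bar>F0 (t + m * k) - (F0 t + F1 t * (t + m * k - t) + F2 t * (t + m * k - t)\<^sup>2 / 2)\<bar>
      \<le> M * \<bar>t + m * k - t\<bar> ^ 3 / 2"
      by (rule taylor_3[OF d]) (use assms that in auto)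
    then show ?thesis
      using \<open>0 < k\<close> by (simp add: algebra_simps power_mult_distrib abs_mult)
  qed
  have aux: "\<bar>p + q - 2 * c - (q + s - 2 * r)\<bar> \<le> 24 * m"
    if "\<bar>p - c - x - y / 2\<bar> \<le> m / 2" "\<bar>r - c + 2 * x - 2 * y\<bar> \<le> 4 * m"
      "\<bar>s - c + 3 * x - 9 * y / 2\<bar> \<le> 27 * m / 2" "0 \<le> m" for p q r s c x y m :: real
    using that unfolding abs_le_iff by (intro conjI; linarith)
  have t0: "0 \<le> M * k ^ 3"
    using order_trans[OF abs_ge_zero d(4)[of t]] assms by simp
  have t1: "\<bar>F0 (t + k) - F0 t - F1 t * k - F2 t * k\<^sup>2 / 2\<bar> \<le> M * k ^ 3 / 2"
    using T[of 1] by simp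
  have t2: "\<bar>F0 (t - 2 * k) - F0 t + 2 * (F1 t * k) - 2 * (F2 t * k\<^sup>2)\<bar> \<le> 4 * (M * k ^ 3)"
    using T[of "-2"] by simp
  have t3: "\<bar>F0 (t - 3 * k) - F0 t + 3 * (F1 t * k) - 9 * (F2 t * k\<^sup>2) / 2\<bar>
      \<le> 27 * (M * k ^ 3) / 2"
    using T[of "-3"] by simp
  show ?thesis
    using aux[OF t1 t2 t3 t0, of "F0 (t - k)"] by (simp only: mult.assoc)
qed

text \<open>Odd order terms cancel by symmetry, and the two fourth order remainders are
  \<open>M * h ^ 4 / 6\<close> each.\<close>

lemma second_difference_quotient:
  fixes F0 F1 F2 F3 F4 :: "real \<Rightarrow> real"
  assumes d: "\<And>x. x \<in> {a..b} \<Longrightarrow> (F0 has_real_derivative F1 x) (at x within {a..b})"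
    "\<And>x. x \<in> {a..b} \<Longrightarrow> (F1 has_real_derivative F2 x) (at x within {a..b})"
    "\<And>x. x \<in> {a..b} \<Longrightarrow> (F2 has_real_derivative F3 x) (at x within {a..b})"
    "\<And>x. x \<in> {a..b} \<Longrightarrow> (F3 has_real_derivative F4 x) (at x within {a..b})"
    "\<And>x. x \<in> {a..b} \<Longrightarrow> \<bar>F4 x\<bar> \<le> M"
    and "0 < h" "a \<le> x - h" "x + h \<le> b"
  shows "\<bar>(F0 (x - h) - 2 * F0 x + F0 (x + h)) / h\<^sup>2 - F2 x\<bar> \<le> M * h\<^sup>2"
proof -
  have T: "\<bar>F0 (x + m * h) - F0 x - m * (F1 x * h) - m\<^sup>2 * (F2 x * h\<^sup>2) / 2
      - m ^ 3 * (F3 x * h ^ 3) / 6\<bar>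
      \<le> \<bar>m\<bar> ^ 4 * (M * h ^ 4) / 6" if "m \<in> {-1, 1}" for m
  proof -
    have "\<bar>F0 (x + m * h) - (F0 x + F1 x * (x + m * h - x) + F2 x * (x + m * h - x)\<^sup>2 / 2
        + F3 x * (x + m * h - x) ^ 3 / 6)\<bar> \<le> M * \<bar>x + m * h - x\<bar> ^ 4 / 6"
      by (rule taylor_4[OF d]) (use assms that in auto)
    then show ?thesis
      using \<open>0 < h\<close> by (simp add: algebra_simps power_mult_distrib abs_mult)
  qed
  have aux: "\<bar>p - 2 * c + q - y\<bar> \<le> m"
    if "\<bar>p - c + x - y / 2 + z / 6\<bar> \<le> m / 6" "\<bar>q - c - x - y / 2 - z / 6\<bar> \<le> m / 6"
      "0 \<le> m" for p q c x y z m :: real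
    using that unfolding abs_le_iff by (intro conjI; linarith)
  have t0: "0 \<le> M * h ^ 4"
    using order_trans[OF abs_ge_zero d(5)[of x]] assms by simp
  have t2: "\<bar>F0 (x + h) - F0 x - F1 x * h - F2 x * h\<^sup>2 / 2 - F3 x * h ^ 3 / 6\<bar> \<le> M * h ^ 4 / 6"
    using T[of 1] by simp
  have t1: "\<bar>F0 (x - h) - F0 x + F1 x * h - F2 x * h\<^sup>2 / 2 + F3 x * h ^ 3 / 6\<bar> \<le> M * h ^ 4 / 6"
    using T[of "-1"] by simp
  have "\<bar>F0 (x - h) - 2 * F0 x + F0 (x + h) - F2 x * h\<^sup>2\<bar> \<le> M * h ^ 4"
    by (rule aux[OF t1 t2 t0])
  moreover have "M * h ^ 4 / h\<^sup>2 = M * h\<^sup>2"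
    using \<open>0 < h\<close> by (simp add: field_simps flip: power_add)
  ultimately have "\<bar>F0 (x - h) - 2 * F0 x + F0 (x + h) - F2 x * h\<^sup>2\<bar> / h\<^sup>2 \<le> M * h\<^sup>2"
    by (metis divide_right_mono zero_le_power2)
  moreover have "(F0 (x - h) - 2 * F0 x + F0 (x + h)) / h\<^sup>2 - F2 x
      = (F0 (x - h) - 2 * F0 x + F0 (x + h) - F2 x * h\<^sup>2) / h\<^sup>2"
    using \<open>0 < h\<close> by (simp add: field_simps)
  ultimately show ?thesis
    by simp
qed

section \<open>The mollifier\<close>

lemma order_eq_Suc_order_pderiv:
  fixes q :: "real poly"
  assumes "q \<noteq> 0" "poly q a = 0"
  shows "pderiv q \<noteq> 0" "order a q = Suc (order a (pderiv q))"
proof -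
  show "pderiv q \<noteq> 0"
  proof
    assume "pderiv q = 0"
    then obtain c where "q = [:c:]"
      using pderiv_eq_0_iff degree_eq_zeroE by blast
    with assms show False
      by simp
  qed
  then show "order a q = Suc (order a (pderiv q))"
    using assms by (intro order_pderiv) (auto simp: order_root)
qed

lemma order_ge_4:
  fixes q :: "real poly"
  assumes "q \<noteq> 0" "poly q a = 0" "poly (pderiv q) a = 0" "poly (pderiv (pderiv q)) a = 0"
    "poly (pderiv (pderiv (pderiv q))) a = 0"
  shows "4 \<le> order a q"
  using order_eq_Suc_order_pderiv assms by simp

text \<open>Both nodes would be zeros of order at least four; splitting off the fourth power of one
  linear factor leaves a polynomial that still has a fourfold zero at the other node, so a nonzero
  \<open>q\<close> would have degree at least eight.\<close>

lemma hermite_unique: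
  fixes q :: "real poly"
  assumes "degree q \<le> 7" "a \<noteq> b"
    and "poly q a = 0" "poly (pderiv q) a = 0" "poly (pderiv (pderiv q)) a = 0"
      "poly (pderiv (pderiv (pderiv q))) a = 0"
    and "poly q b = 0" "poly (pderiv q) b = 0" "poly (pderiv (pderiv q)) b = 0"
      "poly (pderiv (pderiv (pderiv q))) b = 0"
  shows "q = 0"
proof (rule ccontr)
  assume "q \<noteq> 0"
  then have ord: "4 \<le> order a q" "4 \<le> order b q"
    using assms by (auto intro: order_ge_4)
  then have "[:-a, 1:] ^ 4 dvd q"
    by (meson dvd_trans le_imp_power_dvd order_1)
  then obtain r where r: "q = [:-a, 1:] ^ 4 * r"
    by (elim dvdE)
  with \<open>q \<noteq> 0\<close> have "r \<noteq> 0"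
    by auto
  have "poly ([:-a, 1:] ^ 4) b \<noteq> 0"
    using \<open>a \<noteq> b\<close> by simp
  then have "order b ([:-a, 1:] ^ 4) = 0"
    by (rule order_0I)
  then have "4 \<le> order b r"
    using ord(2) \<open>q \<noteq> 0\<close> unfolding r by (simp add: order_mult)
  then have "4 \<le> degree r"
    using order_degree[OF \<open>r \<noteq> 0\<close>] le_trans by blast
  moreover have "degree q = 4 + degree r"
    using \<open>r \<noteq> 0\<close> unfolding r by (simp add: degree_mult_eq degree_power_eq)
  ultimately show False
    using assms(1) by simp
qed

text \<open>The definite description in \<open>mollifier_poly\<close> says nothing until existence
  and uniqueness are known: existence comes from an explicit polynomial, uniqueness from
  \<open>hermite_unique\<close> applied to a difference.\<close>

lemma mollifier_poly_interpolates:
  assumes "0 < \<delta>"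
  defines "p \<equiv> mollifier_poly \<delta>"
  shows "poly p \<delta> = \<delta>" "poly (pderiv p) \<delta> = 1" "poly (pderiv (pderiv p)) \<delta> = 0"
    "poly p (2 * \<delta>) = 2 * \<delta>" "poly (pderiv p) (2 * \<delta>) = 0" "poly (pderiv (pderiv p)) (2 * \<delta>) = 0"
proof -
  define P where "P p \<longleftrightarrow> degree p \<le> 7 \<and>
    poly p \<delta> = \<delta> \<and> poly (pderiv p) \<delta> = 1 \<and>
    poly (pderiv (pderiv p)) \<delta> = 0 \<and> poly (pderiv (pderiv (pderiv p))) \<delta> = 0 \<and>
    poly p (2 * \<delta>) = 2 * \<delta> \<and> poly (pderiv p) (2 * \<delta>) = 0 \<and>
    poly (pderiv (pderiv p)) (2 * \<delta>) = 0 \<and> poly (pderiv (pderiv (pderiv p))) (2 * \<delta>) = 0"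
    for p :: "real poly"
  (* q is the Hermite interpolant for \<delta> = 1 in the variable s = (x - \<delta>) / \<delta>. *)
  define q s where "q = ([:1, 1, 0, 0, 15, -39, 34, -10:] :: real poly)"
    and "s = [:-1, 1 / \<delta>:]"
  have s: "poly s \<delta> = 0" "poly s (2 * \<delta>) = 1" "pderiv s = [:1 / \<delta>:]"
    using \<open>0 < \<delta>\<close> by (simp_all add: s_def pderiv_pCons field_simps)
  have q: "pderiv q = [:1, 0, 0, 60, -195, 204, -70:]"
    "pderiv (pderiv q) = [:0, 0, 180, -780, 1020, -420:]"
    "pderiv (pderiv (pderiv q)) = [:0, 360, -2340, 4080, -2100:]"
    by (simp_all add: q_def pderiv_pCons)
  \<comment> \<open>The outer factor \<delta> compensates the inner slope 1/\<delta>, so first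
    derivatives are those of \<open>q\<close>.\<close>
  define w where "w = smult \<delta> (q \<circ>\<^sub>p s)"
  have w: "pderiv w = pderiv q \<circ>\<^sub>p s"
    using \<open>0 < \<delta>\<close> by (simp add: w_def pderiv_smult pderiv_pcompose s(3))
  have "degree s \<le> 1"
    by (simp add: s_def)
  then have "degree w \<le> 7"
    using \<open>0 < \<delta>\<close> mult_le_mono2[of "degree s" 1 7] by (simp add: w_def degree_pcompose q_def)
  moreover have "poly w \<delta> = \<delta>" "poly w (2 * \<delta>) = 2 * \<delta>"
    by (simp_all add: w_def poly_pcompose s) (simp_all add: q_def)
  ultimately have "P w"
    using \<open>0 < \<delta>\<close> unfolding P_def by (simp add: w pderiv_pcompose pderiv_smult poly_pcompose s) (simp add: q pderiv_pCons)
  moreover have "v = w" if "P v" for v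
  proof -
    have "degree (v - w) \<le> 7"
      using that \<open>P w\<close> unfolding P_def by (meson degree_diff_le)
    then have "v - w = 0"
      using that \<open>P w\<close> \<open>0 < \<delta>\<close> unfolding P_def
      by (intro hermite_unique[of _ \<delta> "2 * \<delta>"]) (simp_all add: pderiv_diff)
    then show ?thesis
      by simp
  qed
  ultimately have "P (THE p. P p)"
    by (rule theI)
  moreover have "p = (THE p. P p)"
    unfolding p_def mollifier_poly_def P_def ..
  ultimately have "P p"
    by simp
  then show "poly p \<delta> = \<delta>" "poly (pderiv p) \<delta> = 1" "poly (pderiv (pderiv p)) \<delta> = 0"
    "poly p (2 * \<delta>) = 2 * \<delta>" "poly (pderiv p) (2 * \<delta>) = 0" "poly (pderiv (pderiv p)) (2 * \<delta>) = 0"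
    unfolding P_def by simp_all
qed

section \<open>Global bounds for the mollifier and the mollified nonlinearity\<close>

lemma mollifier_id: "0 < \<delta> \<Longrightarrow> \<bar>x\<bar> \<le> \<delta> \<Longrightarrow> mollifier \<delta> x = x"
  by (auto simp: mollifier_def mollifier_pos_def)

lemma continuous_bounded_interval:
  fixes F :: "real \<Rightarrow> real"
  assumes "continuous_on {a..b} F"
  obtains B where "0 \<le> B" "\<And>x. x \<in> {a..b} \<Longrightarrow> \<bar>F x\<bar> \<le> B"
proof -
  have "bounded (F ` {a..b})"
    using assms by (intro compact_imp_bounded compact_continuous_image) auto
  then obtain B where "0 < B" "\<forall>y\<in>F ` {a..b}. norm y \<le> B"
    using bounded_pos by blast
  with that[of B] show ?thesis
    by auto
qed

lemma mollifier_twice_differentiable: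
  assumes "0 < \<delta>"
  obtains m' m'' B where "\<And>x. (mollifier \<delta> has_real_derivative m' x) (at x)"
    "\<And>x. (m' has_real_derivative m'' x) (at x)"
    "\<And>x. \<bar>mollifier \<delta> x\<bar> \<le> B" "\<And>x. \<bar>m' x\<bar> \<le> B" "\<And>x. \<bar>m'' x\<bar> \<le> B"
proof -
  define p where "p = mollifier_poly \<delta>"
  note interp = mollifier_poly_interpolates[OF assms, folded p_def]
  \<comment> \<open>\<open>R\<close> continues the pieces from the positive axis as an odd function,
    \<open>S\<close> as an even one. Differentiation swaps parity, so the mollifier and its second
    derivative have the form \<open>R\<close> and its first derivative the form
    \<open>S\<close>.\<close>
  define R where "R F1 F2 F3 x = (if x \<le> - 2 * \<delta> then - F3 else if x \<le> - \<delta> then - F2 (- x)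
    else if x \<le> \<delta> then F1 x else if x \<le> 2 * \<delta> then F2 x else F3)"
    for F1 F2 :: "real \<Rightarrow> real" and F3 x :: real
  define S where "S F1 F2 x = (if x \<le> - 2 * \<delta> then 0 else if x \<le> - \<delta> then F2 (- x)
    else if x \<le> \<delta> then F1 else if x \<le> 2 * \<delta> then F2 x else 0)"
    for F1 x :: real and F2 :: "real \<Rightarrow> real"
  have p': "((\<lambda>x. poly q (- x)) has_real_derivative - poly (pderiv q) (- x)) (at x)"
    for q :: "real poly" and x
    by (rule DERIV_cong[OF DERIV_chain2[OF poly_DERIV]]) (auto intro!: derivative_eq_intros)
  \<comment> \<open>At -\<delta> and -2\<delta> the two sides select different branches; the
    interpolation conditions make these agree.\<close>
  have "mollifier \<delta> x = R (\<lambda>x. x) (poly p) (2 * \<delta>) x" for x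
    using assms interp unfolding p_def
    by (cases "x = - \<delta>"; cases "x = - (2 * \<delta>)") (auto simp: R_def mollifier_def mollifier_pos_def not_le)
  then have moll: "mollifier \<delta> = R (\<lambda>x. x) (poly p) (2 * \<delta>)"
    by blast
  have 1: "(mollifier \<delta> has_real_derivative S 1 (poly (pderiv p)) x) (at x)" for x
    unfolding moll R_def S_def
    by (intro has_real_derivative_glue poly_DERIV)
      (use assms interp p'[of p] in \<open>auto intro!: derivative_eq_intros\<close>)
  have 2: "(S 1 (poly (pderiv p)) has_real_derivative R (\<lambda>_. 0) (poly (pderiv (pderiv p))) 0 x) (at x)" for x
    unfolding R_def S_def
    by (intro has_real_derivative_glue poly_DERIV p')
      (use assms interp in \<open>auto intro!: derivative_eq_intros\<close>)
  have cont: "continuous_on X (poly q)" for X :: "real set" and q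
    by (intro continuous_at_imp_continuous_on ballI DERIV_isCont[OF poly_DERIV])
  obtain B0 where B0: "0 \<le> B0" "\<And>x. x \<in> {\<delta>..2 * \<delta>} \<Longrightarrow> \<bar>poly p x\<bar> \<le> B0"
    by (rule continuous_bounded_interval[of \<delta> "2 * \<delta>" "poly p"]) (use cont in auto)
  obtain B1 where B1: "0 \<le> B1" "\<And>x. x \<in> {\<delta>..2 * \<delta>} \<Longrightarrow> \<bar>poly (pderiv p) x\<bar> \<le> B1"
    by (rule continuous_bounded_interval[of \<delta> "2 * \<delta>" "poly (pderiv p)"]) (use cont in auto)
  obtain B2 where B2: "0 \<le> B2" "\<And>x. x \<in> {\<delta>..2 * \<delta>} \<Longrightarrow> \<bar>poly (pderiv (pderiv p)) x\<bar> \<le> B2"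
    by (rule continuous_bounded_interval[of \<delta> "2 * \<delta>" "poly (pderiv (pderiv p))"]) (use cont in auto)
  let ?B = "B0 + B1 + B2 + 2 * \<delta> + 1"
  have "\<bar>mollifier \<delta> x\<bar> \<le> ?B" for x
    using B0(2)[of x] B0(2)[of "- x"] B0(1) B1(1) B2(1) assms unfolding moll R_def by auto
  moreover have "\<bar>S 1 (poly (pderiv p)) x\<bar> \<le> ?B" for x
    using B1(2)[of x] B1(2)[of "- x"] B0(1) B1(1) B2(1) assms unfolding S_def by auto
  moreover have "\<bar>R (\<lambda>_. 0) (poly (pderiv (pderiv p))) 0 x\<bar> \<le> ?B" for x
    using B2(2)[of x] B2(2)[of "- x"] B0(1) B1(1) B2(1) assms unfolding R_def by auto
  ultimately show ?thesis
    by (rule that[OF 1 2])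
qed

text \<open>The mollifier takes its values in the compact interval \<open>{- B..B}\<close>, on which
  g' and g'' are bounded by continuity. Applying the chain rule twice then bounds the first two
  derivatives of the composition on the whole line.\<close>

lemma mollified_nonlinearity_bounds:
  fixes g g' g'' :: "real \<Rightarrow> real"
  assumes "0 < \<delta>" and g: "\<And>x. (g has_real_derivative g' x) (at x)"
    and g': "\<And>x. (g' has_real_derivative g'' x) (at x)" and "continuous_on UNIV g''"
  obtains K where "0 \<le> K"
    "\<And>x y. \<bar>g (mollifier \<delta> x) - g (mollifier \<delta> y)\<bar> \<le> K * \<bar>x - y\<bar>"
    "\<And>a b c d. \<bar>g (mollifier \<delta> a) - g (mollifier \<delta> b) - (g (mollifier \<delta> c) - g (mollifier \<delta> d))\<bar>
      \<le> K * (\<bar>a - b - (c - d)\<bar> + (\<bar>a - c\<bar> + \<bar>b - d\<bar>) * \<bar>a - b\<bar>)"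
proof -
  obtain m' m'' B where m: "\<And>x. (mollifier \<delta> has_real_derivative m' x) (at x)"
    "\<And>x. (m' has_real_derivative m'' x) (at x)"
    and B: "\<And>x. \<bar>mollifier \<delta> x\<bar> \<le> B" "\<And>x. \<bar>m' x\<bar> \<le> B" "\<And>x. \<bar>m'' x\<bar> \<le> B"
    using mollifier_twice_differentiable[OF \<open>0 < \<delta>\<close>] by blast
  have in_B: "mollifier \<delta> x \<in> {- B..B}" for x
    using B(1)[of x] by auto
  have "continuous_on {- B..B} g'"
    using g' DERIV_isCont continuous_at_imp_continuous_on by blast
  then obtain A1 where A1: "0 \<le> A1" "\<And>x. x \<in> {- B..B} \<Longrightarrow> \<bar>g' x\<bar> \<le> A1"
    using continuous_bounded_interval by blast
  have "continuous_on {- B..B} g''"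
    using assms(4) continuous_on_subset by blast
  then obtain A2 where A2: "0 \<le> A2" "\<And>x. x \<in> {- B..B} \<Longrightarrow> \<bar>g'' x\<bar> \<le> A2"
    using continuous_bounded_interval by blast
  have "0 \<le> B"
    using B(1)[of 0] by simp
  define G' where "G' x = g' (mollifier \<delta> x) * m' x" for x
  define G'' where "G'' x = (g'' (mollifier \<delta> x) * m' x) * m' x + g' (mollifier \<delta> x) * m'' x" for x
  have 1: "((\<lambda>x. g (mollifier \<delta> x)) has_real_derivative G' x) (at x)" for x
    unfolding G'_def by (rule DERIV_chain2[OF g m(1)])
  have 2: "(G' has_real_derivative G'' x) (at x)" for x
    unfolding G'_def G''_def
    by (rule DERIV_cong[OF DERIV_mult[OF DERIV_chain2[OF g' m(1)] m(2)]]) (simp add: algebra_simps)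
  define K where "K = A1 * B + A2 * B * B"
  have "\<bar>G' x\<bar> \<le> K" for x
  proof -
    have "\<bar>G' x\<bar> \<le> A1 * B"
      unfolding G'_def abs_mult using A1 B in_B \<open>0 \<le> B\<close> by (intro mult_mono) auto
    also have "\<dots> \<le> K"
      unfolding K_def using A2 \<open>0 \<le> B\<close> by simp
    finally show ?thesis .
  qed
  moreover have "\<bar>G'' x\<bar> \<le> K" for x
  proof -
    have "\<bar>G'' x\<bar> \<le> \<bar>(g'' (mollifier \<delta> x) * m' x) * m' x\<bar> + \<bar>g' (mollifier \<delta> x) * m'' x\<bar>"
      unfolding G''_def by (rule abs_triangle_ineq)
    also have "\<dots> \<le> A2 * B * B + A1 * B"
      unfolding abs_mult using A1 A2 B in_B \<open>0 \<le> B\<close> by (intro mult_mono add_mono) auto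
    finally show ?thesis
      unfolding K_def by simp
  qed
  moreover have "0 \<le> K"
    unfolding K_def using A1 A2 \<open>0 \<le> B\<close> by simp
  ultimately show ?thesis
    using bounded_derivative_lipschitz[OF 1] second_difference_bound[OF 1 2] by (intro that) auto
qed

section \<open>Discrete operators on the mesh\<close>

lemma summation_by_parts:
  fixes v w :: "nat \<Rightarrow> real"
  assumes "w 0 = 0" "w (J + 1) = 0"
  shows "(\<Sum>i=1..J. (v (i - 1) - 2 * v i + v (i + 1)) * w i)
    = - (\<Sum>i=0..J. (v (i + 1) - v i) * (w (i + 1) - w i))"
proof -
  \<comment> \<open>The boundary term at \<open>J + 1\<close> is kept because the induction on
    \<open>J\<close> moves this end point; only the condition at 0 stays fixed.\<close>
  have "(\<Sum>i=1..J. (v (i - 1) - 2 * v i + v (i + 1)) * w i)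
      = (v (J + 1) - v J) * w (J + 1) - (\<Sum>i=0..J. (v (i + 1) - v i) * (w (i + 1) - w i))"
    using assms(1) by (induction J) (simp_all add: algebra_simps)
  with assms(2) show ?thesis
    by simp
qed

text \<open>Telescoping from the zero boundary value and the Cauchy-Schwarz inequality. The factor
  \<open>h * (real J + 1)\<close> is the length of the grid line, so the bound is uniform in the
  mesh.\<close>

lemma square_le_sum_difference_quotients:
  fixes v :: "nat \<Rightarrow> real"
  assumes "v 0 = 0" "i \<le> J + 1" "0 < h"
  shows "(v i)\<^sup>2 \<le> (h * (real J + 1)) * (h * (\<Sum>k=0..J. ((v (k + 1) - v k) / h)\<^sup>2))"
proof -
  have "v i = (\<Sum>k<i. v (k + 1) - v k)"
    using assms(1) by (simp add: sum_lessThan_telescope)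
  then have "(v i)\<^sup>2 \<le> (\<Sum>k<i. (v (k + 1) - v k)\<^sup>2) * real i"
    using sum_squared_le_sum_of_squares[of "\<lambda>k. v (k + 1) - v k" "{..<i}"] by simp
  also have "\<dots> \<le> (\<Sum>k=0..J. (v (k + 1) - v k)\<^sup>2) * (real J + 1)"
    using assms(2) by (intro mult_mono sum_mono2) (auto intro: sum_nonneg)
  also have "\<dots> = (h * (real J + 1)) * (h * (\<Sum>k=0..J. ((v (k + 1) - v k) / h)\<^sup>2))"
    using \<open>0 < h\<close> by (simp add: power_divide power2_eq_square flip: sum_divide_distrib)
  finally show ?thesis .
qed

section \<open>Discrete norms on the rectangle, Poincare and Sobolev inequalities\<close>

locale mesh =
  fixes J1 J2 :: nat and h1 h2 :: real
  assumes h_pos: "0 < h1" "0 < h2"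
begin

text \<open>The estimates are carried out for squared norms, which are quadratic forms; square roots
  are taken only when the final bounds are stated.\<close>

definition sq0 :: "grid_fun \<Rightarrow> real"
  where "sq0 V = h1 * h2 * (\<Sum>(i, j)\<in>interior_idx J1 J2. (V i j)\<^sup>2)"

definition sq1 :: "grid_fun \<Rightarrow> real"
  where "sq1 V = h1 * h2 * (\<Sum>j=1..J2. \<Sum>i=0..J1. ((V (i + 1) j - V i j) / h1)\<^sup>2) +
     h1 * h2 * (\<Sum>i=1..J1. \<Sum>j=0..J2. ((V i (j + 1) - V i j) / h2)\<^sup>2)"

lemma norm0H_eq: "norm0H J1 J2 h1 h2 V = sqrt (sq0 V)"
  by (simp add: norm0H_def sq0_def)

lemma norm1H_eq: "norm1H J1 J2 h1 h2 V = sqrt (sq1 V)"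
  unfolding norm1H_def sq1_def power2_abs ..

lemma sq0_nonneg: "0 \<le> sq0 V"
  using h_pos by (auto simp: sq0_def intro!: sum_nonneg mult_nonneg_nonneg)

lemma sq1_nonneg: "0 \<le> sq1 V"
  using h_pos by (auto simp: sq1_def intro!: sum_nonneg mult_nonneg_nonneg add_nonneg_nonneg)

lemma sum_interior_idx:
  "(\<Sum>(i, j)\<in>interior_idx J1 J2. F i j) = (\<Sum>i=1..J1. \<Sum>j=1..J2. F i j)"
  by (simp add: interior_idx_def sum.cartesian_product)

lemma sum_interior_idx_swap:
  "(\<Sum>(i, j)\<in>interior_idx J1 J2. F i j) = (\<Sum>j=1..J2. \<Sum>i=1..J1. F i j)"
  unfolding sum_interior_idx by (rule sum.swap)

lemma sq0_eq_0D:
  assumes "sq0 V \<le> 0" "(i, j) \<in> interior_idx J1 J2"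
  shows "V i j = 0"
proof -
  have "(\<Sum>p\<in>interior_idx J1 J2. (V (fst p) (snd p))\<^sup>2) = 0"
    using assms(1) sq0_nonneg[of V] h_pos by (simp add: sq0_def case_prod_unfold)
  then have "\<forall>p\<in>interior_idx J1 J2. (V (fst p) (snd p))\<^sup>2 = 0"
    by (subst (asm) sum_nonneg_eq_0_iff) (auto simp: interior_idx_def)
  with assms(2) show ?thesis
    by fastforce
qed

lemma grid_space_boundary:
  assumes "V \<in> grid_space J1 J2"
  shows "V 0 j = 0" "V i 0 = 0" "V (J1 + 1) j = 0" "V i (J2 + 1) = 0" "V (Suc J1) j = 0" "V i (Suc J2) = 0"
  using assms by (auto simp: grid_space_def interior_idx_def)

text \<open>Summation by parts acts row by row in one direction and column by column in the other,
  hence the two orders of summation. The zero boundary values of \<open>W\<close> remove the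
  boundary terms.\<close>

lemma laplacian_by_parts:
  assumes "W \<in> grid_space J1 J2"
  shows "(\<Sum>(i, j)\<in>interior_idx J1 J2. discrete_laplacian J1 J2 h1 h2 V i j * W i j)
    = - ((\<Sum>j=1..J2. \<Sum>i=0..J1. (V (i + 1) j - V i j) / h1 * ((W (i + 1) j - W i j) / h1))
       + (\<Sum>i=1..J1. \<Sum>j=0..J2. (V i (j + 1) - V i j) / h2 * ((W i (j + 1) - W i j) / h2)))"
proof -
  have quotient: "(\<Sum>i=1..J. (v (i - 1) - 2 * v i + v (i + 1)) * w i / h\<^sup>2)
      = - (\<Sum>i=0..J. (v (i + 1) - v i) / h * ((w (i + 1) - w i) / h))"
    if "w 0 = 0" "w (J + 1) = 0" for v w :: "nat \<Rightarrow> real" and J h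
    using summation_by_parts[OF that] unfolding sum_divide_distrib[symmetric]
    by (simp add: power2_eq_square flip: sum_divide_distrib)
  have "(\<Sum>(i, j)\<in>interior_idx J1 J2. discrete_laplacian J1 J2 h1 h2 V i j * W i j)
      = (\<Sum>(i, j)\<in>interior_idx J1 J2. (V (i - 1) j - 2 * V i j + V (i + 1) j) * W i j / h1\<^sup>2
          + (V i (j - 1) - 2 * V i j + V i (j + 1)) * W i j / h2\<^sup>2)"
    by (rule sum.cong) (auto simp: discrete_laplacian_def distrib_right)
  also have "\<dots> = (\<Sum>(i, j)\<in>interior_idx J1 J2. (V (i - 1) j - 2 * V i j + V (i + 1) j) * W i j / h1\<^sup>2)
      + (\<Sum>(i, j)\<in>interior_idx J1 J2. (V i (j - 1) - 2 * V i j + V i (j + 1)) * W i j / h2\<^sup>2)"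
    by (simp add: case_prod_unfold sum.distrib)
  also have "(\<Sum>(i, j)\<in>interior_idx J1 J2. (V (i - 1) j - 2 * V i j + V (i + 1) j) * W i j / h1\<^sup>2)
      = (\<Sum>j=1..J2. - (\<Sum>i=0..J1. (V (i + 1) j - V i j) / h1 * ((W (i + 1) j - W i j) / h1)))"
    unfolding sum_interior_idx_swap
    using grid_space_boundary[OF assms] by (intro sum.cong refl quotient) auto
  also have "(\<Sum>(i, j)\<in>interior_idx J1 J2. (V i (j - 1) - 2 * V i j + V i (j + 1)) * W i j / h2\<^sup>2)
      = (\<Sum>i=1..J1. - (\<Sum>j=0..J2. (V i (j + 1) - V i j) / h2 * ((W i (j + 1) - W i j) / h2)))"
    unfolding sum_interior_idx
    using grid_space_boundary[OF assms] by (intro sum.cong refl quotient) auto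
  finally show ?thesis
    by (simp add: sum_negf)
qed

lemma laplacian_energy:
  assumes "V \<in> grid_space J1 J2"
  shows "h1 * h2 * (\<Sum>(i, j)\<in>interior_idx J1 J2. discrete_laplacian J1 J2 h1 h2 V i j * V i j) = - sq1 V"
  unfolding laplacian_by_parts[OF assms] sq1_def by (simp add: power2_eq_square algebra_simps)

text \<open>Average times difference is half a difference of squares, applied to each difference
  quotient: this makes the Crank-Nicolson step telescope in the discrete H1 norm.\<close>

lemma laplacian_energy_difference:
  assumes "V \<in> grid_space J1 J2" "W \<in> grid_space J1 J2"
  shows "h1 * h2 * (\<Sum>(i, j)\<in>interior_idx J1 J2.
      discrete_laplacian J1 J2 h1 h2 (\<lambda>k l. (W k l + V k l) / 2) i j * (W i j - V i j))
    = (sq1 V - sq1 W) / 2"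
proof -
  have Z: "(\<lambda>i j. W i j - V i j) \<in> grid_space J1 J2"
    using assms by (auto simp: grid_space_def)
  have eq: "((w' + v') / 2 - (w + v) / 2) / h * ((w' - v' - (w - v)) / h)
      = (((w' - w) / h)\<^sup>2 - ((v' - v) / h)\<^sup>2) / 2" for w w' v v' h :: real
  proof (cases "h = 0")
    case False
    then show ?thesis
      by (simp add: field_simps power2_eq_square)
  qed simp
  show ?thesis
    unfolding laplacian_by_parts[OF Z] sq1_def eq
    by (simp add: sum_subtractf sum_divide_distrib[symmetric] algebra_simps diff_divide_distrib)
qed

lemma sq1_ge_first:
  "h1 * h2 * (\<Sum>j=1..J2. \<Sum>i=0..J1. ((V (i + 1) j - V i j) / h1)\<^sup>2) \<le> sq1 V"
  using h_pos by (auto simp: sq1_def intro!: sum_nonneg mult_nonneg_nonneg)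

text \<open>Only differences in the first direction enter: every value is bounded along its own
  line, and summing over that line costs its length once more.\<close>

lemma discrete_poincare:
  assumes "V \<in> grid_space J1 J2"
  shows "sq0 V \<le> (h1 * (real J1 + 1))\<^sup>2 * sq1 V"
proof -
  define A where "A = h1 * (real J1 + 1)"
  define S where "S j = (\<Sum>k=0..J1. ((V (k + 1) j - V k j) / h1)\<^sup>2)" for j
  have S: "0 \<le> S j" for j
    unfolding S_def by (simp add: sum_nonneg)
  have A: "0 \<le> A" "h1 * real J1 \<le> A"
    using h_pos by (simp_all add: A_def)
  have "sq0 V = h1 * h2 * (\<Sum>j=1..J2. \<Sum>i=1..J1. (V i j)\<^sup>2)"
    unfolding sq0_def sum_interior_idx_swap ..
  also have "\<dots> \<le> h1 * h2 * (\<Sum>j=1..J2. \<Sum>i=1..J1. A * (h1 * S j))"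
    using h_pos grid_space_boundary[OF assms] unfolding A_def S_def
    by (intro mult_left_mono sum_mono square_le_sum_difference_quotients) auto
  also have "\<dots> = (h1 * real J1) * A * (h1 * h2 * (\<Sum>j=1..J2. S j))"
    by (simp add: sum_distrib_left sum_distrib_right algebra_simps)
  also have "\<dots> \<le> A * A * (h1 * h2 * (\<Sum>j=1..J2. S j))"
    using A S h_pos by (intro mult_right_mono) (auto intro!: mult_nonneg_nonneg sum_nonneg)
  also have "\<dots> \<le> A * A * sq1 V"
    using sq1_ge_first[of V] A unfolding S_def by (intro mult_left_mono) auto
  finally show ?thesis
    by (simp add: A_def power2_eq_square)
qed

text \<open>The value is bounded along both grid lines through \<open>(i, j)\<close>. A line is one
  member of the sum over all parallel lines, and completing that sum to the norm takes the
  transversal mesh width, \<open>h2\<close> in one case and \<open>h1\<close> in the other. Adding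
  both bounds gives the factor \<open>h1 + h2\<close>; the constant is the longer side of the
  rectangle.\<close>

lemma discrete_sobolev:
  assumes "V \<in> grid_space J1 J2"
  shows "(h1 + h2) * (V i j)\<^sup>2 \<le> max (h1 * (real J1 + 1)) (h2 * (real J2 + 1)) * sq1 V"
proof (cases "(i, j) \<in> interior_idx J1 J2")
  case True
  define A B where "A = h1 * (real J1 + 1)" and "B = h2 * (real J2 + 1)"
  define S1 S2 where "S1 = h1 * h2 * (\<Sum>j=1..J2. \<Sum>i=0..J1. ((V (i + 1) j - V i j) / h1)\<^sup>2)"
    and "S2 = h1 * h2 * (\<Sum>i=1..J1. \<Sum>j=0..J2. ((V i (j + 1) - V i j) / h2)\<^sup>2)"
  have pos: "0 \<le> A" "0 \<le> B" "0 \<le> S1" "0 \<le> S2"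
    using h_pos by (auto simp: A_def B_def S1_def S2_def intro!: sum_nonneg mult_nonneg_nonneg)
  have "(V i j)\<^sup>2 \<le> A * (h1 * (\<Sum>k=0..J1. ((V (k + 1) j - V k j) / h1)\<^sup>2))"
    using True h_pos grid_space_boundary[OF assms] unfolding A_def
    by (intro square_le_sum_difference_quotients[of "\<lambda>i. V i j"]) (auto simp: interior_idx_def)
  also have "\<dots> \<le> A * (h1 * (\<Sum>l=1..J2. \<Sum>k=0..J1. ((V (k + 1) l - V k l) / h1)\<^sup>2))"
    using True h_pos pos
    by (intro mult_left_mono member_le_sum[of j "{1..J2}" "\<lambda>l. \<Sum>k=0..J1. ((V (k + 1) l - V k l) / h1)\<^sup>2"])
      (auto simp: interior_idx_def intro: sum_nonneg)
  finally have "h2 * (V i j)\<^sup>2 \<le> h2 * (A * (h1 * (\<Sum>l=1..J2. \<Sum>k=0..J1. ((V (k + 1) l - V k l) / h1)\<^sup>2)))"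
    using h_pos by simp
  also have "\<dots> = A * S1"
    by (simp add: S1_def)
  finally have 1: "h2 * (V i j)\<^sup>2 \<le> A * S1" .
  have "(V i j)\<^sup>2 \<le> B * (h2 * (\<Sum>k=0..J2. ((V i (k + 1) - V i k) / h2)\<^sup>2))"
    using True h_pos grid_space_boundary[OF assms] unfolding B_def
    by (intro square_le_sum_difference_quotients[of "\<lambda>j. V i j"]) (auto simp: interior_idx_def)
  also have "\<dots> \<le> B * (h2 * (\<Sum>l=1..J1. \<Sum>k=0..J2. ((V l (k + 1) - V l k) / h2)\<^sup>2))"
    using True h_pos pos
    by (intro mult_left_mono member_le_sum[of i "{1..J1}" "\<lambda>l. \<Sum>k=0..J2. ((V l (k + 1) - V l k) / h2)\<^sup>2"])
      (auto simp: interior_idx_def intro: sum_nonneg)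
  finally have "h1 * (V i j)\<^sup>2 \<le> h1 * (B * (h2 * (\<Sum>l=1..J1. \<Sum>k=0..J2. ((V l (k + 1) - V l k) / h2)\<^sup>2)))"
    using h_pos by simp
  also have "\<dots> = B * S2"
    by (simp add: S2_def)
  finally have 2: "h1 * (V i j)\<^sup>2 \<le> B * S2" .
  have "(h1 + h2) * (V i j)\<^sup>2 \<le> A * S1 + B * S2"
    using 1 2 by (simp add: distrib_right)
  also have "\<dots> \<le> max A B * S1 + max A B * S2"
    using pos by (intro add_mono mult_right_mono) auto
  also have "\<dots> = max A B * sq1 V"
    by (simp add: sq1_def S1_def S2_def distrib_left)
  finally show ?thesis
    unfolding A_def B_def .
next
  case False
  then have "V i j = 0"
    using assms by (auto simp: grid_space_def)
  moreover have "0 \<le> max (h1 * (real J1 + 1)) (h2 * (real J2 + 1))"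
    using h_pos by (simp add: le_max_iff_disj)
  ultimately show ?thesis
    using sq1_nonneg by simp
qed

section \<open>Unique solvability of the implicit step\<close>

lemma implicit_step_unique:
  assumes "0 < \<kappa>" "X \<in> grid_space J1 J2" "Y \<in> grid_space J1 J2"
    and "\<And>i j. (i, j) \<in> interior_idx J1 J2 \<Longrightarrow>
      X i j - \<kappa> * discrete_laplacian J1 J2 h1 h2 X i j = Y i j - \<kappa> * discrete_laplacian J1 J2 h1 h2 Y i j"
  shows "X = Y"
proof -
  define Z where "Z i j = X i j - Y i j" for i j
  have Z: "Z \<in> grid_space J1 J2"
    using assms(2,3) by (auto simp: grid_space_def Z_def)
  have lap: "discrete_laplacian J1 J2 h1 h2 Z i j
      = discrete_laplacian J1 J2 h1 h2 X i j - discrete_laplacian J1 J2 h1 h2 Y i j" for i j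
    by (simp add: discrete_laplacian_def Z_def algebra_simps diff_divide_distrib add_divide_distrib)
  have "Z i j = \<kappa> * discrete_laplacian J1 J2 h1 h2 Z i j" if "(i, j) \<in> interior_idx J1 J2" for i j
    using assms(4)[OF that] unfolding lap by (simp add: Z_def algebra_simps)
  \<comment> \<open>The homogeneous equation is tested with \<open>Z\<close> itself; the discrete
    Laplacian is negative, so the squared norm of \<open>Z\<close> cannot be positive.\<close>
  then have "(Z i j)\<^sup>2 = \<kappa> * (discrete_laplacian J1 J2 h1 h2 Z i j * Z i j)" if "(i, j) \<in> interior_idx J1 J2" for i j
    using that by (simp add: power2_eq_square)
  then have "sq0 Z = h1 * h2 * (\<Sum>(i, j)\<in>interior_idx J1 J2. \<kappa> * (discrete_laplacian J1 J2 h1 h2 Z i j * Z i j))"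
    unfolding sq0_def by (intro arg_cong2[where f = "(*)"] sum.cong refl) auto
  also have "\<dots> = \<kappa> * (h1 * h2 * (\<Sum>(i, j)\<in>interior_idx J1 J2. discrete_laplacian J1 J2 h1 h2 Z i j * Z i j))"
    by (simp add: sum_distrib_left case_prod_unfold algebra_simps)
  also have "\<dots> \<le> 0"
    unfolding laplacian_energy[OF Z] using sq1_nonneg[of Z] assms(1) by simp
  finally have "Z i j = 0" if "(i, j) \<in> interior_idx J1 J2" for i j
    using sq0_eq_0D that by blast
  then have "Z i j = 0" for i j
    using Z by (auto simp: grid_space_def)
  then show ?thesis
    by (auto simp: Z_def)
qed

text \<open>The Jacobi iteration of the implicit step is a contraction in the maximum norm.\<close>

lemma implicit_step_solvable:
  assumes "0 < \<kappa>"
  obtains X where "X \<in> grid_space J1 J2"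
    "\<And>i j. (i, j) \<in> interior_idx J1 J2 \<Longrightarrow> X i j - \<kappa> * discrete_laplacian J1 J2 h1 h2 X i j = R i j"
proof -
  define c1 c2 where "c1 = \<kappa> / h1\<^sup>2" and "c2 = \<kappa> / h2\<^sup>2"
  have c: "0 < c1" "0 < c2"
    using assms h_pos by (simp_all add: c1_def c2_def)
  define q where "q = 1 + 2 * c1 + 2 * c2"
  have q: "0 < q"
    using c by (simp add: q_def)
  \<comment> \<open>The equation at \<open>p\<close> is solved for its central entry, whose
    coefficient is \<open>q\<close>. Setting the remaining entries to zero keeps all later iterates
    in the grid space.\<close>
  define S where "S x p = (if p \<in> interior_idx J1 J2 then
      (R (fst p) (snd p) + c1 * (x (fst p - 1, snd p) + x (fst p + 1, snd p))
        + c2 * (x (fst p, snd p - 1) + x (fst p, snd p + 1))) / q else 0)"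
    for x :: "nat \<times> nat \<Rightarrow> real" and p
  \<comment> \<open>The sum of the off-diagonal weights over the diagonal entry: strict diagonal
    dominance makes this less than one for every positive \<kappa>.\<close>
  define \<rho> where "\<rho> = (2 * c1 + 2 * c2) / q"
  have \<rho>: "0 \<le> \<rho>" "\<rho> < 1"
    using c by (simp_all add: \<rho>_def q_def)
  have contr: "\<bar>S x p - S y p\<bar> \<le> \<rho> * B" if d: "\<And>r. \<bar>x r - y r\<bar> \<le> B" for x y B p
  proof (cases "p \<in> interior_idx J1 J2")
    case True
    let ?d = "\<lambda>r. x r - y r"
    have d2: "\<bar>?d r + ?d s\<bar> \<le> B + B" for r s
      using d[of r] d[of s] by linarith
    have "S x p - S y p = (c1 * (?d (fst p - 1, snd p) + ?d (fst p + 1, snd p))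
        + c2 * (?d (fst p, snd p - 1) + ?d (fst p, snd p + 1))) / q"
      unfolding S_def using True by (simp add: algebra_simps flip: diff_divide_distrib)
    moreover have "\<bar>c1 * (?d (fst p - 1, snd p) + ?d (fst p + 1, snd p))
        + c2 * (?d (fst p, snd p - 1) + ?d (fst p, snd p + 1))\<bar> \<le> c1 * (B + B) + c2 * (B + B)"
      using c by (intro order_trans[OF abs_triangle_ineq] add_mono)
        (simp_all only: abs_mult abs_of_pos mult_left_mono d2 less_imp_le)
    ultimately show ?thesis
      using q by (simp add: \<rho>_def abs_divide divide_right_mono algebra_simps flip: add_divide_distrib)
  next
    case False
    have "0 \<le> B"
      using d[of p] by linarith
    with False \<rho> show ?thesis
      by (simp add: S_def)
  qed
  define X where "X n = (S ^^ n) (\<lambda>_. 0)" for n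
  have X: "X 0 = (\<lambda>_. 0)" "X (Suc n) = S (X n)" for n
    by (simp_all add: X_def)
  \<comment> \<open>Only finitely many entries can be nonzero, so the first increment is bounded
    uniformly in \<open>p\<close>.\<close>
  obtain B where B: "\<And>p. \<bar>S (\<lambda>_. 0) p\<bar> \<le> B"
  proof -
    have "S (\<lambda>_. 0) ` UNIV \<subseteq> insert 0 (S (\<lambda>_. 0) ` interior_idx J1 J2)"
      by (auto simp: S_def)
    then have "finite (range (S (\<lambda>_. 0)))"
      by (rule finite_subset) (simp add: interior_idx_def)
    then have "bounded (range (S (\<lambda>_. 0)))"
      by (rule finite_imp_bounded)
    with that show ?thesis
      by (auto simp: bounded_iff)
  qed
  have le: "\<bar>X (Suc n) p - X n p\<bar> \<le> \<rho> ^ n * B" for n p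
  proof (induction n arbitrary: p)
    case 0
    then show ?case
      using B by (simp add: X)
  next
    case (Suc n)
    show ?case
      using contr[where x = "X (Suc n)" and y = "X n" and p = p, OF Suc.IH] unfolding X(2) by (simp add: mult.assoc)
  qed
  have "summable (\<lambda>n. \<rho> ^ n * B)"
    using \<rho> by (intro summable_mult2 summable_geometric) simp
  then have summ: "summable (\<lambda>n. X (Suc n) p - X n p)" for p
    by (rule summable_comparison_test'[where N = 0]) (simp only: real_norm_def le)
  have "convergent (\<lambda>n. X n p)" for p
    using summ[of p] sum_lessThan_telescope[of "\<lambda>n. X n p"] by (simp add: summable_iff_convergent X(1))
  then obtain x where x: "\<And>p. (\<lambda>n. X n p) \<longlonglongrightarrow> x p"
    unfolding convergent_def by metis
  \<comment> \<open>Each entry of \<open>S x\<close> depends on finitely many entries of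
    \<open>x\<close>, so pointwise convergence suffices to pass to the limit.\<close>
  have "(\<lambda>n. S (X n) p) \<longlonglongrightarrow> S x p" for p
    using q unfolding S_def by (cases "p \<in> interior_idx J1 J2") (auto intro!: tendsto_intros x)
  then have fp: "x p = S x p" for p
    using LIMSEQ_unique LIMSEQ_Suc[OF x[of p]] unfolding X(2) by blast
  show ?thesis
  proof
    let ?X = "\<lambda>i j. x (i, j)"
    show "?X \<in> grid_space J1 J2"
      using fp by (auto simp: grid_space_def S_def)
    fix i j assume ij: "(i, j) \<in> interior_idx J1 J2"
    have "q * ?X i j = R i j + c1 * (?X (i - 1) j + ?X (i + 1) j) + c2 * (?X i (j - 1) + ?X i (j + 1))"
      using fp[of "(i, j)"] ij q by (simp add: S_def field_simps)
    moreover have "\<kappa> * discrete_laplacian J1 J2 h1 h2 ?X i j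
      = c1 * (?X (i - 1) j - 2 * ?X i j + ?X (i + 1) j) + c2 * (?X i (j - 1) - 2 * ?X i j + ?X i (j + 1))"
      using ij by (simp add: discrete_laplacian_def c1_def c2_def distrib_left add_divide_distrib)
    ultimately show "?X i j - \<kappa> * discrete_laplacian J1 J2 h1 h2 ?X i j = R i j"
      by (simp add: q_def algebra_simps)
  qed
qed

end

section \<open>Energy estimates\<close>

context mesh
begin

lemma discrete_laplacian_diff:
  "discrete_laplacian J1 J2 h1 h2 (\<lambda>k l. V k l - W k l) i j
    = discrete_laplacian J1 J2 h1 h2 V i j - discrete_laplacian J1 J2 h1 h2 W i j"
  by (simp add: discrete_laplacian_def algebra_simps diff_divide_distrib add_divide_distrib)

lemma discrete_laplacian_average:
  "discrete_laplacian J1 J2 h1 h2 (\<lambda>k l. (V k l + W k l) / 2) i j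
    = (discrete_laplacian J1 J2 h1 h2 V i j + discrete_laplacian J1 J2 h1 h2 W i j) / 2"
proof -
  have "((a + a') / 2 - 2 * ((b + b') / 2) + (c + c') / 2) / q
      = ((a - 2 * b + c) / q + (a' - 2 * b' + c') / q) / 2" for a a' b b' c c' q :: real
    by (cases "q = 0") (simp_all add: field_simps)
  then show ?thesis
    by (simp add: discrete_laplacian_def)
qed

lemma sum_interior_mono:
  assumes "\<And>i j. (i, j) \<in> interior_idx J1 J2 \<Longrightarrow> F i j \<le> G i j"
  shows "h1 * h2 * (\<Sum>(i, j)\<in>interior_idx J1 J2. F i j) \<le> h1 * h2 * (\<Sum>(i, j)\<in>interior_idx J1 J2. G i j)"
  using assms h_pos by (intro mult_left_mono sum_mono) auto

lemma sq0_uniform_bound: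
  assumes "\<And>i j. (i, j) \<in> interior_idx J1 J2 \<Longrightarrow> \<bar>F i j\<bar> \<le> M"
  shows "sq0 F \<le> (h1 * (real J1 + 1)) * (h2 * (real J2 + 1)) * M\<^sup>2"
proof -
  have "sq0 F \<le> h1 * h2 * (\<Sum>(i, j)\<in>interior_idx J1 J2. M\<^sup>2)"
    unfolding sq0_def using assms
    by (intro sum_interior_mono) (metis abs_ge_zero abs_le_square_iff abs_of_nonneg order_trans)
  also have "\<dots> = (h1 * real J1) * (h2 * real J2) * M\<^sup>2"
    by (simp add: interior_idx_def)
  also have "\<dots> \<le> (h1 * (real J1 + 1)) * (h2 * (real J2 + 1)) * M\<^sup>2"
    using h_pos by (intro mult_right_mono mult_mono) auto
  finally show ?thesis .
qed

text \<open>With \<open>d = W - V\<close>, the scheme reads \<open>d = \<tau> * (L + F)\<close>, and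
  pointwise \<open>L * d + \<tau> / 2 * F\<^sup>2 - d\<^sup>2 / (2 * \<tau>)\<close> equals
  \<open>\<tau> / 2 * L\<^sup>2\<close>, which is nonnegative. Half of the dissipation thus pays for
  the source, and the other half survives on the left for use in the recursion of the reaction
  error.\<close>

lemma energy_step:
  assumes "0 < \<tau>" "V \<in> grid_space J1 J2" "W \<in> grid_space J1 J2"
    and scheme: "\<And>i j. (i, j) \<in> interior_idx J1 J2 \<Longrightarrow> (W i j - V i j) / \<tau>
      = discrete_laplacian J1 J2 h1 h2 (\<lambda>k l. (W k l + V k l) / 2) i j + F i j"
  shows "sq0 (\<lambda>i j. W i j - V i j) / \<tau> + sq1 W \<le> sq1 V + \<tau> * sq0 F"
proof -
  define d where "d i j = W i j - V i j" for i j
  define L where "L = discrete_laplacian J1 J2 h1 h2 (\<lambda>k l. (W k l + V k l) / 2)"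
  have pt: "(d i j)\<^sup>2 / (2 * \<tau>) \<le> L i j * d i j + \<tau> / 2 * (F i j)\<^sup>2"
    if "(i, j) \<in> interior_idx J1 J2" for i j
  proof -
    have "d i j = \<tau> * (L i j + F i j)"
      using scheme[OF that] \<open>0 < \<tau>\<close> by (simp add: d_def L_def field_simps)
    then have "L i j * d i j + \<tau> / 2 * (F i j)\<^sup>2 - (d i j)\<^sup>2 / (2 * \<tau>) = (\<tau> / 2) * (L i j)\<^sup>2"
      using \<open>0 < \<tau>\<close> by (simp add: field_simps power2_eq_square)
    also have "\<dots> \<ge> 0"
      using \<open>0 < \<tau>\<close> by simp
    finally show ?thesis
      by simp
  qed
  have "sq0 d / (2 * \<tau>) = h1 * h2 * (\<Sum>(i, j)\<in>interior_idx J1 J2. (d i j)\<^sup>2 / (2 * \<tau>))"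
    by (simp add: sq0_def case_prod_unfold flip: sum_divide_distrib)
  also have "\<dots> \<le> h1 * h2 * (\<Sum>(i, j)\<in>interior_idx J1 J2. L i j * d i j + \<tau> / 2 * (F i j)\<^sup>2)"
    using pt by (rule sum_interior_mono)
  also have "\<dots> = h1 * h2 * (\<Sum>(i, j)\<in>interior_idx J1 J2. L i j * d i j) + \<tau> / 2 * sq0 F"
    by (simp add: sq0_def case_prod_unfold sum.distrib sum_distrib_left algebra_simps)
  also have "h1 * h2 * (\<Sum>(i, j)\<in>interior_idx J1 J2. L i j * d i j) = (sq1 V - sq1 W) / 2"
    unfolding L_def d_def by (rule laplacian_energy_difference[OF assms(2,3)])
  finally show ?thesis
    using \<open>0 < \<tau>\<close> by (simp add: d_def[abs_def] field_simps)
qed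

text \<open>The pointwise identity of \<open>energy_step\<close> for backward Euler from zero
  initial data, tested with the new level itself, so that its full H1 energy appears.\<close>

lemma energy_implicit_step:
  assumes "0 < \<kappa>" "V \<in> grid_space J1 J2"
    and scheme: "\<And>i j. (i, j) \<in> interior_idx J1 J2 \<Longrightarrow>
      V i j / \<kappa> = discrete_laplacian J1 J2 h1 h2 V i j + F i j"
  shows "sq0 V / \<kappa> + 2 * sq1 V \<le> \<kappa> * sq0 F"
proof -
  define L where "L = discrete_laplacian J1 J2 h1 h2 V"
  have pt: "(V i j)\<^sup>2 / (2 * \<kappa>) \<le> L i j * V i j + \<kappa> / 2 * (F i j)\<^sup>2"
    if "(i, j) \<in> interior_idx J1 J2" for i j
  proof -
    have "V i j = \<kappa> * (L i j + F i j)"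
      using scheme[OF that] \<open>0 < \<kappa>\<close> by (simp add: L_def field_simps)
    then have "L i j * V i j + \<kappa> / 2 * (F i j)\<^sup>2 - (V i j)\<^sup>2 / (2 * \<kappa>) = (\<kappa> / 2) * (L i j)\<^sup>2"
      using \<open>0 < \<kappa>\<close> by (simp add: field_simps power2_eq_square)
    also have "\<dots> \<ge> 0"
      using \<open>0 < \<kappa>\<close> by simp
    finally show ?thesis
      by simp
  qed
  have "sq0 V / (2 * \<kappa>) = h1 * h2 * (\<Sum>(i, j)\<in>interior_idx J1 J2. (V i j)\<^sup>2 / (2 * \<kappa>))"
    by (simp add: sq0_def case_prod_unfold flip: sum_divide_distrib)
  also have "\<dots> \<le> h1 * h2 * (\<Sum>(i, j)\<in>interior_idx J1 J2. L i j * V i j + \<kappa> / 2 * (F i j)\<^sup>2)"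
    using pt by (rule sum_interior_mono)
  also have "\<dots> = h1 * h2 * (\<Sum>(i, j)\<in>interior_idx J1 J2. L i j * V i j) + \<kappa> / 2 * sq0 F"
    by (simp add: sq0_def case_prod_unfold sum.distrib sum_distrib_left algebra_simps)
  also have "h1 * h2 * (\<Sum>(i, j)\<in>interior_idx J1 J2. L i j * V i j) = - sq1 V"
    unfolding L_def by (rule laplacian_energy[OF assms(2)])
  finally show ?thesis
    using \<open>0 < \<kappa>\<close> by (simp add: field_simps)
qed

section \<open>Squared norms of sums of grid functions\<close>

lemma sq0_le_two:
  assumes "\<And>i j. (i, j) \<in> interior_idx J1 J2 \<Longrightarrow> \<bar>F i j\<bar> \<le> \<bar>G i j\<bar> + \<bar>R i j\<bar>"
  shows "sq0 F \<le> 2 * (sq0 G + sq0 R)"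
proof -
  have "(F i j)\<^sup>2 \<le> 2 * ((G i j)\<^sup>2 + (R i j)\<^sup>2)" if "(i, j) \<in> interior_idx J1 J2" for i j
  proof -
    have "(F i j)\<^sup>2 \<le> (\<bar>G i j\<bar> + \<bar>R i j\<bar>)\<^sup>2"
      using assms[OF that] by (metis abs_ge_zero power2_abs power_mono)
    also have "\<dots> \<le> 2 * ((G i j)\<^sup>2 + (R i j)\<^sup>2)"
      using sum_squares_bound[of "\<bar>G i j\<bar>" "\<bar>R i j\<bar>"] by (simp add: power2_sum)
    finally show ?thesis .
  qed
  then have "sq0 F \<le> h1 * h2 * (\<Sum>(i, j)\<in>interior_idx J1 J2. 2 * ((G i j)\<^sup>2 + (R i j)\<^sup>2))"
    unfolding sq0_def by (rule sum_interior_mono)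
  also have "\<dots> = 2 * (sq0 G + sq0 R)"
    by (simp add: sq0_def case_prod_unfold sum.distrib sum_distrib_left algebra_simps)
  finally show ?thesis .
qed

lemma sq0_scale: "sq0 (\<lambda>i j. c * V i j) = c\<^sup>2 * sq0 V"
  by (simp add: sq0_def case_prod_unfold sum_distrib_left power_mult_distrib algebra_simps)

lemma sq0_le_scale:
  assumes "\<And>i j. (i, j) \<in> interior_idx J1 J2 \<Longrightarrow> \<bar>F i j\<bar> \<le> c * \<bar>G i j\<bar>"
  shows "sq0 F \<le> c\<^sup>2 * sq0 G"
proof -
  have "(F i j)\<^sup>2 \<le> (c * G i j)\<^sup>2" if "(i, j) \<in> interior_idx J1 J2" for i j
    using power_mono[OF assms[OF that] abs_ge_zero, of 2] by (simp add: power_mult_distrib)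
  then have "sq0 F \<le> sq0 (\<lambda>i j. c * G i j)"
    unfolding sq0_def by (rule sum_interior_mono)
  then show ?thesis
    by (simp add: sq0_scale)
qed

text \<open>The weights come from \<open>(a + s)\<^sup>2 = (1 + \<tau>) * a\<^sup>2 + (1 + 1 /
  \<tau>) * s\<^sup>2 - (\<tau> * a - s)\<^sup>2 / \<tau>\<close>. The main term \<open>G\<close>
  may grow only by 1 + \<tau> per step to stay bounded over \<open>N\<close> steps; the other terms
  are small enough to bear 1 + 1/\<tau>.\<close>

lemma sq0_le_weighted:
  assumes "0 < \<tau>" and "\<And>i j. (i, j) \<in> interior_idx J1 J2 \<Longrightarrow> \<bar>F i j\<bar> \<le> \<bar>G i j\<bar> + (\<bar>X i j\<bar> + \<bar>Y i j\<bar> + \<bar>Z i j\<bar> + \<bar>R i j\<bar>)"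
  shows "sq0 F \<le> (1 + \<tau>) * sq0 G + (1 + 1 / \<tau>) * (4 * (sq0 X + sq0 Y + sq0 Z + sq0 R))"
proof -
  have "(F i j)\<^sup>2 \<le> (1 + \<tau>) * (G i j)\<^sup>2
      + (1 + 1 / \<tau>) * (4 * ((X i j)\<^sup>2 + (Y i j)\<^sup>2 + (Z i j)\<^sup>2 + (R i j)\<^sup>2))"
    if "(i, j) \<in> interior_idx J1 J2" for i j
  proof -
    define a s where "a = \<bar>G i j\<bar>" and "s = \<bar>X i j\<bar> + \<bar>Y i j\<bar> + \<bar>Z i j\<bar> + \<bar>R i j\<bar>"
    have "(F i j)\<^sup>2 \<le> (a + s)\<^sup>2"
      using assms(2)[OF that] unfolding a_def s_def by (metis abs_ge_zero power2_abs power_mono)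
    also have "\<dots> = (1 + \<tau>) * a\<^sup>2 + (1 + 1 / \<tau>) * s\<^sup>2 - (\<tau> * a - s)\<^sup>2 / \<tau>"
      using \<open>0 < \<tau>\<close> by (simp add: field_simps power2_eq_square)
    also have "\<dots> \<le> (1 + \<tau>) * a\<^sup>2 + (1 + 1 / \<tau>) * s\<^sup>2"
      using \<open>0 < \<tau>\<close> by simp
    also have "s\<^sup>2 \<le> 4 * ((X i j)\<^sup>2 + (Y i j)\<^sup>2 + (Z i j)\<^sup>2 + (R i j)\<^sup>2)"
    proof -
      have "(x + y + z + w)\<^sup>2 \<le> 4 * (x\<^sup>2 + y\<^sup>2 + z\<^sup>2 + w\<^sup>2)" for x y z w :: real
      proof -
        have "4 * (x\<^sup>2 + y\<^sup>2 + z\<^sup>2 + w\<^sup>2) - (x + y + z + w)\<^sup>2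
          = (x - y)\<^sup>2 + (x - z)\<^sup>2 + (x - w)\<^sup>2 + (y - z)\<^sup>2 + (y - w)\<^sup>2 + (z - w)\<^sup>2"
          by algebra
        then show ?thesis
          by (smt (verit) zero_le_power2)
      qed
      from this[of "\<bar>X i j\<bar>" "\<bar>Y i j\<bar>" "\<bar>Z i j\<bar>" "\<bar>R i j\<bar>"] show ?thesis
        unfolding s_def by simp
    qed
    finally show ?thesis
      using \<open>0 < \<tau>\<close> by (simp add: a_def mult_left_mono)
  qed
  then have "sq0 F \<le> h1 * h2 * (\<Sum>(i, j)\<in>interior_idx J1 J2. (1 + \<tau>) * (G i j)\<^sup>2
      + (1 + 1 / \<tau>) * (4 * ((X i j)\<^sup>2 + (Y i j)\<^sup>2 + (Z i j)\<^sup>2 + (R i j)\<^sup>2)))"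
    unfolding sq0_def by (rule sum_interior_mono)
  also have "\<dots> = (1 + \<tau>) * sq0 G + (1 + 1 / \<tau>) * (4 * (sq0 X + sq0 Y + sq0 Z + sq0 R))"
    unfolding sq0_def case_prod_unfold sum.distrib sum_distrib_left[symmetric]
    by (simp only: algebra_simps)
  finally show ?thesis .
qed

end

text \<open>The rate \<open>c\<close> adds up the coefficients that appear in one step of the energy
  recursion, \<open>C0\<close> is the exponential growth times a bound for the initial energy, and
  the last summand pays for one further step of \<open>P\<close> to the final level
  \<open>N\<close>.\<close>

definition gronwall_const :: "real \<Rightarrow> real \<Rightarrow> real"
  where "gronwall_const T K = (let c = 2 + 2 * T * K + 2 * K + 2 * T * K\<^sup>2 + K + 2 * K\<^sup>2;
    C0 = exp (c * T) * (1 + 2 * K + 8 * T * K\<^sup>2) in C0 + 2 * T * (C0 + K))"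

lemma gronwall_const_nonneg: "0 \<le> T \<Longrightarrow> 0 \<le> K \<Longrightarrow> 0 \<le> gronwall_const T K"
  by (simp add: gronwall_const_def Let_def)

text \<open>The energy \<open>K * P n + H n + H (n - 1)\<close> grows by a factor \<open>1 + c * \<tau>\<close> per step: the
  increment \<open>D n / \<tau>\<close> in the bound for \<open>H n\<close> is absorbed by the dissipation.\<close>

lemma relaxation_gronwall:
  fixes P H D :: "nat \<Rightarrow> real" and K \<tau> T S :: real and N :: nat
  assumes "0 < \<tau>" "real N * \<tau> \<le> T" "1 \<le> K" "0 \<le> S" "1 \<le> N"
    and nonneg: "\<And>n. 0 \<le> P n" "\<And>n. 0 \<le> H n" "\<And>n. 0 \<le> D n"
    and "P 0 = 0"
    and step_P: "\<And>n. n < N \<Longrightarrow> D (Suc n) / \<tau> + P (Suc n) \<le> P n + 2 * \<tau> * (H n + K * S)"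
    and step_H: "\<And>n. Suc (Suc n) < N \<Longrightarrow> H (Suc (Suc n)) \<le> (1 + \<tau>) * H n
      + K * (D (Suc (Suc n)) / \<tau> + \<tau> * (P (Suc (Suc n)) + P (Suc n)) + \<tau> * S)"
    and H0: "H 0 \<le> K * S" and H1: "1 < N \<Longrightarrow> H 1 \<le> K * (S + P 1)"
  shows "\<And>m. m < N \<Longrightarrow> H m \<le> gronwall_const T K * S"
    and "\<And>m. m \<le> N \<Longrightarrow> P m \<le> gronwall_const T K * S"
proof -
  define c where "c = 2 + 2 * T * K + 2 * K + 2 * T * K\<^sup>2 + K + 2 * K\<^sup>2"
  define C0 where "C0 = exp (c * T) * (1 + 2 * K + 8 * T * K\<^sup>2)"
  have gronwall: "gronwall_const T K = C0 + 2 * T * (C0 + K)"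
    by (simp add: gronwall_const_def Let_def c_def C0_def)
  have "\<tau> \<le> real N * \<tau>"
    using assms(1,5) by simp
  then have "\<tau> \<le> T" "0 < T"
    using assms(1,2) by linarith+
  have "0 \<le> K"
    using assms(3) by simp
  have "0 \<le> c"
    unfolding c_def using \<open>0 \<le> K\<close> \<open>0 < T\<close> by simp
  \<comment> \<open>The index is shifted by one, so that \<open>E n\<close> involves the levels
    \<open>n\<close> and \<open>Suc n\<close> without a predecessor.\<close>
  define E where "E n = K * P (Suc n) + H (Suc n) + H n" for n
  have P1: "P 1 \<le> 4 * T * K * S"
  proof -
    have "0 \<le> D 1 / \<tau>"
      using nonneg \<open>0 < \<tau>\<close> by simp
    then have "P 1 \<le> 2 * \<tau> * (H 0 + K * S)"
      using step_P[of 0] assms(5) \<open>P 0 = 0\<close> by simp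
    also have "\<dots> \<le> 2 * T * (K * S + K * S)"
      using H0 \<open>\<tau> \<le> T\<close> \<open>0 < \<tau>\<close> \<open>0 < T\<close> \<open>0 \<le> K\<close> \<open>0 \<le> S\<close> nonneg(2)[of 0]
      by (intro mult_mono) auto
    finally show ?thesis
      by simp
  qed
  have E0: "E 0 \<le> (2 * K + 8 * T * K\<^sup>2) * S" if "1 < N"
  proof -
    have "K * P 1 \<le> K * (4 * T * K * S)"
      using P1 \<open>0 \<le> K\<close> by (rule mult_left_mono)
    then show ?thesis
      using H1[OF that] H0 unfolding E_def by (simp add: algebra_simps power2_eq_square)
  qed
  \<comment> \<open>Adding the consistency level \<open>S\<close> to \<open>E\<close> makes the
    recursion homogeneous, so it iterates to a power of \<open>1 + c * \<tau>\<close>.\<close>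
  have ES: "E (Suc n) + S \<le> (1 + c * \<tau>) * (E n + S)" if "Suc (Suc n) < N" for n
  proof -
    define p1 p0 hn hh hz q where "p1 = P (Suc (Suc n))" and "p0 = P (Suc n)"
      and "hn = H (Suc (Suc n))" and "hh = H (Suc n)" and "hz = H n" and "q = D (Suc (Suc n)) / \<tau>"
    have pos: "0 \<le> p0" "0 \<le> hh" "0 \<le> hz" "0 \<le> q"
      using nonneg \<open>0 < \<tau>\<close> by (simp_all add: p0_def hh_def hz_def q_def)
    have a: "q + p1 \<le> p0 + 2 * \<tau> * (hh + K * S)"
      using step_P[of "Suc n"] that by (simp add: p1_def p0_def hh_def q_def)
    have b: "hn \<le> (1 + \<tau>) * hz + K * (q + \<tau> * (p1 + p0) + \<tau> * S)"
      using step_H[OF that] by (simp add: p1_def p0_def hn_def hz_def q_def)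
    \<comment> \<open>Multiplied by \<open>K\<close>, the bound for \<open>P\<close> carries the
      same dissipation term \<open>K * q\<close> as \<open>b\<close>, which drops out when the two
      are added.\<close>
    have a1: "K * q + K * p1 \<le> K * p0 + 2 * \<tau> * K * hh + 2 * \<tau> * K\<^sup>2 * S"
      using mult_left_mono[OF a \<open>0 \<le> K\<close>] by (simp add: algebra_simps power2_eq_square)
    have "\<tau> * (hh + K * S) \<le> T * (hh + K * S)"
      using \<open>\<tau> \<le> T\<close> pos \<open>0 \<le> K\<close> \<open>0 \<le> S\<close> by (intro mult_right_mono) auto
    then have "p1 \<le> p0 + 2 * T * (hh + K * S)"
      using a pos by linarith
    \<comment> \<open>The new value \<open>p1\<close> on the right of \<open>b\<close> is replaced
      by quantities of earlier levels.\<close>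
    then have a2: "(K * \<tau>) * p1 \<le> (K * \<tau>) * (p0 + 2 * T * (hh + K * S))"
      using \<open>0 \<le> K\<close> \<open>0 < \<tau>\<close> by (intro mult_left_mono) auto
    have "K * p1 + hn + hh \<le> (K * p0 + hh + hz)
        + \<tau> * (hz + 2 * (K * p0) + (2 * T * K + 2 * K) * hh + (2 * T * K\<^sup>2 + K + 2 * K\<^sup>2) * S)"
      using a1 a2 b by (simp add: algebra_simps power2_eq_square)
    also have "hz + 2 * (K * p0) + (2 * T * K + 2 * K) * hh + (2 * T * K\<^sup>2 + K + 2 * K\<^sup>2) * S
        \<le> c * hz + c * (K * p0) + c * hh + c * S"
    proof (intro add_mono mult_right_mono)
      have "1 * hz \<le> c * hz"
        using pos \<open>0 \<le> K\<close> \<open>0 < T\<close> by (intro mult_right_mono) (auto simp: c_def)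
      then show "hz \<le> c * hz"
        by simp
    qed (use pos \<open>0 \<le> K\<close> \<open>0 < T\<close> \<open>0 \<le> S\<close> in \<open>auto simp: c_def\<close>)
    finally show ?thesis
      using \<open>0 < \<tau>\<close> unfolding E_def by (simp add: p1_def p0_def hn_def hh_def hz_def algebra_simps)
  qed
  have E: "E n + S \<le> C0 * S" if "Suc n < N" for n
  proof -
    have "E n + S \<le> (1 + c * \<tau>) ^ n * (E 0 + S)"
      using that
    proof (induction n)
      case (Suc n)
      then have "E (Suc n) + S \<le> (1 + c * \<tau>) * (E n + S)"
        using ES by simp
      also have "\<dots> \<le> (1 + c * \<tau>) * ((1 + c * \<tau>) ^ n * (E 0 + S))"
        using Suc \<open>0 \<le> c\<close> \<open>0 < \<tau>\<close> by (intro mult_left_mono) auto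
      finally show ?case
        by (simp add: mult.assoc)
    qed simp
    also have "\<dots> \<le> exp (c * T) * ((1 + 2 * K + 8 * T * K\<^sup>2) * S)"
    proof (rule mult_mono)
      have "(1 + c * \<tau>) ^ n \<le> exp (c * \<tau>) ^ n"
        using \<open>0 \<le> c\<close> \<open>0 < \<tau>\<close> exp_ge_add_one_self[of "c * \<tau>"] by (intro power_mono) auto
      also have "\<dots> = exp (c * (real n * \<tau>))"
        by (simp add: mult_ac flip: exp_of_nat_mult)
      also have "\<dots> \<le> exp (c * T)"
      proof -
        have "real n * \<tau> \<le> real N * \<tau>"
          using that \<open>0 < \<tau>\<close> by (intro mult_right_mono) auto
        then show ?thesis
          using \<open>0 \<le> c\<close> assms(2) by (simp add: mult_left_mono)
      qed
      finally show "(1 + c * \<tau>) ^ n \<le> exp (c * T)" .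
      show "E 0 + S \<le> (1 + 2 * K + 8 * T * K\<^sup>2) * S"
        using E0 that by (simp add: algebra_simps)
      show "0 \<le> E 0 + S"
        using nonneg \<open>0 \<le> K\<close> \<open>0 \<le> S\<close> by (simp add: E_def)
    qed simp
    finally show ?thesis
      by (simp add: C0_def)
  qed
  have "1 * (1 + 2 * K + 8 * T * K\<^sup>2) \<le> C0"
    unfolding C0_def using \<open>0 \<le> c\<close> \<open>0 < T\<close> \<open>0 \<le> K\<close> by (intro mult_right_mono) auto
  moreover have "0 \<le> T * K\<^sup>2"
    using \<open>0 < T\<close> by simp
  ultimately have "K \<le> C0"
    using \<open>0 \<le> K\<close> by simp
  then have "0 \<le> C0"
    using \<open>0 \<le> K\<close> by simp
  have H_le: "H m \<le> C0 * S" if "m < N" for m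
  proof (cases m)
    case 0
    then show ?thesis
      using H0 mult_right_mono[OF \<open>K \<le> C0\<close> \<open>0 \<le> S\<close>] by simp
  next
    case (Suc n)
    have "0 \<le> K * P (Suc n)"
      using nonneg \<open>0 \<le> K\<close> by simp
    with E[of n] that Suc nonneg(2)[of n] \<open>0 \<le> S\<close> show ?thesis
      unfolding E_def by simp
  qed
  have P_le: "P m \<le> C0 * S" if "m < N" for m
  proof (cases m)
    case 0
    then show ?thesis
      using \<open>P 0 = 0\<close> \<open>0 \<le> C0\<close> \<open>0 \<le> S\<close> by simp
  next
    case (Suc n)
    have "1 * P (Suc n) \<le> K * P (Suc n)"
      using nonneg \<open>1 \<le> K\<close> by (intro mult_right_mono) auto
    with E[of n] that Suc nonneg(2)[of n] nonneg(2)[of "Suc n"] \<open>0 \<le> S\<close> show ?thesis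
      unfolding E_def by simp
  qed
  have C0_le: "C0 * S \<le> gronwall_const T K * S"
    unfolding gronwall using \<open>0 \<le> C0\<close> \<open>0 \<le> K\<close> \<open>0 < T\<close> \<open>0 \<le> S\<close> by (intro mult_right_mono) auto
  show "H m \<le> gronwall_const T K * S" if "m < N" for m
    using H_le[OF that] C0_le by linarith
  show "P m \<le> gronwall_const T K * S" if "m \<le> N" for m
  proof (cases "m < N")
    case True
    then show ?thesis
      using P_le C0_le by fastforce
  next
    \<comment> \<open>At level \<open>N\<close> there is no reaction error left, hence no
      \<open>E\<close>; a last use of \<open>step_P\<close> from level \<open>N - 1\<close> gives
      the extra summand of \<open>gronwall_const\<close>.\<close>
    case False
    with that have "m = N"
      by simp
    with assms(5) obtain n where n: "m = Suc n" "n < N"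
      by (cases m) auto
    have "0 \<le> D (Suc n) / \<tau>"
      using nonneg \<open>0 < \<tau>\<close> by simp
    then have "P m \<le> P n + 2 * \<tau> * (H n + K * S)"
      using step_P[OF n(2)] unfolding n(1) by linarith
    also have "\<dots> \<le> C0 * S + 2 * T * (C0 * S + K * S)"
      using P_le[OF n(2)] H_le[OF n(2)] \<open>\<tau> \<le> T\<close> \<open>0 < \<tau>\<close> \<open>0 < T\<close> \<open>0 \<le> K\<close> \<open>0 \<le> S\<close> nonneg(2)[of n]
      by (intro mult_mono add_mono) auto
    finally show ?thesis
      unfolding gronwall by (simp add: algebra_simps)
  qed
qed

section \<open>Consistency\<close>

locale heat_problem =
  fixes T a1 a2 b1 b2 \<delta> :: real
    and D :: "(real \<times> real) set" and Q :: "(real \<times> real \<times> real) set"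
    and g g' g'' :: "real \<Rightarrow> real"
    and f u :: "real \<Rightarrow> real \<times> real \<Rightarrow> real"
    and u0 :: "real \<times> real \<Rightarrow> real"
    and u_t u_tt u_ttt u_x1 u_x1_2 u_x1_3 u_x1_4 u_x2 u_x2_2 u_x2_3 u_x2_4 \<zeta>_t \<zeta>_tt \<zeta>_ttt ::
      "real \<Rightarrow> real \<times> real \<Rightarrow> real"
  assumes T_pos: "0 < T" and a_less: "a1 < a2" and b_less: "b1 < b2"
    and D_eq: "D = {a1..a2} \<times> {b1..b2}" and Q_eq: "Q = {0..T} \<times> D"
    and g_0: "g 0 = 0"
    and g_deriv: "\<And>x. (g has_real_derivative g' x) (at x)"
    and g'_deriv: "\<And>x. (g' has_real_derivative g'' x) (at x)"
    and g''_cont: "continuous_on UNIV g''"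
    and u_cont: "continuous_on Q (\<lambda>(t, x). u t x)"
    and u_t: "has_partial_t Q u u_t" and u_t_cont: "continuous_on Q (\<lambda>(t, x). u_t t x)"
    and u_tt: "has_partial_t Q u_t u_tt" and u_tt_cont: "continuous_on Q (\<lambda>(t, x). u_tt t x)"
    and u_ttt: "has_partial_t Q u_tt u_ttt" and u_ttt_cont: "continuous_on Q (\<lambda>(t, x). u_ttt t x)"
    and u_x1: "has_partial_x1 Q u u_x1" and u_x1_2: "has_partial_x1 Q u_x1 u_x1_2"
    and u_x1_3: "has_partial_x1 Q u_x1_2 u_x1_3" and u_x1_4: "has_partial_x1 Q u_x1_3 u_x1_4"
    and u_x1_4_cont: "continuous_on Q (\<lambda>(t, x). u_x1_4 t x)"
    and u_x2: "has_partial_x2 Q u u_x2" and u_x2_2: "has_partial_x2 Q u_x2 u_x2_2"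
    and u_x2_3: "has_partial_x2 Q u_x2_2 u_x2_3" and u_x2_4: "has_partial_x2 Q u_x2_3 u_x2_4"
    and u_x2_4_cont: "continuous_on Q (\<lambda>(t, x). u_x2_4 t x)"
    and pde: "\<forall>(t, x)\<in>Q. u_t t x = (u_x1_2 t x + u_x2_2 t x) + g (u t x) + f t x"
    and u_boundary: "\<forall>t\<in>{0..T}. \<forall>x\<in>frontier D. u t x = 0"
    and u_initial: "\<forall>x\<in>D. u 0 x = u0 x"
    and \<zeta>_t: "has_partial_t Q (\<lambda>t x. g (u t x)) \<zeta>_t" and \<zeta>_t_cont: "continuous_on Q (\<lambda>(t, x). \<zeta>_t t x)"
    and \<zeta>_tt: "has_partial_t Q \<zeta>_t \<zeta>_tt" and \<zeta>_tt_cont: "continuous_on Q (\<lambda>(t, x). \<zeta>_tt t x)"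
    and \<zeta>_ttt: "has_partial_t Q \<zeta>_tt \<zeta>_ttt" and \<zeta>_ttt_cont: "continuous_on Q (\<lambda>(t, x). \<zeta>_ttt t x)"
    and \<delta>_pos: "0 < \<delta>" and u_sup: "2 * (SUP (t, x)\<in>Q. \<bar>u t x\<bar>) \<le> \<delta>"
begin

section \<open>Derivatives along the sections of the space-time cylinder and bounds for the
  data\<close>

lemma partial_tD:
  assumes "has_partial_t Q F F'" "x \<in> D" "t \<in> {0..T}"
  shows "((\<lambda>s. F s x) has_real_derivative F' t x) (at t within {0..T})"
proof -
  obtain x1 x2 where x: "x = (x1, x2)"
    by fastforce
  have "{s. (s, x1, x2) \<in> Q} = {0..T}"
    using assms(2) by (auto simp: Q_eq x)
  then show ?thesis
    using assms by (force simp: has_partial_t_def Q_eq x)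
qed

lemma partial_x1D:
  assumes "has_partial_x1 Q F F'" "t \<in> {0..T}" "x2 \<in> {b1..b2}" "x1 \<in> {a1..a2}"
  shows "((\<lambda>y. F t (y, x2)) has_real_derivative F' t (x1, x2)) (at x1 within {a1..a2})"
proof -
  have "{y. (t, y, x2) \<in> Q} = {a1..a2}"
    using assms by (auto simp: Q_eq D_eq)
  then show ?thesis
    using assms by (force simp: has_partial_x1_def Q_eq D_eq)
qed

lemma partial_x2D:
  assumes "has_partial_x2 Q F F'" "t \<in> {0..T}" "x1 \<in> {a1..a2}" "x2 \<in> {b1..b2}"
  shows "((\<lambda>y. F t (x1, y)) has_real_derivative F' t (x1, x2)) (at x2 within {b1..b2})"
proof -
  have "{y. (t, x1, y) \<in> Q} = {b1..b2}"
    using assms by (auto simp: Q_eq D_eq)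
  then show ?thesis
    using assms by (force simp: has_partial_x2_def Q_eq D_eq)
qed

lemma compact_Q: "compact Q"
  unfolding Q_eq D_eq by (intro compact_Times compact_Icc)

text \<open>The supremum dominates each value because compactness of \<open>Q\<close> bounds the
  range. Half of \<delta> remains available for the error of the approximations.\<close>

lemma u_bounded:
  assumes "t \<in> {0..T}" "x \<in> D"
  shows "\<bar>u t x\<bar> \<le> \<delta> / 2"
proof -
  have "continuous_on Q (\<lambda>(t, x). \<bar>u t x\<bar>)"
    using continuous_on_rabs[OF u_cont] by (simp add: case_prod_unfold)
  then have "bdd_above ((\<lambda>(t, x). \<bar>u t x\<bar>) ` Q)"
    using compact_Q by (intro bounded_imp_bdd_above compact_imp_bounded compact_continuous_image)
  then have "(\<lambda>(t, x). \<bar>u t x\<bar>) (t, x) \<le> (SUP (t, x)\<in>Q. \<bar>u t x\<bar>)"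
    using assms by (intro cSUP_upper) (auto simp: Q_eq)
  with u_sup show ?thesis
    by simp
qed

text \<open>One bound for all derivatives that occur in Taylor remainders; the solution enters the
  final constants only through it.\<close>

definition data_bound :: "real \<Rightarrow> bool"
  where "data_bound M \<longleftrightarrow> 0 \<le> M \<and> (\<forall>F\<in>{u_t, u_tt, u_ttt, u_x1_4, u_x2_4, \<zeta>_t, \<zeta>_tt, \<zeta>_ttt}.
    \<forall>t\<in>{0..T}. \<forall>x\<in>D. \<bar>F t x\<bar> \<le> M)"

lemma data_bound_exists: "\<exists>M. data_bound M"
proof -
  have "\<exists>M\<ge>0. \<forall>F\<in>\<F>. \<forall>t\<in>{0..T}. \<forall>x\<in>D. \<bar>F t x\<bar> \<le> M"
    if "finite \<F>" "\<forall>F\<in>\<F>. continuous_on Q (\<lambda>(t, x). F t x)"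
    for \<F> :: "(real \<Rightarrow> real \<times> real \<Rightarrow> real) set"
    using that
  proof (induction \<F>)
    case (insert F \<F>)
    then obtain M where M: "0 \<le> M" "\<forall>F\<in>\<F>. \<forall>t\<in>{0..T}. \<forall>x\<in>D. \<bar>F t x\<bar> \<le> M"
      by auto
    have "bounded ((\<lambda>(t, x). F t x) ` Q)"
      using insert.prems compact_Q by (intro compact_imp_bounded compact_continuous_image) auto
    then obtain B where "\<forall>y\<in>(\<lambda>(t, x). F t x) ` Q. norm y \<le> B"
      unfolding bounded_iff by blast
    then have "\<forall>t\<in>{0..T}. \<forall>x\<in>D. \<bar>F t x\<bar> \<le> max M B"
      by (force simp: Q_eq)
    with M show ?case
      by (intro exI[of _ "max M B"]) (auto simp: le_max_iff_disj)
  qed auto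
  from this[of "{u_t, u_tt, u_ttt, u_x1_4, u_x2_4, \<zeta>_t, \<zeta>_tt, \<zeta>_ttt}"] show ?thesis
    using u_t_cont u_tt_cont u_ttt_cont u_x1_4_cont u_x2_4_cont \<zeta>_t_cont \<zeta>_tt_cont \<zeta>_ttt_cont
    unfolding data_bound_def by simp
qed

context
  fixes M :: real
  assumes M: "data_bound M"
begin

lemma M_nonneg: "0 \<le> M"
  using M by (simp add: data_bound_def)

lemma data_le:
  assumes "x \<in> D" "t \<in> {0..T}"
  shows "\<bar>u_t t x\<bar> \<le> M" "\<bar>u_tt t x\<bar> \<le> M" "\<bar>u_ttt t x\<bar> \<le> M" "\<bar>u_x1_4 t x\<bar> \<le> M" "\<bar>u_x2_4 t x\<bar> \<le> M"
    "\<bar>\<zeta>_t t x\<bar> \<le> M" "\<bar>\<zeta>_tt t x\<bar> \<le> M" "\<bar>\<zeta>_ttt t x\<bar> \<le> M"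
  using M assms by (simp_all add: data_bound_def)

lemma u_lipschitz:
  assumes "x \<in> D" "t \<in> {0..T}" "s \<in> {0..T}"
  shows "\<bar>u t x - u s x\<bar> \<le> M * \<bar>t - s\<bar>"
  by (rule taylor_1[OF partial_tD[OF u_t]]) (use assms data_le in auto)

lemma \<zeta>_lipschitz:
  assumes "x \<in> D" "t \<in> {0..T}" "s \<in> {0..T}"
  shows "\<bar>g (u t x) - g (u s x)\<bar> \<le> M * \<bar>t - s\<bar>"
  by (rule taylor_1[OF partial_tD[OF \<zeta>_t]]) (use assms data_le in auto)

text \<open>The expansion is about the new time \<open>k\<close>, where the implicit half step
  evaluates the Laplacian. First order is enough, as this step is taken only once.\<close>

lemma u_backward_difference:
  assumes "x \<in> D" "0 < k" "k \<le> T"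
  shows "\<bar>(u k x - u 0 x) / k - u_t k x\<bar> \<le> M * k"
proof -
  have "\<bar>u 0 x - (u k x + u_t k x * (0 - k))\<bar> \<le> M * \<bar>0 - k\<bar>\<^sup>2"
    by (rule taylor_2[OF partial_tD[OF u_t] partial_tD[OF u_tt]]) (use assms data_le in auto)
  then have "\<bar>u k x - u 0 x - u_t k x * k\<bar> \<le> M * k * k"
    by (simp add: power2_eq_square algebra_simps abs_minus_commute)
  moreover have "(u k x - u 0 x) / k - u_t k x = (u k x - u 0 x - u_t k x * k) / k"
    using \<open>0 < k\<close> by (simp add: field_simps)
  ultimately show ?thesis
    using \<open>0 < k\<close> by (simp add: abs_divide pos_divide_le_eq)
qed

lemma u_trapezoid:
  assumes "x \<in> D" "0 < k" "0 \<le> t" "t + k \<le> T"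
  shows "\<bar>(u (t + k) x - u t x) / k - (u_t t x + u_t (t + k) x) / 2\<bar> \<le> M * k\<^sup>2"
  by (rule trapezoid_difference[OF partial_tD[OF u_t] partial_tD[OF u_tt] partial_tD[OF u_ttt]])
    (use assms data_le in auto)

lemma \<zeta>_midpoint:
  assumes "x \<in> D" "0 < k" "0 \<le> t" "t + k \<le> T"
  shows "\<bar>(g (u t x) + g (u (t + k) x)) / 2 - g (u (t + k / 2) x)\<bar> \<le> M * k\<^sup>2"
  by (rule midpoint_average[OF partial_tD[OF \<zeta>_t] partial_tD[OF \<zeta>_tt]]) (use assms data_le in auto)

lemma \<zeta>_third_difference:
  assumes "x \<in> D" "0 < k" "0 \<le> t - 3 * k" "t + k \<le> T"
  shows "\<bar>(g (u (t + k) x) + g (u (t - k) x) - 2 * g (u t x))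
    - (g (u (t - k) x) + g (u (t - 3 * k) x) - 2 * g (u (t - 2 * k) x))\<bar> \<le> 24 * M * k ^ 3"
  by (rule third_difference[OF partial_tD[OF \<zeta>_t] partial_tD[OF \<zeta>_tt] partial_tD[OF \<zeta>_ttt]])
    (use assms data_le in auto)

end

lemma frontier_D:
  assumes "(x1, x2) \<in> D" "x1 = a1 \<or> x1 = a2 \<or> x2 = b1 \<or> x2 = b2"
  shows "(x1, x2) \<in> frontier D"
  using assms unfolding D_eq frontier_def
  by (auto simp: closure_Times interior_Times interior_atLeastAtMost_real)

end

section \<open>Time levels, nodes and interpolation\<close>

locale discretization = heat_problem +
  fixes N J1 J2 :: nat
  assumes N_pos: "1 \<le> N"
begin

definition \<tau> :: real where "\<tau> = T / real N"
abbreviation h1 :: real where "h1 \<equiv> mesh_width a1 a2 J1"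
abbreviation h2 :: real where "h2 \<equiv> mesh_width b1 b2 J2"
abbreviation I\<^sub>H :: "(real \<times> real \<Rightarrow> real) \<Rightarrow> grid_fun" where "I\<^sub>H \<equiv> grid_interp a1 a2 b1 b2 J1 J2"
abbreviation \<Delta>\<^sub>H :: "grid_fun \<Rightarrow> grid_fun" where "\<Delta>\<^sub>H \<equiv> discrete_laplacian J1 J2 h1 h2"

definition node :: "nat \<Rightarrow> nat \<Rightarrow> real \<times> real"
  where "node i j = (a1 + real i * h1, b1 + real j * h2)"

lemma \<tau>_pos: "0 < \<tau>" and \<tau>_le: "\<tau> \<le> T" and N_\<tau>: "real N * \<tau> = T"
  using T_pos N_pos by (simp_all add: \<tau>_def field_simps)

lemma time_in: "n \<le> N \<Longrightarrow> real n * \<tau> \<in> {0..T}"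
  using T_pos N_pos by (simp add: \<tau>_def field_simps mult_left_mono)

lemma half_time_in:
  assumes "n < N"
  shows "real n * \<tau> + \<tau> / 2 \<in> {0..T}"
proof -
  have "real n * \<tau> + \<tau> \<le> T"
    using time_in[of "Suc n"] assms by (simp add: algebra_simps)
  then show ?thesis
    using time_in[of n] assms \<tau>_pos by auto
qed

lemma h_width: "h1 * (real J1 + 1) = a2 - a1" "h2 * (real J2 + 1) = b2 - b1"
  by (simp_all add: mesh_width_def)

sublocale mesh J1 J2 h1 h2
  using a_less b_less by unfold_locales (simp_all add: mesh_width_def)

lemma coordinate_in:
  "i \<le> J1 + 1 \<Longrightarrow> a1 + real i * h1 \<in> {a1..a2}" "j \<le> J2 + 1 \<Longrightarrow> b1 + real j * h2 \<in> {b1..b2}"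
proof -
  show "a1 + real i * h1 \<in> {a1..a2}" if "i \<le> J1 + 1"
  proof -
    have "real i * h1 \<le> (real J1 + 1) * h1"
      using that h_pos by (intro mult_right_mono) auto
    then show ?thesis
      using h_width(1) h_pos by (simp add: mult.commute)
  qed
  show "b1 + real j * h2 \<in> {b1..b2}" if "j \<le> J2 + 1"
  proof -
    have "real j * h2 \<le> (real J2 + 1) * h2"
      using that h_pos by (intro mult_right_mono) auto
    then show ?thesis
      using h_width(2) h_pos by (simp add: mult.commute)
  qed
qed

lemma node_in_D: "i \<le> J1 + 1 \<Longrightarrow> j \<le> J2 + 1 \<Longrightarrow> node i j \<in> D"
  using coordinate_in unfolding node_def D_eq by blast

lemma interior_node_in_D: "(i, j) \<in> interior_idx J1 J2 \<Longrightarrow> node i j \<in> D"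
  by (rule node_in_D) (auto simp: interior_idx_def)

lemma interp_interior: "(i, j) \<in> interior_idx J1 J2 \<Longrightarrow> I\<^sub>H z i j = z (node i j)"
  by (simp add: grid_interp_def node_def)

lemma interp_in_grid_space: "I\<^sub>H z \<in> grid_space J1 J2"
  by (simp add: grid_interp_def grid_space_def)

text \<open>On boundary nodes the interpolant is zero by definition and \<open>u\<close> by the
  boundary condition. So difference quotients next to the boundary also use true values of
  \<open>u\<close>, as consistency requires.\<close>

lemma interp_u:
  assumes "t \<in> {0..T}" "i \<le> J1 + 1" "j \<le> J2 + 1"
  shows "I\<^sub>H (u t) i j = u t (node i j)"
proof (cases "(i, j) \<in> interior_idx J1 J2")
  case False
  then have "i = 0 \<or> i = J1 + 1 \<or> j = 0 \<or> j = J2 + 1"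
    using assms by (auto simp: interior_idx_def)
  then have "a1 + real i * h1 = a1 \<or> a1 + real i * h1 = a2 \<or> b1 + real j * h2 = b1 \<or> b1 + real j * h2 = b2"
    using h_width by (auto simp: algebra_simps)
  then have "node i j \<in> frontier D"
    using node_in_D[OF assms(2,3)] frontier_D unfolding node_def by blast
  then have "u t (node i j) = 0"
    using u_boundary assms(1) by blast
  with False show ?thesis
    by (simp add: grid_interp_def)
qed (rule interp_interior)

lemma interp_u_bounded:
  assumes "t \<in> {0..T}"
  shows "\<bar>I\<^sub>H (u t) i j\<bar> \<le> \<delta> / 2"
proof (cases "(i, j) \<in> interior_idx J1 J2")
  case True
  then show ?thesis
    using interp_interior interior_node_in_D u_bounded[OF assms] by simp
next
  case False
  then show ?thesis
    using \<delta>_pos by (simp add: grid_interp_def)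
qed

lemma interp_initial: "I\<^sub>H (u 0) = I\<^sub>H u0"
proof (intro ext)
  fix i j show "I\<^sub>H (u 0) i j = I\<^sub>H u0 i j"
  proof (cases "(i, j) \<in> interior_idx J1 J2")
    case True
    then show ?thesis
      using interp_interior interior_node_in_D u_initial by simp
  qed (simp add: grid_interp_def)
qed

context
  fixes M :: real
  assumes M: "data_bound M"
begin

lemma laplacian_consistency:
  assumes "t \<in> {0..T}" "(i, j) \<in> interior_idx J1 J2"
  shows "\<bar>\<Delta>\<^sub>H (I\<^sub>H (u t)) i j - (u_x1_2 t (node i j) + u_x2_2 t (node i j))\<bar> \<le> M * (h1\<^sup>2 + h2\<^sup>2)"
proof -
  define x y where "x = a1 + real i * h1" and "y = b1 + real j * h2"
  have ij: "1 \<le> i" "i \<le> J1" "1 \<le> j" "j \<le> J2"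
    using assms(2) by (auto simp: interior_idx_def)
  have n: "node i j = (x, y)" "node (i - 1) j = (x - h1, y)" "node (i + 1) j = (x + h1, y)"
    "node i (j - 1) = (x, y - h2)" "node i (j + 1) = (x, y + h2)"
    using ij by (simp_all add: node_def x_def y_def of_nat_diff algebra_simps)
  have xin: "x \<in> {a1..a2}" "x - h1 \<in> {a1..a2}" "x + h1 \<in> {a1..a2}"
    using coordinate_in(1)[of i] coordinate_in(1)[of "i - 1"] coordinate_in(1)[of "i + 1"] ij
    by (simp_all add: x_def of_nat_diff algebra_simps)
  have yin: "y \<in> {b1..b2}" "y - h2 \<in> {b1..b2}" "y + h2 \<in> {b1..b2}"
    using coordinate_in(2)[of j] coordinate_in(2)[of "j - 1"] coordinate_in(2)[of "j + 1"] ij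
    by (simp_all add: y_def of_nat_diff algebra_simps)
  have lap: "\<Delta>\<^sub>H (I\<^sub>H (u t)) i j = (u t (x - h1, y) - 2 * u t (x, y) + u t (x + h1, y)) / h1\<^sup>2
      + (u t (x, y - h2) - 2 * u t (x, y) + u t (x, y + h2)) / h2\<^sup>2"
    using assms ij interp_u[OF assms(1)] unfolding n(2-)[symmetric] n(1)[symmetric]
    by (simp add: discrete_laplacian_def)
  have "\<bar>(u t (x - h1, y) - 2 * u t (x, y) + u t (x + h1, y)) / h1\<^sup>2 - u_x1_2 t (x, y)\<bar> \<le> M * h1\<^sup>2"
    by (rule second_difference_quotient[where a = a1 and b = a2, OF partial_x1D[OF u_x1] partial_x1D[OF u_x1_2]
          partial_x1D[OF u_x1_3] partial_x1D[OF u_x1_4]])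
      (use assms(1) xin yin h_pos data_le(4)[OF M] in \<open>auto simp: D_eq\<close>)
  moreover have "\<bar>(u t (x, y - h2) - 2 * u t (x, y) + u t (x, y + h2)) / h2\<^sup>2 - u_x2_2 t (x, y)\<bar> \<le> M * h2\<^sup>2"
    by (rule second_difference_quotient[where a = b1 and b = b2, OF partial_x2D[OF u_x2] partial_x2D[OF u_x2_2]
          partial_x2D[OF u_x2_3] partial_x2D[OF u_x2_4]])
      (use assms(1) xin yin h_pos data_le(5)[OF M] in \<open>auto simp: D_eq\<close>)
  ultimately show ?thesis
    unfolding lap n(1) distrib_left by linarith
qed

text \<open>The equation at time \<tau>/2 eliminates \<open>f\<close>. The backward difference and
  the replacement of \<open>g (u (\<tau> / 2) x)\<close> by its initial value cost
  \<open>M * \<tau> / 2\<close> each.\<close>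

lemma half_step_consistency:
  assumes "(i, j) \<in> interior_idx J1 J2"
  shows "\<bar>(I\<^sub>H (u (\<tau> / 2)) i j - I\<^sub>H u0 i j) / (\<tau> / 2)
      - (\<Delta>\<^sub>H (I\<^sub>H (u (\<tau> / 2))) i j + g (I\<^sub>H u0 i j) + I\<^sub>H (f (\<tau> / 2)) i j)\<bar>
    \<le> M * (\<tau> + h1\<^sup>2 + h2\<^sup>2)"
proof -
  define x where "x = node i j"
  have x: "x \<in> D"
    unfolding x_def using assms by (rule interior_node_in_D)
  have t: "\<tau> / 2 \<in> {0..T}" "0 \<in> {0..T}"
    using \<tau>_pos \<tau>_le by auto
  have I: "I\<^sub>H z i j = z x" for z
    unfolding x_def using assms by (rule interp_interior)
  have a: "f (\<tau> / 2) x = u_t (\<tau> / 2) x - (u_x1_2 (\<tau> / 2) x + u_x2_2 (\<tau> / 2) x) - g (u (\<tau> / 2) x)"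
    using pde x t by (force simp: Q_eq)
  have b: "\<bar>(u (\<tau> / 2) x - u 0 x) / (\<tau> / 2) - u_t (\<tau> / 2) x\<bar> \<le> M * (\<tau> / 2)"
    by (rule u_backward_difference[OF M x]) (use \<tau>_pos \<tau>_le in auto)
  have "\<bar>g (u (\<tau> / 2) x) - g (u 0 x)\<bar> \<le> M * \<bar>\<tau> / 2 - 0\<bar>"
    by (rule \<zeta>_lipschitz[OF M x t])
  then have c: "\<bar>g (u (\<tau> / 2) x) - g (u 0 x)\<bar> \<le> M * (\<tau> / 2)"
    using \<tau>_pos by simp
  have d: "\<bar>\<Delta>\<^sub>H (I\<^sub>H (u (\<tau> / 2))) i j - (u_x1_2 (\<tau> / 2) x + u_x2_2 (\<tau> / 2) x)\<bar> \<le> M * (h1\<^sup>2 + h2\<^sup>2)"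
    unfolding x_def by (rule laplacian_consistency[OF t(1) assms])
  have aux: "\<bar>DQ - (l + g0 + f1)\<bar> \<le> p + p + q"
    if "f1 = ut - l' - g1" "\<bar>DQ - ut\<bar> \<le> p" "\<bar>g1 - g0\<bar> \<le> p" "\<bar>l - l'\<bar> \<le> q"
    for f1 ut l l' g1 g0 DQ p q :: real
    using that(2-4) unfolding that(1) abs_le_iff by (intro conjI; linarith)
  have "u0 x = u 0 x"
    using u_initial x by simp
  then show ?thesis
    using aux[OF a b c d] unfolding I by (simp add: algebra_simps)
qed

text \<open>The equation at both ends of the step eliminates the average of \<open>f\<close>. The
  trapezoidal error and the passage from the average of \<open>g (u t x)\<close> to its midpoint
  value, which \<Phi> is meant to approximate, are second order in \<tau>.\<close>

lemma full_step_consistency: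
  assumes "n < N" "(i, j) \<in> interior_idx J1 J2"
  shows "\<bar>(I\<^sub>H (u (real (Suc n) * \<tau>)) i j - I\<^sub>H (u (real n * \<tau>)) i j) / \<tau>
      - (\<Delta>\<^sub>H (\<lambda>k l. (I\<^sub>H (u (real (Suc n) * \<tau>)) k l + I\<^sub>H (u (real n * \<tau>)) k l) / 2) i j
        + g (I\<^sub>H (u (real n * \<tau> + \<tau> / 2)) i j)
        + I\<^sub>H (\<lambda>x. (f (real (Suc n) * \<tau>) x + f (real n * \<tau>) x) / 2) i j)\<bar>
    \<le> 2 * M * (\<tau>\<^sup>2 + h1\<^sup>2 + h2\<^sup>2)"
proof -
  define x where "x = node i j"
  define t s where "t = real n * \<tau>" and "s = real (Suc n) * \<tau>"
  have x: "x \<in> D"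
    unfolding x_def using assms by (intro interior_node_in_D)
  have ts: "t \<in> {0..T}" "s \<in> {0..T}" "s = t + \<tau>"
    using time_in[of n] time_in[of "Suc n"] assms by (auto simp: t_def s_def algebra_simps)
  have I: "I\<^sub>H z i j = z x" for z
    unfolding x_def using assms by (intro interp_interior)
  have ft: "f r x = u_t r x - (u_x1_2 r x + u_x2_2 r x) - g (u r x)" if "r \<in> {0..T}" for r
    using pde x that by (force simp: Q_eq)
  have a: "\<bar>(u s x - u t x) / \<tau> - (u_t t x + u_t s x) / 2\<bar> \<le> M * \<tau>\<^sup>2"
    unfolding ts(3) by (rule u_trapezoid[OF M x]) (use \<tau>_pos ts in auto)
  have b: "\<bar>(g (u t x) + g (u s x)) / 2 - g (u (t + \<tau> / 2) x)\<bar> \<le> M * \<tau>\<^sup>2"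
    unfolding ts(3) by (rule \<zeta>_midpoint[OF M x]) (use \<tau>_pos ts in auto)
  have lap: "\<bar>\<Delta>\<^sub>H (I\<^sub>H (u r)) i j - (u_x1_2 r x + u_x2_2 r x)\<bar> \<le> M * (h1\<^sup>2 + h2\<^sup>2)"
    if "r \<in> {0..T}" for r
    unfolding x_def by (rule laplacian_consistency[OF that assms(2)])
  have aux: "\<bar>DQ - ((ls + lt) / 2 + gm + (fs + ft) / 2)\<bar> \<le> 2 * p + 2 * q"
    if "\<bar>DQ - (ut + us) / 2\<bar> \<le> p" "\<bar>(gt + gs) / 2 - gm\<bar> \<le> p" "\<bar>lt - lt'\<bar> \<le> q" "\<bar>ls - ls'\<bar> \<le> q"
      "fs = us - ls' - gs" "ft = ut - lt' - gt"
    for DQ ut us gt gs gm lt ls lt' ls' fs ft p q :: real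
  proof -
    have tri: "\<bar>X + Y - v / 2 - w / 2\<bar> \<le> 2 * p + 2 * q"
      if "\<bar>X\<bar> \<le> p" "\<bar>Y\<bar> \<le> p" "\<bar>v\<bar> \<le> q" "\<bar>w\<bar> \<le> q" for X Y v w :: real
      using that by linarith
    have "DQ - ((ls + lt) / 2 + gm + (fs + ft) / 2)
        = (DQ - (ut + us) / 2) + ((gt + gs) / 2 - gm) - (lt - lt') / 2 - (ls - ls') / 2"
      unfolding that(5,6) by (simp add: field_simps)
    then show ?thesis
      using tri[OF that(1-4)] by (simp only:)
  qed
  have "2 * M * (\<tau>\<^sup>2 + h1\<^sup>2 + h2\<^sup>2) = 2 * (M * \<tau>\<^sup>2) + 2 * (M * (h1\<^sup>2 + h2\<^sup>2))"
    by (simp add: algebra_simps)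
  then show ?thesis
    unfolding I s_def[symmetric] t_def[symmetric] discrete_laplacian_average
    using aux[OF a b lap[OF ts(1)] lap[OF ts(2)] ft[OF ts(2)] ft[OF ts(1)]] by (simp only:)
qed

end

end

section \<open>The two schemes\<close>

context discretization
begin

section \<open>Reformulation and unique solvability of the recursions\<close>

lemma half_step_iff:
  "half_step T a1 a2 b1 b2 g f u0 N J1 J2 Uh \<longleftrightarrow> Uh \<in> grid_space J1 J2 \<and>
    (\<forall>(i, j)\<in>interior_idx J1 J2. (Uh i j - I\<^sub>H u0 i j) / (\<tau> / 2)
      = \<Delta>\<^sub>H Uh i j + g (I\<^sub>H u0 i j) + I\<^sub>H (f (\<tau> / 2)) i j)"
  unfolding half_step_def Let_def \<tau>_def ..

text \<open>The reaction term \<open>F\<close> is an arbitrary array, so the step is the same linear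
  problem for both schemes.\<close>

definition full_step :: "grid_fun \<Rightarrow> grid_fun \<Rightarrow> grid_fun \<Rightarrow> nat \<Rightarrow> bool"
  where "full_step V W F n \<longleftrightarrow> (\<forall>i j. (i, j) \<in> interior_idx J1 J2 \<longrightarrow> (W i j - V i j) / \<tau>
    = \<Delta>\<^sub>H (\<lambda>k l. (W k l + V k l) / 2) i j + F i j
      + I\<^sub>H (\<lambda>x. (f (real (Suc n) * \<tau>) x + f (real n * \<tau>) x) / 2) i j)"

lemma relaxation_steps_iff:
  "relaxation_steps T a1 a2 b1 b2 \<gamma> f u0 N J1 J2 Uh U \<Phi> \<longleftrightarrow>
    U 0 = I\<^sub>H u0 \<and> (\<forall>n\<le>N. U n \<in> grid_space J1 J2) \<and> \<Phi> 0 = (\<lambda>i j. \<gamma> (Uh i j)) \<and>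
    (\<forall>n. Suc n < N \<longrightarrow> \<Phi> (Suc n) = (\<lambda>i j. 2 * \<gamma> (U (Suc n) i j) - \<Phi> n i j)) \<and>
    (\<forall>n<N. full_step (U n) (U (Suc n)) (\<Phi> n) n)"
proof -
  have "(\<forall>n\<in>{1..<N}. R n (n - 1)) \<longleftrightarrow> (\<forall>n. Suc n < N \<longrightarrow> R (Suc n) n)" for R
  proof (intro iffI ballI)
    fix n assume *: "\<forall>n. Suc n < N \<longrightarrow> R (Suc n) n" "n \<in> {1..<N}"
    then show "R n (n - 1)"
      by (cases n) auto
  qed force
  from this[of "\<lambda>n m. \<Phi> n = (\<lambda>i j. 2 * \<gamma> (U n i j) - \<Phi> m i j)"] show ?thesis
    unfolding relaxation_steps_def Let_def \<tau>_def[symmetric] full_step_def by force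
qed

text \<open>Multiplying by \<tau> and collecting the new level on the left gives the operator of
  \<open>implicit_step_unique\<close> and \<open>implicit_step_solvable\<close> with \<kappa> =
  \<tau>/2.\<close>

lemma full_step_implicit_form:
  "full_step V W F n \<longleftrightarrow> (\<forall>i j. (i, j) \<in> interior_idx J1 J2 \<longrightarrow> W i j - \<tau> / 2 * \<Delta>\<^sub>H W i j
    = V i j + \<tau> / 2 * \<Delta>\<^sub>H V i j
      + \<tau> * (F i j + I\<^sub>H (\<lambda>x. (f (real (Suc n) * \<tau>) x + f (real n * \<tau>) x) / 2) i j))"
proof -
  have "(w - v) / \<tau> = (l + l') / 2 + p + q \<longleftrightarrow> w - \<tau> / 2 * l = v + \<tau> / 2 * l' + \<tau> * (p + q)"
    for w v l l' p q :: real
    using \<tau>_pos by (auto simp: field_simps)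
  then show ?thesis
    unfolding full_step_def discrete_laplacian_average by simp
qed

lemma full_step_unique:
  assumes "full_step V W F n" "full_step V W' F n" "W \<in> grid_space J1 J2" "W' \<in> grid_space J1 J2"
  shows "W = W'"
  by (rule implicit_step_unique[of "\<tau> / 2"])
    (use assms \<tau>_pos in \<open>auto simp: full_step_implicit_form\<close>)

lemma full_step_solvable: "\<exists>W\<in>grid_space J1 J2. full_step V W F n"
proof -
  have "0 < \<tau> / 2"
    using \<tau>_pos by simp
  from implicit_step_solvable[OF this, of "\<lambda>i j. V i j + \<tau> / 2 * \<Delta>\<^sub>H V i j
      + \<tau> * (F i j + I\<^sub>H (\<lambda>x. (f (real (Suc n) * \<tau>) x + f (real n * \<tau>) x) / 2) i j)"]
  obtain W where "W \<in> grid_space J1 J2" and "full_step V W F n"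
    unfolding full_step_implicit_form by blast
  then show ?thesis
    by blast
qed

lemma relaxation_steps_solvable:
  "\<exists>V \<Phi>. relaxation_steps T a1 a2 b1 b2 \<gamma> f u0 N J1 J2 Uh V \<Phi>"
proof -
  \<comment> \<open>The state at level \<open>n\<close> is the pair of solution and reaction term.
    The pair is continued beyond \<open>N\<close>, where nothing is required of it, so that
    dependent choice applies to all levels.\<close>
  define R where "R n X Y \<longleftrightarrow> full_step (fst X) (fst Y) (snd X) n \<and>
    snd Y = (\<lambda>i j. 2 * \<gamma> (fst Y i j) - snd X i j)" for n and X Y :: "grid_fun \<times> grid_fun"
  have "\<exists>X. (\<forall>n. (fst (X n) \<in> grid_space J1 J2 \<and> (n = 0 \<longrightarrow> X n = (I\<^sub>H u0, \<lambda>i j. \<gamma> (Uh i j)))) \<and> R n (X n) (X (Suc n)))"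
  proof (rule dependent_nat_choice)
    show "\<exists>X. fst X \<in> grid_space J1 J2 \<and> (0 = 0 \<longrightarrow> X = (I\<^sub>H u0, \<lambda>i j. \<gamma> (Uh i j)))"
      using interp_in_grid_space by simp
    fix X :: "grid_fun \<times> grid_fun" and n
    obtain W where "W \<in> grid_space J1 J2" "full_step (fst X) W (snd X) n"
      using full_step_solvable by blast
    then show "\<exists>Y. (fst Y \<in> grid_space J1 J2 \<and> (Suc n = 0 \<longrightarrow> Y = (I\<^sub>H u0, \<lambda>i j. \<gamma> (Uh i j)))) \<and> R n X Y"
      by (intro exI[of _ "(W, \<lambda>i j. 2 * \<gamma> (W i j) - snd X i j)"]) (simp add: R_def)
  qed
  then obtain X where X: "\<And>n. fst (X n) \<in> grid_space J1 J2" "X 0 = (I\<^sub>H u0, \<lambda>i j. \<gamma> (Uh i j))"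
    "\<And>n. R n (X n) (X (Suc n))"
    by blast
  then have "relaxation_steps T a1 a2 b1 b2 \<gamma> f u0 N J1 J2 Uh (\<lambda>n. fst (X n)) (\<lambda>n. snd (X n))"
    unfolding relaxation_steps_iff R_def by simp
  then show ?thesis
    by blast
qed

lemma relaxation_steps_unique:
  assumes "relaxation_steps T a1 a2 b1 b2 \<gamma> f u0 N J1 J2 Uh U \<Phi>"
    and "relaxation_steps T a1 a2 b1 b2 \<gamma> f u0 N J1 J2 Uh V \<Psi>"
  shows "\<And>n. n \<le> N \<Longrightarrow> U n = V n" and "\<And>n. n < N \<Longrightarrow> \<Phi> n = \<Psi> n"
proof -
  have *: "(n \<le> N \<longrightarrow> U n = V n) \<and> (n < N \<longrightarrow> \<Phi> n = \<Psi> n)" for n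
  proof (induction n)
    case 0
    then show ?case
      using assms unfolding relaxation_steps_iff by simp
  next
    case (Suc n)
    have "U (Suc n) = V (Suc n)" if "Suc n \<le> N"
    proof (rule full_step_unique)
      show "full_step (U n) (U (Suc n)) (\<Phi> n) n"
        using assms(1) that unfolding relaxation_steps_iff by simp
      show "full_step (U n) (V (Suc n)) (\<Phi> n) n"
        using assms(2) that Suc unfolding relaxation_steps_iff by simp
    qed (use assms that in \<open>simp_all add: relaxation_steps_iff\<close>)
    with Suc show ?case
      using assms unfolding relaxation_steps_iff by simp
  qed
  show "U n = V n" if "n \<le> N" for n
    using * that by blast
  show "\<Phi> n = \<Psi> n" if "n < N" for n
    using * that by blast
qed

section \<open>From the modified scheme to the relaxation scheme\<close>

lemma max_error_eq:
  "max_error T a1 a2 b1 b2 g u N J1 J2 V \<Phi>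
    = (MAX m\<in>{0..N - 1}. norm0H J1 J2 h1 h2 (\<lambda>i j. g (I\<^sub>H (u (real m * \<tau> + \<tau> / 2)) i j) - \<Phi> m i j))
    + (MAX m\<in>{0..N}. norm1H J1 J2 h1 h2 (\<lambda>i j. I\<^sub>H (u (real m * \<tau>)) i j - V m i j))"
  unfolding max_error_def Let_def \<tau>_def ..

lemma powr_\<tau>: "\<tau> powr (3 / 2) + \<tau> powr (1 / 2) * h1\<^sup>2 + \<tau> powr (1 / 2) * h2\<^sup>2
    = sqrt \<tau> * (\<tau> + h1\<^sup>2 + h2\<^sup>2)"
proof -
  have "\<tau> powr (3 / 2) = \<tau> powr (1 / 2 + 1)"
    by simp
  also have "\<dots> = sqrt \<tau> * \<tau>"
    using \<tau>_pos by (simp only: powr_add powr_one powr_half_sqrt less_imp_le)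
  finally show ?thesis
    using \<tau>_pos by (simp add: powr_half_sqrt algebra_simps)
qed

text \<open>Product of the sides over the shorter side is the longer side, so the constant
  \<open>L\<close> of the theorem is the square root of the Sobolev constant. The error is then at
  most \<delta>/2, and so is the exact solution.\<close>

lemma sup_bound:
  assumes "V \<in> grid_space J1 J2" "t \<in> {0..T}"
    and "norm1H J1 J2 h1 h2 (\<lambda>i j. I\<^sub>H (u t) i j - V i j) \<le> B"
    and "sqrt ((a2 - a1) * (b2 - b1) / min (a2 - a1) (b2 - b1)) * (B / sqrt (h1 + h2)) \<le> \<delta> / 2"
  shows "\<bar>V i j\<bar> \<le> \<delta>"
proof -
  define e where "e i j = I\<^sub>H (u t) i j - V i j" for i j
  define m where "m = max (a2 - a1) (b2 - b1)"
  have m: "(a2 - a1) * (b2 - b1) / min (a2 - a1) (b2 - b1) = m"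
    using a_less b_less by (auto simp: m_def min_def max_def field_simps)
  have e: "e \<in> grid_space J1 J2"
    using assms(1) interp_in_grid_space[of "u t"] by (auto simp: grid_space_def e_def)
  have "(h1 + h2) * (e i j)\<^sup>2 \<le> m * sq1 e"
    using discrete_sobolev[OF e, of i j] unfolding h_width m_def .
  then have "sqrt ((h1 + h2) * (e i j)\<^sup>2) \<le> sqrt (m * sq1 e)"
    by (rule real_sqrt_le_mono)
  then have "sqrt (h1 + h2) * \<bar>e i j\<bar> \<le> sqrt m * norm1H J1 J2 h1 h2 e"
    by (simp add: real_sqrt_mult norm1H_eq)
  also have "\<dots> \<le> sqrt m * B"
    using assms(3) a_less unfolding e_def[abs_def, symmetric]
    by (intro mult_left_mono) (auto simp: m_def le_max_iff_disj)
  finally have "\<bar>e i j\<bar> \<le> sqrt m * (B / sqrt (h1 + h2))"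
    using h_pos by (simp add: field_simps)
  also have "\<dots> \<le> \<delta> / 2"
    using assms(4) unfolding m .
  finally have "\<bar>e i j\<bar> \<le> \<delta> / 2" .
  with interp_u_bounded[OF assms(2), of i j] show ?thesis
    unfolding e_def by linarith
qed

text \<open>The discrete Sobolev inequality keeps the modified scheme in the range where the mollifier
  is the identity, so that it coincides with the relaxation scheme.\<close>

lemma rfd_error:
  assumes P: "property_P T a1 a2 b1 b2 g f u0 u \<delta> C1 C2 C3" and J: "1 \<le> J1" "1 \<le> J2"
    and C1: "\<tau> * C1 \<le> 1 / 2"
    and L: "L = sqrt ((a2 - a1) * (b2 - b1) / min (a2 - a1) (b2 - b1))"
    and C3: "C3 * L * ((\<tau>\<^sup>2 + h1\<^sup>2 + h2\<^sup>2) / sqrt (h1 + h2)) \<le> \<delta> / 2"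
    and C2: "C2 * L * ((\<tau> powr (3 / 2) + \<tau> powr (1 / 2) * h1\<^sup>2 + \<tau> powr (1 / 2) * h2\<^sup>2) / sqrt (h1 + h2)) \<le> \<delta> / 2"
    and rfd: "rfd_scheme T a1 a2 b1 b2 g f u0 N J1 J2 Uh U \<Phi>"
  shows "max_error T a1 a2 b1 b2 g u N J1 J2 U \<Phi> \<le> C3 * (\<tau>\<^sup>2 + h1\<^sup>2 + h2\<^sup>2)"
proof -
  \<comment> \<open>The half step does not involve the mollifier, so the given \<open>Uh\<close>
    also starts the modified scheme.\<close>
  obtain V \<Psi> where rel: "relaxation_steps T a1 a2 b1 b2 (\<lambda>x. g (mollifier \<delta> x)) f u0 N J1 J2 Uh V \<Psi>"
    using relaxation_steps_solvable by blast
  then have "modified_scheme T a1 a2 b1 b2 g f u0 \<delta> N J1 J2 Uh V \<Psi>"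
    using rfd unfolding rfd_scheme_def modified_scheme_def by simp
  then have err: "half_step_error T a1 a2 b1 b2 u N J1 J2 Uh
      \<le> C2 * (\<tau> powr (3 / 2) + \<tau> powr (1 / 2) * h1\<^sup>2 + \<tau> powr (1 / 2) * h2\<^sup>2)"
    "max_error T a1 a2 b1 b2 g u N J1 J2 V \<Psi> \<le> C3 * (\<tau>\<^sup>2 + h1\<^sup>2 + h2\<^sup>2)"
    using P N_pos J C1 unfolding property_P_def Let_def \<tau>_def by blast+
  have "Uh \<in> grid_space J1 J2"
    using rfd unfolding rfd_scheme_def half_step_iff by simp
  then have Uh: "\<bar>Uh i j\<bar> \<le> \<delta>" for i j
    by (rule sup_bound[where t = "\<tau> / 2"])
      (use err(1) C2 \<tau>_pos \<tau>_le in \<open>auto simp: half_step_error_def \<tau>_def[symmetric] L mult_ac\<close>)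
  have V: "\<bar>V m i j\<bar> \<le> \<delta>" if "m \<le> N" for m i j
  proof (rule sup_bound)
    show "V m \<in> grid_space J1 J2"
      using rel that unfolding relaxation_steps_iff by simp
    show "real m * \<tau> \<in> {0..T}"
      using that by (rule time_in)
    \<comment> \<open>\<open>max_error\<close> is a sum of two maxima; the one for the reaction
      terms is nonnegative and may be dropped to isolate the H1 error of \<open>V m\<close>.\<close>
    have "0 \<le> norm0H J1 J2 h1 h2 (\<lambda>i j. g (I\<^sub>H (u (real 0 * \<tau> + \<tau> / 2)) i j) - \<Psi> 0 i j)"
      by (simp add: norm0H_eq sq0_nonneg)
    also have "\<dots> \<le> (MAX m\<in>{0..N - 1}. norm0H J1 J2 h1 h2 (\<lambda>i j. g (I\<^sub>H (u (real m * \<tau> + \<tau> / 2)) i j) - \<Psi> m i j))"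
      by (rule Max_ge) (auto intro!: image_eqI[where x = 0])
    finally have "0 \<le> (MAX m\<in>{0..N - 1}. norm0H J1 J2 h1 h2 (\<lambda>i j. g (I\<^sub>H (u (real m * \<tau> + \<tau> / 2)) i j) - \<Psi> m i j))" .
    moreover have "norm1H J1 J2 h1 h2 (\<lambda>i j. I\<^sub>H (u (real m * \<tau>)) i j - V m i j)
        \<le> (MAX m\<in>{0..N}. norm1H J1 J2 h1 h2 (\<lambda>i j. I\<^sub>H (u (real m * \<tau>)) i j - V m i j))"
      using that by (intro Max_ge) auto
    ultimately show "norm1H J1 J2 h1 h2 (\<lambda>i j. I\<^sub>H (u (real m * \<tau>)) i j - V m i j) \<le> C3 * (\<tau>\<^sup>2 + h1\<^sup>2 + h2\<^sup>2)"
      using err(2) unfolding max_error_eq by linarith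
    show "sqrt ((a2 - a1) * (b2 - b1) / min (a2 - a1) (b2 - b1)) * (C3 * (\<tau>\<^sup>2 + h1\<^sup>2 + h2\<^sup>2) / sqrt (h1 + h2)) \<le> \<delta> / 2"
      using C3 by (simp add: L mult_ac)
  qed
  have "relaxation_steps T a1 a2 b1 b2 g f u0 N J1 J2 Uh V \<Psi>"
    using rel Uh V mollifier_id[OF \<delta>_pos] unfolding relaxation_steps_iff by simp
  then have eq: "\<And>n. n \<le> N \<Longrightarrow> U n = V n" "\<And>n. n < N \<Longrightarrow> \<Phi> n = \<Psi> n"
    using relaxation_steps_unique rfd unfolding rfd_scheme_def by blast+
  have "max_error T a1 a2 b1 b2 g u N J1 J2 U \<Phi> = max_error T a1 a2 b1 b2 g u N J1 J2 V \<Psi>"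
    unfolding max_error_eq using N_pos eq
    by (intro arg_cong2[where f = "(+)"] arg_cong[where f = Max] image_cong refl) auto
  with err(2) show ?thesis
    by simp
qed

end

section \<open>Error of the modified scheme\<close>

context discretization
begin

section \<open>Error equations and recursions for the reaction error\<close>

definition err :: "real \<Rightarrow> grid_fun \<Rightarrow> grid_fun"
  where "err t W i j = I\<^sub>H (u t) i j - W i j"

definition reaction_err :: "nat \<Rightarrow> grid_fun \<Rightarrow> grid_fun"
  where "reaction_err n F i j = g (I\<^sub>H (u (real n * \<tau> + \<tau> / 2)) i j) - F i j"

lemma err_in_grid_space: "W \<in> grid_space J1 J2 \<Longrightarrow> err t W \<in> grid_space J1 J2"
  using interp_in_grid_space[of "u t"] by (auto simp: grid_space_def err_def)

lemma laplacian_err: "\<Delta>\<^sub>H (err t W) i j = \<Delta>\<^sub>H (I\<^sub>H (u t)) i j - \<Delta>\<^sub>H W i j"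
  unfolding err_def[abs_def] by (rule discrete_laplacian_diff)

lemma err_poincare:
  "W \<in> grid_space J1 J2 \<Longrightarrow> sq0 (err t W) \<le> (a2 - a1)\<^sup>2 * sq1 (err t W)"
  using discrete_poincare[OF err_in_grid_space] unfolding h_width .

text \<open>Exact values lie where the mollifier is the identity, so it can be inserted to compare
  exact and approximate reactions through the same globally Lipschitz function.\<close>

lemma mollified_u:
  "t \<in> {0..T} \<Longrightarrow> g (mollifier \<delta> (I\<^sub>H (u t) i j)) = g (I\<^sub>H (u t) i j)"
  using mollifier_id[OF \<delta>_pos] interp_u_bounded \<delta>_pos by (smt (verit) field_sum_of_halves)

context
  fixes M K :: real and Vh :: grid_fun and V \<Phi> :: "nat \<Rightarrow> grid_fun"
  assumes M: "data_bound M" and K: "0 \<le> K"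
    and lip: "\<And>x y. \<bar>g (mollifier \<delta> x) - g (mollifier \<delta> y)\<bar> \<le> K * \<bar>x - y\<bar>"
    and sd: "\<And>a b c d. \<bar>g (mollifier \<delta> a) - g (mollifier \<delta> b) - (g (mollifier \<delta> c) - g (mollifier \<delta> d))\<bar>
      \<le> K * (\<bar>a - b - (c - d)\<bar> + (\<bar>a - c\<bar> + \<bar>b - d\<bar>) * \<bar>a - b\<bar>)"
    and scheme: "modified_scheme T a1 a2 b1 b2 g f u0 \<delta> N J1 J2 Vh V \<Phi>"
begin

abbreviation G :: real where "G \<equiv> (a2 - a1) * (b2 - b1)"
abbreviation eh :: grid_fun where "eh \<equiv> err (\<tau> / 2) Vh"
abbreviation e :: "nat \<Rightarrow> grid_fun" where "e n \<equiv> err (real n * \<tau>) (V n)"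
abbreviation \<theta> :: "nat \<Rightarrow> grid_fun" where "\<theta> n \<equiv> reaction_err n (\<Phi> n)"

lemma schemeD:
  "Vh \<in> grid_space J1 J2"
  "(i, j) \<in> interior_idx J1 J2 \<Longrightarrow>
    (Vh i j - I\<^sub>H u0 i j) / (\<tau> / 2) = \<Delta>\<^sub>H Vh i j + g (I\<^sub>H u0 i j) + I\<^sub>H (f (\<tau> / 2)) i j"
  "V 0 = I\<^sub>H u0" "n \<le> N \<Longrightarrow> V n \<in> grid_space J1 J2"
  "\<Phi> 0 i j = g (mollifier \<delta> (Vh i j))"
  "Suc n < N \<Longrightarrow> \<Phi> (Suc n) i j = 2 * g (mollifier \<delta> (V (Suc n) i j)) - \<Phi> n i j"
  "n < N \<Longrightarrow> full_step (V n) (V (Suc n)) (\<Phi> n) n"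
  using scheme unfolding modified_scheme_def half_step_iff relaxation_steps_iff by auto

text \<open>The initial values are exact, so the error equation of the half step starts from zero.
  Both parts of the energy are used later: the L2 part starts the recursion of the reaction error,
  the H1 part gives the half step bound of \<open>property_P\<close>.\<close>

lemma half_step_energy:
  "sq0 eh / (\<tau> / 2) + 2 * sq1 eh \<le> \<tau> / 2 * (G * (M * (\<tau> + h1\<^sup>2 + h2\<^sup>2))\<^sup>2)"
proof -
  define F where "F i j = (I\<^sub>H (u (\<tau> / 2)) i j - I\<^sub>H u0 i j) / (\<tau> / 2)
      - (\<Delta>\<^sub>H (I\<^sub>H (u (\<tau> / 2))) i j + g (I\<^sub>H u0 i j) + I\<^sub>H (f (\<tau> / 2)) i j)" for i j
  have "eh i j / (\<tau> / 2) = \<Delta>\<^sub>H eh i j + F i j" if "(i, j) \<in> interior_idx J1 J2" for i j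
  proof -
    have "eh i j / (\<tau> / 2) = (I\<^sub>H (u (\<tau> / 2)) i j - I\<^sub>H u0 i j) / (\<tau> / 2) - (Vh i j - I\<^sub>H u0 i j) / (\<tau> / 2)"
      unfolding err_def diff_divide_distrib by simp
    then show ?thesis
      unfolding schemeD(2)[OF that] laplacian_err F_def by simp
  qed
  then have "sq0 eh / (\<tau> / 2) + 2 * sq1 eh \<le> \<tau> / 2 * sq0 F"
    using \<tau>_pos err_in_grid_space[OF schemeD(1)] by (intro energy_implicit_step) auto
  also have "sq0 F \<le> G * (M * (\<tau> + h1\<^sup>2 + h2\<^sup>2))\<^sup>2"
    unfolding h_width[symmetric] F_def using half_step_consistency[OF M] by (intro sq0_uniform_bound)
  finally show ?thesis
    using \<tau>_pos by simp
qed

lemma full_step_energy: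
  assumes "n < N"
  shows "sq0 (\<lambda>i j. e (Suc n) i j - e n i j) / \<tau> + sq1 (e (Suc n))
    \<le> sq1 (e n) + 2 * \<tau> * (sq0 (\<theta> n) + G * (2 * M * (\<tau>\<^sup>2 + h1\<^sup>2 + h2\<^sup>2))\<^sup>2)"
proof -
  define R where "R i j = (I\<^sub>H (u (real (Suc n) * \<tau>)) i j - I\<^sub>H (u (real n * \<tau>)) i j) / \<tau>
      - (\<Delta>\<^sub>H (\<lambda>k l. (I\<^sub>H (u (real (Suc n) * \<tau>)) k l + I\<^sub>H (u (real n * \<tau>)) k l) / 2) i j
        + g (I\<^sub>H (u (real n * \<tau> + \<tau> / 2)) i j)
        + I\<^sub>H (\<lambda>x. (f (real (Suc n) * \<tau>) x + f (real n * \<tau>) x) / 2) i j)" for i j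
  have "(e (Suc n) i j - e n i j) / \<tau>
      = \<Delta>\<^sub>H (\<lambda>k l. (e (Suc n) k l + e n k l) / 2) i j + (\<theta> n i j + R i j)"
    if "(i, j) \<in> interior_idx J1 J2" for i j
  proof -
    have "(e (Suc n) i j - e n i j) / \<tau> = (I\<^sub>H (u (real (Suc n) * \<tau>)) i j - I\<^sub>H (u (real n * \<tau>)) i j) / \<tau>
        - (V (Suc n) i j - V n i j) / \<tau>"
      unfolding err_def diff_divide_distrib by simp
    also have "(V (Suc n) i j - V n i j) / \<tau> = \<Delta>\<^sub>H (\<lambda>k l. (V (Suc n) k l + V n k l) / 2) i j + \<Phi> n i j
        + I\<^sub>H (\<lambda>x. (f (real (Suc n) * \<tau>) x + f (real n * \<tau>) x) / 2) i j"
      using schemeD(7)[OF assms] that unfolding full_step_def by blast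
    finally have eq: "(e (Suc n) i j - e n i j) / \<tau> = (I\<^sub>H (u (real (Suc n) * \<tau>)) i j - I\<^sub>H (u (real n * \<tau>)) i j) / \<tau>
      - (\<Delta>\<^sub>H (\<lambda>k l. (V (Suc n) k l + V n k l) / 2) i j + \<Phi> n i j
        + I\<^sub>H (\<lambda>x. (f (real (Suc n) * \<tau>) x + f (real n * \<tau>) x) / 2) i j)" .
    have "X - ((l' + m') / 2 + p + F) = ((l - l') + (m - m')) / 2 + ((z - p) + (X - ((l + m) / 2 + z + F)))"
      for X l m l' m' p F z :: real
      by (simp add: add_divide_distrib diff_divide_distrib)
    then show ?thesis
      unfolding eq discrete_laplacian_average laplacian_err R_def reaction_err_def .
  qed
  then have energy: "sq0 (\<lambda>i j. e (Suc n) i j - e n i j) / \<tau> + sq1 (e (Suc n))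
      \<le> sq1 (e n) + \<tau> * sq0 (\<lambda>i j. \<theta> n i j + R i j)"
    using \<tau>_pos assms by (intro energy_step err_in_grid_space schemeD(4)) auto
  have R: "sq0 R \<le> G * (2 * M * (\<tau>\<^sup>2 + h1\<^sup>2 + h2\<^sup>2))\<^sup>2"
    unfolding h_width[symmetric] R_def using full_step_consistency[OF M assms] by (intro sq0_uniform_bound)
  have "sq0 (\<lambda>i j. \<theta> n i j + R i j) \<le> 2 * (sq0 (\<theta> n) + sq0 R)"
    by (rule sq0_le_two) (rule abs_triangle_ineq)
  also have "\<dots> \<le> 2 * (sq0 (\<theta> n) + G * (2 * M * (\<tau>\<^sup>2 + h1\<^sup>2 + h2\<^sup>2))\<^sup>2)"
    using R by (intro mult_left_mono add_left_mono) auto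
  finally have "\<tau> * sq0 (\<lambda>i j. \<theta> n i j + R i j)
      \<le> \<tau> * (2 * (sq0 (\<theta> n) + G * (2 * M * (\<tau>\<^sup>2 + h1\<^sup>2 + h2\<^sup>2))\<^sup>2))"
    using \<tau>_pos by (intro mult_left_mono) auto
  also have "\<dots> = 2 * \<tau> * (sq0 (\<theta> n) + G * (2 * M * (\<tau>\<^sup>2 + h1\<^sup>2 + h2\<^sup>2))\<^sup>2)"
    by (simp only: mult_ac)
  finally show ?thesis
    using add_left_mono energy order_trans by blast
qed

lemma reaction_err_0: "sq0 (\<theta> 0) \<le> K\<^sup>2 * sq0 eh"
proof (rule sq0_le_scale)
  fix i j
  have "\<tau> / 2 \<in> {0..T}"
    using \<tau>_pos \<tau>_le by auto
  then have "\<theta> 0 i j = g (mollifier \<delta> (I\<^sub>H (u (\<tau> / 2)) i j)) - g (mollifier \<delta> (Vh i j))"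
    unfolding reaction_err_def schemeD(5) by (simp add: mollified_u)
  then show "\<bar>\<theta> 0 i j\<bar> \<le> K * \<bar>eh i j\<bar>"
    using lip by (simp add: err_def)
qed

lemma sq0_const_le: "sq0 (\<lambda>i j. c) \<le> G * c\<^sup>2"
  unfolding h_width[symmetric] using sq0_uniform_bound[of "\<lambda>i j. c" "\<bar>c\<bar>"] by simp

text \<open>Two-level differencing would need a reaction error before the half step, so here the
  one-level relation is used. It brings in the full \<open>e 1\<close>, not an increment, but only
  once, and \<open>e 1\<close> is controlled by the first energy step.\<close>

lemma reaction_err_1:
  assumes "1 < N"
  shows "sq0 (\<theta> 1) \<le> 2 * (sq0 (\<theta> 0) + 2 * ((2 * K)\<^sup>2 * sq0 (e 1) + G * (2 * M * \<tau>\<^sup>2)\<^sup>2))"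
proof -
  have pt: "\<bar>\<theta> 1 i j\<bar> \<le> \<bar>\<theta> 0 i j\<bar> + \<bar>\<bar>2 * K * e 1 i j\<bar> + \<bar>2 * M * \<tau>\<^sup>2\<bar>\<bar>"
    if ij: "(i, j) \<in> interior_idx J1 J2" for i j
  proof -
    define z where "z t = g (I\<^sub>H (u t) i j)" for t
    have t: "\<tau> + \<tau> / 2 \<in> {0..T}" "\<tau> \<in> {0..T}"
      using half_time_in[OF assms] \<tau>_pos \<tau>_le by auto
    have "\<bar>(z (\<tau> / 2) + z (\<tau> / 2 + \<tau>)) / 2 - z (\<tau> / 2 + \<tau> / 2)\<bar> \<le> M * \<tau>\<^sup>2"
      unfolding z_def interp_interior[OF ij]
      by (rule \<zeta>_midpoint[OF M interior_node_in_D[OF ij]]) (use \<tau>_pos t in auto)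
    moreover have "\<bar>a + b - 2 * c\<bar> \<le> 2 * m" if "\<bar>(a + b) / 2 - c\<bar> \<le> m" for a b c m :: real
    proof -
      have "a + b - 2 * c = 2 * ((a + b) / 2 - c)"
        by (simp add: field_simps)
      then have "\<bar>a + b - 2 * c\<bar> = 2 * \<bar>(a + b) / 2 - c\<bar>"
        by (simp only: abs_mult abs_numeral)
      with that show ?thesis
        by (simp only: mult_le_cancel_left_pos zero_less_numeral)
    qed
    moreover have "\<tau> / 2 + \<tau> = \<tau> + \<tau> / 2" "\<tau> / 2 + \<tau> / 2 = \<tau>"
      by simp_all
    ultimately have mid: "\<bar>z (\<tau> / 2) + z (\<tau> + \<tau> / 2) - 2 * z \<tau>\<bar> \<le> 2 * M * \<tau>\<^sup>2"
      by (metis mult.assoc)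
    have "\<bar>g (mollifier \<delta> (I\<^sub>H (u \<tau>) i j)) - g (mollifier \<delta> (V 1 i j))\<bar> \<le> K * \<bar>e 1 i j\<bar>"
      using lip by (simp add: err_def)
    then have l: "\<bar>z \<tau> - g (mollifier \<delta> (V 1 i j))\<bar> \<le> K * \<bar>e 1 i j\<bar>"
      unfolding mollified_u[OF t(2)] z_def .
    have "\<theta> 1 i j = z (\<tau> + \<tau> / 2) - 2 * g (mollifier \<delta> (V 1 i j)) + \<Phi> 0 i j"
      using schemeD(6)[of 0] assms by (simp add: reaction_err_def z_def)
    moreover have "\<theta> 0 i j = z (\<tau> / 2) - \<Phi> 0 i j"
      by (simp add: reaction_err_def z_def)
    ultimately have eq: "\<theta> 1 i j = (z (\<tau> / 2) + z (\<tau> + \<tau> / 2) - 2 * z \<tau>)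
        + 2 * (z \<tau> - g (mollifier \<delta> (V 1 i j))) - \<theta> 0 i j"
      by simp
    have "\<bar>x + 2 * y - w\<bar> \<le> \<bar>w\<bar> + (2 * q + p)" if "\<bar>x\<bar> \<le> p" "\<bar>y\<bar> \<le> q" for x y w p q :: real
      using that by linarith
    from this[OF mid l] have "\<bar>\<theta> 1 i j\<bar> \<le> \<bar>\<theta> 0 i j\<bar> + (2 * (K * \<bar>e 1 i j\<bar>) + 2 * M * \<tau>\<^sup>2)"
      unfolding eq .
    also have "2 * (K * \<bar>e 1 i j\<bar>) + 2 * M * \<tau>\<^sup>2 = \<bar>\<bar>2 * K * e 1 i j\<bar> + \<bar>2 * M * \<tau>\<^sup>2\<bar>\<bar>"
      using K M_nonneg[OF M] by (simp add: abs_mult)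
    finally show ?thesis .
  qed
  have "sq0 (\<theta> 1) \<le> 2 * (sq0 (\<theta> 0) + sq0 (\<lambda>i j. \<bar>2 * K * e 1 i j\<bar> + \<bar>2 * M * \<tau>\<^sup>2\<bar>))"
    using pt by (rule sq0_le_two)
  also have "sq0 (\<lambda>i j. \<bar>2 * K * e 1 i j\<bar> + \<bar>2 * M * \<tau>\<^sup>2\<bar>)
      \<le> 2 * (sq0 (\<lambda>i j. 2 * K * e 1 i j) + sq0 (\<lambda>i j. 2 * M * \<tau>\<^sup>2))"
    by (rule sq0_le_two) simp
  also have "sq0 (\<lambda>i j. 2 * K * e 1 i j) = (2 * K)\<^sup>2 * sq0 (e 1)"
    by (rule sq0_scale)
  also have "sq0 (\<lambda>i j. 2 * M * \<tau>\<^sup>2) \<le> G * (2 * M * \<tau>\<^sup>2)\<^sup>2"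
    by (rule sq0_const_le)
  finally show ?thesis
    by simp
qed

text \<open>Two relaxation steps are combined, so that only the increment of the error and a third
  difference of \<open>g (u t x)\<close> in time enter.\<close>

lemma reaction_err_Suc_Suc:
  assumes "Suc (Suc n) < N"
  shows "sq0 (\<theta> (Suc (Suc n))) \<le> (1 + \<tau>) * sq0 (\<theta> n)
    + (1 + 1 / \<tau>) * (4 * ((2 * K)\<^sup>2 * sq0 (\<lambda>i j. e (Suc (Suc n)) i j - e (Suc n) i j)
      + (2 * K * M * \<tau>)\<^sup>2 * sq0 (e (Suc (Suc n))) + (2 * K * M * \<tau>)\<^sup>2 * sq0 (e (Suc n))
      + G * (3 * M * \<tau> ^ 3)\<^sup>2))"
proof -
  define t2 t1 where "t2 = real (Suc (Suc n)) * \<tau>" and "t1 = real (Suc n) * \<tau>"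
  have tt: "t1 = t2 - \<tau>" "real n * \<tau> = t2 - 2 * \<tau>"
    by (simp_all add: t1_def t2_def algebra_simps)
  have t: "t2 \<in> {0..T}" "t1 \<in> {0..T}" "t2 + \<tau> / 2 \<in> {0..T}" "t2 - 2 * \<tau> \<in> {0..T}"
    using time_in[of "Suc (Suc n)"] time_in[of "Suc n"] half_time_in[OF assms] time_in[of n] assms
    unfolding t2_def[symmetric] t1_def[symmetric] tt(2) by simp_all
  let ?\<theta>2 = "\<theta> (Suc (Suc n))" and ?e2 = "e (Suc (Suc n))" and ?e1 = "e (Suc n)"
  have pt: "\<bar>?\<theta>2 i j\<bar> \<le> \<bar>\<theta> n i j\<bar> + (\<bar>2 * K * (?e2 i j - ?e1 i j)\<bar> + \<bar>2 * K * M * \<tau> * ?e2 i j\<bar>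
      + \<bar>2 * K * M * \<tau> * ?e1 i j\<bar> + \<bar>3 * M * \<tau> ^ 3\<bar>)"
    if ij: "(i, j) \<in> interior_idx J1 J2" for i j
  proof -
    define z where "z t = g (I\<^sub>H (u t) i j)" for t
    define G2 G1 where "G2 = g (mollifier \<delta> (V (Suc (Suc n)) i j))" and "G1 = g (mollifier \<delta> (V (Suc n) i j))"
    define d2 d1 where "d2 = ?e2 i j" and "d1 = ?e1 i j"
    \<comment> \<open>The third difference is centred at \<open>t2\<close> with half a time step.
      Its outer points are the midpoints belonging to the levels \<open>n + 2\<close> and
      \<open>n\<close>, and the midpoint between them cancels.\<close>
    have raw: "\<bar>(z (t2 + \<tau> / 2) + z (t2 - \<tau> / 2) - 2 * z t2)
        - (z (t2 - \<tau> / 2) + z (t2 - 3 * (\<tau> / 2)) - 2 * z (t2 - 2 * (\<tau> / 2)))\<bar> \<le> 24 * M * (\<tau> / 2) ^ 3"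
      unfolding z_def interp_interior[OF ij]
      by (rule \<zeta>_third_difference[OF M interior_node_in_D[OF ij]]) (use \<tau>_pos t in auto)
    have shift: "t2 - 3 * (\<tau> / 2) = real n * \<tau> + \<tau> / 2" "t2 - 2 * (\<tau> / 2) = t1"
      by (simp_all add: tt)
    have "24 * M * (\<tau> / 2) ^ 3 = 3 * M * \<tau> ^ 3"
      by (simp add: power_divide)
    moreover have "(p + m - 2 * x) - (m + q - 2 * y) = p - q - 2 * x + 2 * y" for p q m x y :: real
      by simp
    ultimately have third: "\<bar>z (t2 + \<tau> / 2) - z (real n * \<tau> + \<tau> / 2) - 2 * z t2 + 2 * z t1\<bar> \<le> 3 * M * \<tau> ^ 3"
      using raw[unfolded shift] by (simp only:)
    \<comment> \<open>The exact values play the role of \<open>a\<close> and \<open>b\<close> in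
      \<open>sd\<close>, so the quadratic term is the error times an exact increment of size
      \<open>M * \<tau>\<close>, and no product of two errors occurs.\<close>
    have "\<bar>z t2 - z t1 - (G2 - G1)\<bar>
        \<le> K * (\<bar>I\<^sub>H (u t2) i j - I\<^sub>H (u t1) i j - (V (Suc (Suc n)) i j - V (Suc n) i j)\<bar>
          + (\<bar>I\<^sub>H (u t2) i j - V (Suc (Suc n)) i j\<bar> + \<bar>I\<^sub>H (u t1) i j - V (Suc n) i j\<bar>)
            * \<bar>I\<^sub>H (u t2) i j - I\<^sub>H (u t1) i j\<bar>)"
      using sd[of "I\<^sub>H (u t2) i j" "I\<^sub>H (u t1) i j" "V (Suc (Suc n)) i j" "V (Suc n) i j"]
      unfolding mollified_u[OF t(1)] mollified_u[OF t(2)] z_def G2_def G1_def .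
    also have "\<dots> = K * (\<bar>d2 - d1\<bar> + (\<bar>d2\<bar> + \<bar>d1\<bar>) * \<bar>I\<^sub>H (u t2) i j - I\<^sub>H (u t1) i j\<bar>)"
      unfolding d2_def d1_def err_def t2_def t1_def by (simp add: algebra_simps)
    also have "\<dots> \<le> K * (\<bar>d2 - d1\<bar> + (\<bar>d2\<bar> + \<bar>d1\<bar>) * (M * \<tau>))"
    proof -
      have "\<bar>I\<^sub>H (u t2) i j - I\<^sub>H (u t1) i j\<bar> \<le> M * \<bar>t2 - t1\<bar>"
        unfolding interp_interior[OF ij] by (rule u_lipschitz[OF M interior_node_in_D[OF ij] t(1,2)])
      then show ?thesis
        using K \<tau>_pos unfolding tt(1) by (intro mult_left_mono add_mono) auto
    qed
    finally have increment: "\<bar>z t2 - z t1 - (G2 - G1)\<bar> \<le> K * (\<bar>d2 - d1\<bar> + (\<bar>d2\<bar> + \<bar>d1\<bar>) * (M * \<tau>))" .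
    have "?\<theta>2 i j = z (t2 + \<tau> / 2) - 2 * G2 + 2 * G1 - \<Phi> n i j"
      using schemeD(6)[OF assms] schemeD(6)[of n] assms
      by (simp add: reaction_err_def z_def G2_def G1_def t2_def)
    moreover have "\<theta> n i j = z (real n * \<tau> + \<tau> / 2) - \<Phi> n i j"
      by (simp add: reaction_err_def z_def)
    ultimately have eq: "?\<theta>2 i j = \<theta> n i j + 2 * (z t2 - z t1 - (G2 - G1))
        + (z (t2 + \<tau> / 2) - z (real n * \<tau> + \<tau> / 2) - 2 * z t2 + 2 * z t1)"
      by simp
    have "\<bar>w + 2 * y + x\<bar> \<le> \<bar>w\<bar> + 2 * q + p" if "\<bar>x\<bar> \<le> p" "\<bar>y\<bar> \<le> q" for x y w p q :: real
      using that by linarith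
    from this[OF third increment]
    have "\<bar>?\<theta>2 i j\<bar> \<le> \<bar>\<theta> n i j\<bar> + 2 * (K * (\<bar>d2 - d1\<bar> + (\<bar>d2\<bar> + \<bar>d1\<bar>) * (M * \<tau>))) + 3 * M * \<tau> ^ 3"
      unfolding eq .
    also have "\<dots> = \<bar>\<theta> n i j\<bar> + (\<bar>2 * K * (d2 - d1)\<bar> + \<bar>2 * K * M * \<tau> * d2\<bar>
      + \<bar>2 * K * M * \<tau> * d1\<bar> + \<bar>3 * M * \<tau> ^ 3\<bar>)"
    proof -
      have abs: "\<bar>2 * K * (d2 - d1)\<bar> = 2 * K * \<bar>d2 - d1\<bar>" "\<bar>2 * K * M * \<tau> * d2\<bar> = 2 * K * M * \<tau> * \<bar>d2\<bar>"
        "\<bar>2 * K * M * \<tau> * d1\<bar> = 2 * K * M * \<tau> * \<bar>d1\<bar>" "\<bar>3 * M * \<tau> ^ 3\<bar> = 3 * M * \<tau> ^ 3"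
        using K M_nonneg[OF M] \<tau>_pos by (simp_all add: abs_mult)
      show ?thesis
        unfolding abs by (simp add: algebra_simps)
    qed
    finally show ?thesis
      unfolding d2_def d1_def .
  qed
  have "sq0 ?\<theta>2 \<le> (1 + \<tau>) * sq0 (\<theta> n) + (1 + 1 / \<tau>) * (4 * (sq0 (\<lambda>i j. 2 * K * (?e2 i j - ?e1 i j))
      + sq0 (\<lambda>i j. 2 * K * M * \<tau> * ?e2 i j) + sq0 (\<lambda>i j. 2 * K * M * \<tau> * ?e1 i j) + sq0 (\<lambda>i j. 3 * M * \<tau> ^ 3)))"
    using \<tau>_pos pt by (rule sq0_le_weighted)
  also have "\<dots> \<le> (1 + \<tau>) * sq0 (\<theta> n) + (1 + 1 / \<tau>) * (4 * ((2 * K)\<^sup>2 * sq0 (\<lambda>i j. ?e2 i j - ?e1 i j)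
      + (2 * K * M * \<tau>)\<^sup>2 * sq0 ?e2 + (2 * K * M * \<tau>)\<^sup>2 * sq0 ?e1 + G * (3 * M * \<tau> ^ 3)\<^sup>2))"
    using \<tau>_pos sq0_const_le[of "3 * M * \<tau> ^ 3"]
    unfolding sq0_scale[of "2 * K" "\<lambda>i j. ?e2 i j - ?e1 i j"] sq0_scale[of "2 * K * M * \<tau>" ?e2]
      sq0_scale[of "2 * K * M * \<tau>" ?e1]
    by (intro add_left_mono mult_left_mono) auto
  finally show ?thesis .
qed

text \<open>\<open>Kr\<close> is a sum of nonnegative terms, each dominating the coefficients in one
  hypothesis of \<open>relaxation_gronwall\<close>: after the 1 come the consistency error of a full
  step, the two-step recursion of \<theta>, the Lipschitz term in \<theta> at level 1, and the half
  step and midpoint errors that start \<theta>.\<close>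

lemma scheme_error:
  fixes Kr :: real
  defines "Kr \<equiv> 1 + 4 * G * M\<^sup>2 + 4 * (1 + T) * (4 * K\<^sup>2 + 4 * K\<^sup>2 * M\<^sup>2 * (a2 - a1)\<^sup>2 + 9 * G * M\<^sup>2)
    + 16 * K\<^sup>2 * (a2 - a1)\<^sup>2 + 2 * K\<^sup>2 * G * M\<^sup>2 * (1 + T)\<^sup>2 + 16 * G * M\<^sup>2"
  defines "S \<equiv> (\<tau>\<^sup>2 + h1\<^sup>2 + h2\<^sup>2)\<^sup>2"
  shows "\<And>m. m < N \<Longrightarrow> sq0 (\<theta> m) \<le> gronwall_const T Kr * S"
    and "\<And>m. m \<le> N \<Longrightarrow> sq1 (e m) \<le> gronwall_const T Kr * S"
proof -
  define A where "A = (a2 - a1)\<^sup>2"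
  have pos: "0 \<le> G" "0 \<le> M" "0 \<le> S" "0 \<le> A" "0 \<le> T"
    using a_less b_less M_nonneg[OF M] T_pos by (simp_all add: S_def A_def)
  define c4 where "c4 = 4 * K\<^sup>2 + 4 * K\<^sup>2 * M\<^sup>2 * A + 9 * G * M\<^sup>2"
  have Kr: "Kr = 1 + 4 * G * M\<^sup>2 + 4 * (1 + T) * c4 + 16 * K\<^sup>2 * A
      + 2 * K\<^sup>2 * G * M\<^sup>2 * (1 + T)\<^sup>2 + 16 * G * M\<^sup>2"
    unfolding Kr_def c4_def A_def ..
  have c4: "4 * K\<^sup>2 \<le> c4" "4 * K\<^sup>2 * M\<^sup>2 * A \<le> c4" "9 * G * M\<^sup>2 \<le> c4" "0 \<le> c4"
    using pos K by (simp_all add: c4_def)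
  have terms: "0 \<le> 4 * G * M\<^sup>2" "0 \<le> 4 * (1 + T) * c4" "0 \<le> 16 * K\<^sup>2 * A"
    "0 \<le> 2 * K\<^sup>2 * G * M\<^sup>2 * (1 + T)\<^sup>2" "0 \<le> 16 * G * M\<^sup>2"
    using pos c4 by simp_all
  have Kr_ge: "1 \<le> Kr" "4 * G * M\<^sup>2 \<le> Kr" "4 * (1 + T) * c4 \<le> Kr" "16 * K\<^sup>2 * A \<le> Kr"
    "2 * K\<^sup>2 * G * M\<^sup>2 * (1 + T)\<^sup>2 + 16 * G * M\<^sup>2 \<le> Kr" "K\<^sup>2 * G * M\<^sup>2 * (1 + T)\<^sup>2 \<le> Kr"
    unfolding Kr using terms by linarith+
  have \<tau>4: "\<tau> ^ 4 \<le> S"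
  proof -
    have "(\<tau>\<^sup>2)\<^sup>2 \<le> (\<tau>\<^sup>2 + h1\<^sup>2 + h2\<^sup>2)\<^sup>2"
      by (intro power_mono) auto
    then show ?thesis
      by (simp add: S_def flip: power_mult)
  qed
  define P D H where "P n = sq1 (e n)" and "D n = sq0 (\<lambda>i j. e n i j - e (n - 1) i j)"
    and "H n = sq0 (\<theta> n)" for n
  have poincare: "sq0 (e n) \<le> A * P n" if "n \<le> N" for n
    unfolding A_def P_def by (rule err_poincare[OF schemeD(4)[OF that]])
  have P0: "P 0 = 0"
  proof -
    have "e 0 = (\<lambda>i j. 0)"
      using schemeD(3) interp_initial by (simp add: err_def[abs_def])
    then show ?thesis
      by (simp add: P_def sq1_def)
  qed
  have nonneg: "0 \<le> P n" "0 \<le> H n" "0 \<le> D n" for n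
    by (simp_all add: P_def H_def D_def sq0_nonneg sq1_nonneg)
  have step_P: "D (Suc n) / \<tau> + P (Suc n) \<le> P n + 2 * \<tau> * (H n + Kr * S)" if "n < N" for n
  proof -
    have "G * (2 * M * (\<tau>\<^sup>2 + h1\<^sup>2 + h2\<^sup>2))\<^sup>2 = 4 * G * M\<^sup>2 * S"
      by (simp add: S_def power_mult_distrib)
    also have "\<dots> \<le> Kr * S"
      using Kr_ge(2) pos by (intro mult_right_mono)
    finally have "2 * \<tau> * (H n + G * (2 * M * (\<tau>\<^sup>2 + h1\<^sup>2 + h2\<^sup>2))\<^sup>2) \<le> 2 * \<tau> * (H n + Kr * S)"
      using \<tau>_pos by (intro mult_left_mono) auto
    then show ?thesis
      using full_step_energy[OF that] by (simp add: P_def H_def D_def)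
  qed
  have step_H: "H (Suc (Suc n)) \<le> (1 + \<tau>) * H n
      + Kr * (D (Suc (Suc n)) / \<tau> + \<tau> * (P (Suc (Suc n)) + P (Suc n)) + \<tau> * S)"
    if n: "Suc (Suc n) < N" for n
  proof -
    define q Q2 Q1 where "q = D (Suc (Suc n))" and "Q2 = sq0 (e (Suc (Suc n)))" and "Q1 = sq0 (e (Suc n))"
    have q: "0 \<le> q" "0 \<le> Q2" "0 \<le> Q1"
      using nonneg by (simp_all add: q_def Q2_def Q1_def sq0_nonneg)
    define X where "X = 4 * ((2 * K)\<^sup>2 * q + (2 * K * M * \<tau>)\<^sup>2 * Q2 + (2 * K * M * \<tau>)\<^sup>2 * Q1 + G * (3 * M * \<tau> ^ 3)\<^sup>2)"
    have "0 \<le> X"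
      using q pos by (simp add: X_def)
    \<comment> \<open>\<tau> is at most \<open>T\<close>. The remaining 1/\<tau> turns
      \<open>q\<close> into the dissipation, the two squared factors \<tau> of the error terms into
      one, and \<tau>^6 into \<tau> times \<tau>^4.\<close>
    have "(1 + 1 / \<tau>) * X \<le> ((1 + T) / \<tau>) * X"
      using \<tau>_pos \<tau>_le \<open>0 \<le> X\<close> by (intro mult_right_mono) (simp_all add: field_simps)
    also have "\<dots> = 4 * (1 + T) * (4 * K\<^sup>2 * (q / \<tau>) + 4 * K\<^sup>2 * M\<^sup>2 * (\<tau> * (Q2 + Q1)) + 9 * G * M\<^sup>2 * (\<tau> * \<tau> ^ 4))"
    proof -
      have X: "X / \<tau> = 4 * (4 * K\<^sup>2 * (q / \<tau>) + 4 * K\<^sup>2 * M\<^sup>2 * (\<tau> * (Q2 + Q1)) + 9 * G * M\<^sup>2 * (\<tau> * \<tau> ^ 4))"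
        using \<tau>_pos by (simp add: X_def field_simps eval_nat_numeral)
      have "(1 + T) / \<tau> * X = (1 + T) * (X / \<tau>)"
        by simp
      then show ?thesis
        unfolding X by (simp only: mult_ac)
    qed
    also have "\<dots> \<le> 4 * (1 + T) * (c4 * (q / \<tau>) + c4 * (\<tau> * (P (Suc (Suc n)) + P (Suc n))) + c4 * (\<tau> * S))"
    proof (intro mult_left_mono add_mono)
      show "4 * K\<^sup>2 * (q / \<tau>) \<le> c4 * (q / \<tau>)"
        using c4 q \<tau>_pos by (intro mult_right_mono) auto
      have "4 * K\<^sup>2 * M\<^sup>2 * (\<tau> * (Q2 + Q1)) \<le> 4 * K\<^sup>2 * M\<^sup>2 * (\<tau> * (A * P (Suc (Suc n)) + A * P (Suc n)))"
        using poincare[of "Suc (Suc n)"] poincare[of "Suc n"] n \<tau>_pos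
        by (intro mult_left_mono add_mono) (auto simp: Q2_def Q1_def)
      also have "\<dots> = 4 * K\<^sup>2 * M\<^sup>2 * A * (\<tau> * (P (Suc (Suc n)) + P (Suc n)))"
        by (simp add: algebra_simps)
      also have "\<dots> \<le> c4 * (\<tau> * (P (Suc (Suc n)) + P (Suc n)))"
        using c4 nonneg \<tau>_pos by (intro mult_right_mono) auto
      finally show "4 * K\<^sup>2 * M\<^sup>2 * (\<tau> * (Q2 + Q1)) \<le> c4 * (\<tau> * (P (Suc (Suc n)) + P (Suc n)))" .
      show "9 * G * M\<^sup>2 * (\<tau> * \<tau> ^ 4) \<le> c4 * (\<tau> * S)"
        using c4 \<tau>_pos \<tau>4 pos by (intro mult_mono mult_left_mono) auto
    qed (use pos in auto)
    also have "\<dots> = 4 * (1 + T) * c4 * (q / \<tau> + \<tau> * (P (Suc (Suc n)) + P (Suc n)) + \<tau> * S)"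
      by (simp only: distrib_left mult.assoc)
    also have "\<dots> \<le> Kr * (q / \<tau> + \<tau> * (P (Suc (Suc n)) + P (Suc n)) + \<tau> * S)"
      using Kr_ge(3) q nonneg \<tau>_pos pos by (intro mult_right_mono) auto
    finally have "(1 + 1 / \<tau>) * X \<le> Kr * (q / \<tau> + \<tau> * (P (Suc (Suc n)) + P (Suc n)) + \<tau> * S)" .
    moreover have "H (Suc (Suc n)) \<le> (1 + \<tau>) * H n + (1 + 1 / \<tau>) * X"
      using reaction_err_Suc_Suc[OF n] unfolding H_def X_def q_def D_def Q2_def Q1_def diff_Suc_1 .
    ultimately show ?thesis
      unfolding q_def by linarith
  qed
  have H0: "H 0 \<le> K\<^sup>2 * G * M\<^sup>2 * (1 + T)\<^sup>2 * S"
  proof -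
    define w where "w = \<tau> + h1\<^sup>2 + h2\<^sup>2"
    \<comment> \<open>Clearing the factor \<tau>/2 makes the L2 error of the half step a multiple of
      \<tau> * (\<tau> + h1^2 + h2^2), which is of second order in time.\<close>
    have "sq0 eh / (\<tau> / 2) \<le> \<tau> / 2 * (G * (M * w)\<^sup>2)"
      using half_step_energy sq1_nonneg[of eh] unfolding w_def by linarith
    then have "sq0 eh \<le> \<tau> / 2 * (G * (M * w)\<^sup>2) * (\<tau> / 2)"
      using \<tau>_pos by (subst (asm) pos_divide_le_eq) auto
    also have "\<dots> = G * M\<^sup>2 * ((\<tau> * w)\<^sup>2 / 4)"
      by (simp add: power_mult_distrib power2_eq_square)
    also have "\<dots> \<le> G * M\<^sup>2 * ((1 + T)\<^sup>2 * S)"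
    proof (intro mult_left_mono)
      have "\<tau> * w = \<tau>\<^sup>2 + \<tau> * (h1\<^sup>2 + h2\<^sup>2)"
        by (simp add: w_def power2_eq_square algebra_simps)
      also have "\<dots> \<le> (1 + T) * \<tau>\<^sup>2 + (1 + T) * (h1\<^sup>2 + h2\<^sup>2)"
        using \<tau>_le T_pos mult_right_mono[of 1 "1 + T" "\<tau>\<^sup>2"] by (intro add_mono mult_right_mono) auto
      also have "\<dots> = (1 + T) * (\<tau>\<^sup>2 + h1\<^sup>2 + h2\<^sup>2)"
        by (simp add: algebra_simps)
      finally have "(\<tau> * w)\<^sup>2 \<le> ((1 + T) * (\<tau>\<^sup>2 + h1\<^sup>2 + h2\<^sup>2))\<^sup>2"
        using \<tau>_pos by (intro power_mono) (auto simp: w_def)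
      then have le: "(\<tau> * w)\<^sup>2 \<le> (1 + T)\<^sup>2 * S"
        unfolding power_mult_distrib[of "1 + T"] S_def .
      have "y / 4 \<le> z" if "y \<le> z" "0 \<le> y" for y z :: real
        using that by simp
      from this[OF le zero_le_power2] show "(\<tau> * w)\<^sup>2 / 4 \<le> (1 + T)\<^sup>2 * S" .
    qed (use pos in auto)
    finally have "K\<^sup>2 * sq0 eh \<le> K\<^sup>2 * (G * M\<^sup>2 * ((1 + T)\<^sup>2 * S))"
      by (intro mult_left_mono) auto
    then show ?thesis
      using reaction_err_0 by (simp add: H_def mult_ac)
  qed
  have H0': "H 0 \<le> Kr * S"
    using H0 mult_right_mono[OF Kr_ge(6) pos(3)] by linarith
  have H1: "H 1 \<le> Kr * (S + P 1)" if "1 < N"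
  proof -
    have "H 1 \<le> 2 * H 0 + 16 * K\<^sup>2 * sq0 (e 1) + 16 * G * M\<^sup>2 * \<tau> ^ 4"
      using reaction_err_1[OF that] by (simp add: H_def power_mult_distrib algebra_simps flip: power_mult)
    also have "\<dots> \<le> 2 * (K\<^sup>2 * G * M\<^sup>2 * (1 + T)\<^sup>2 * S) + 16 * K\<^sup>2 * (A * P 1) + 16 * G * M\<^sup>2 * S"
      using H0 poincare[OF less_imp_le[OF that]] \<tau>4 pos by (intro add_mono mult_left_mono) auto
    also have "\<dots> = (2 * K\<^sup>2 * G * M\<^sup>2 * (1 + T)\<^sup>2 + 16 * G * M\<^sup>2) * S + 16 * K\<^sup>2 * A * P 1"
      by (simp add: algebra_simps)
    also have "\<dots> \<le> Kr * S + Kr * P 1"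
      using Kr_ge pos nonneg by (intro add_mono mult_right_mono) auto
    finally show ?thesis
      by (simp add: distrib_left)
  qed
  have N\<tau>: "real N * \<tau> \<le> T"
    by (simp add: N_\<tau>)
  note gronwall = relaxation_gronwall[OF \<tau>_pos N\<tau> Kr_ge(1) pos(3) N_pos nonneg P0 step_P step_H H0' H1]
  show "sq0 (\<theta> m) \<le> gronwall_const T Kr * S" if "m < N" for m
    using gronwall(1)[OF _ _ _ that] unfolding H_def by simp
  show "sq1 (e m) \<le> gronwall_const T Kr * S" if "m \<le> N" for m
    using gronwall(2)[OF _ _ _ that] unfolding P_def by simp
qed

text \<open>The H1 part of \<open>half_step_energy\<close> gains only one factor \<tau> in the
  square, hence the square root of \<tau> here. The summand 1 keeps the constant positive when
  \<open>M\<close> is zero.\<close>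

lemma half_step_error_bound:
  "half_step_error T a1 a2 b1 b2 u N J1 J2 Vh
    \<le> (sqrt ((a2 - a1) * (b2 - b1)) * M + 1)
      * (\<tau> powr (3 / 2) + \<tau> powr (1 / 2) * h1\<^sup>2 + \<tau> powr (1 / 2) * h2\<^sup>2)"
proof -
  let ?G = "(a2 - a1) * (b2 - b1)"
  define w where "w = \<tau> + h1\<^sup>2 + h2\<^sup>2"
  have "0 \<le> w"
    using \<tau>_pos by (simp add: w_def)
  have "0 \<le> ?G"
    using a_less b_less by simp
  have "0 \<le> sq0 (err (\<tau> / 2) Vh) / (\<tau> / 2)"
    using \<tau>_pos sq0_nonneg by simp
  then have "2 * sq1 (err (\<tau> / 2) Vh) \<le> \<tau> / 2 * (?G * (M * w)\<^sup>2)"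
    using half_step_energy unfolding w_def by linarith
  also have "\<dots> \<le> 2 * \<tau> * (?G * (M * w)\<^sup>2)"
    using \<tau>_pos \<open>0 \<le> ?G\<close> by (intro mult_right_mono mult_nonneg_nonneg[OF _ zero_le_power2]) auto
  finally have "sq1 (err (\<tau> / 2) Vh) \<le> \<tau> * (?G * (M * w)\<^sup>2)"
    by simp
  then have "sqrt (sq1 (err (\<tau> / 2) Vh)) \<le> sqrt (\<tau> * (?G * (M * w)\<^sup>2))"
    by (rule real_sqrt_le_mono)
  also have "\<dots> = (sqrt ?G * M) * (sqrt \<tau> * w)"
    using M_nonneg[OF M] \<open>0 \<le> w\<close> by (simp add: real_sqrt_mult)
  also have "\<dots> \<le> (sqrt ?G * M + 1) * (sqrt \<tau> * w)"
    using \<tau>_pos \<open>0 \<le> w\<close> by (intro mult_right_mono) auto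
  finally show ?thesis
    unfolding powr_\<tau> half_step_error_def \<tau>_def[symmetric] norm1H_eq err_def[abs_def] w_def .
qed

end

end

context discretization
begin

section \<open>Choice of the constants and conclusion\<close>

lemma max_error_bound:
  assumes bounds: "\<And>m. m < N \<Longrightarrow> sq0 (reaction_err m (\<Phi> m)) \<le> C * (\<tau>\<^sup>2 + h1\<^sup>2 + h2\<^sup>2)\<^sup>2"
    "\<And>m. m \<le> N \<Longrightarrow> sq1 (err (real m * \<tau>) (V m)) \<le> C * (\<tau>\<^sup>2 + h1\<^sup>2 + h2\<^sup>2)\<^sup>2"
  shows "max_error T a1 a2 b1 b2 g u N J1 J2 V \<Phi> \<le> (2 * sqrt C + 1) * (\<tau>\<^sup>2 + h1\<^sup>2 + h2\<^sup>2)"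
proof -
  let ?s = "\<tau>\<^sup>2 + h1\<^sup>2 + h2\<^sup>2"
  have root: "sqrt (C * ?s\<^sup>2) = sqrt C * ?s"
    by (simp add: real_sqrt_mult)
  have "sqrt (sq0 (reaction_err m (\<Phi> m))) \<le> sqrt C * ?s" if "m < N" for m
    using real_sqrt_le_mono[OF bounds(1)[OF that]] unfolding root .
  then have "(MAX m\<in>{0..N - 1}. norm0H J1 J2 h1 h2 (\<lambda>i j. g (I\<^sub>H (u (real m * \<tau> + \<tau> / 2)) i j) - \<Phi> m i j)) \<le> sqrt C * ?s"
    using N_pos unfolding norm0H_eq reaction_err_def[abs_def] by (subst Max_le_iff) auto
  moreover have "sqrt (sq1 (err (real m * \<tau>) (V m))) \<le> sqrt C * ?s" if "m \<le> N" for m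
    using real_sqrt_le_mono[OF bounds(2)[OF that]] unfolding root .
  then have "(MAX m\<in>{0..N}. norm1H J1 J2 h1 h2 (\<lambda>i j. I\<^sub>H (u (real m * \<tau>)) i j - V m i j)) \<le> sqrt C * ?s"
    unfolding norm1H_eq err_def[abs_def] by (subst Max_le_iff) auto
  moreover have "(2 * sqrt C + 1) * ?s = sqrt C * ?s + sqrt C * ?s + ?s"
    by (simp only: distrib_right mult_2 mult_1_left)
  moreover have "0 \<le> ?s"
    by simp
  ultimately show ?thesis
    unfolding max_error_eq by linarith
qed

end

lemma (in heat_problem) property_P_exists:
  "\<exists>C1>0. \<exists>C2>0. \<exists>C3>0. property_P T a1 a2 b1 b2 g f u0 u \<delta> C1 C2 C3"
proof -
  obtain M where M: "data_bound M"
    using data_bound_exists by blast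
  obtain K where K: "0 \<le> K"
    "\<And>x y. \<bar>g (mollifier \<delta> x) - g (mollifier \<delta> y)\<bar> \<le> K * \<bar>x - y\<bar>"
    "\<And>a b c d. \<bar>g (mollifier \<delta> a) - g (mollifier \<delta> b) - (g (mollifier \<delta> c) - g (mollifier \<delta> d))\<bar>
      \<le> K * (\<bar>a - b - (c - d)\<bar> + (\<bar>a - c\<bar> + \<bar>b - d\<bar>) * \<bar>a - b\<bar>)"
    using mollified_nonlinearity_bounds[OF \<delta>_pos g_deriv g'_deriv g''_cont] by blast
  define G where "G = (a2 - a1) * (b2 - b1)"
  define Kr where "Kr = 1 + 4 * G * M\<^sup>2 + 4 * (1 + T) * (4 * K\<^sup>2 + 4 * K\<^sup>2 * M\<^sup>2 * (a2 - a1)\<^sup>2 + 9 * G * M\<^sup>2)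
    + 16 * K\<^sup>2 * (a2 - a1)\<^sup>2 + 2 * K\<^sup>2 * G * M\<^sup>2 * (1 + T)\<^sup>2 + 16 * G * M\<^sup>2"
  have pos: "0 \<le> G" "0 \<le> M" "0 \<le> Kr"
    using a_less b_less M_nonneg[OF M] K(1) T_pos by (simp_all add: G_def Kr_def)
  define C where "C = gronwall_const T Kr"
  have "0 \<le> C"
    unfolding C_def using pos T_pos by (intro gronwall_const_nonneg) auto
  \<comment> \<open>Each of the two maxima is at most sqrt C times the mesh term, hence the factor
    2; the added 1 makes the third constant positive.\<close>
  have "property_P T a1 a2 b1 b2 g f u0 u \<delta> 1 (sqrt G * M + 1) (2 * sqrt C + 1)"
    unfolding property_P_def Let_def
  proof (intro allI impI)
    fix N J1 J2 :: nat and Vh V \<Phi>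
    assume "1 \<le> N" and scheme: "modified_scheme T a1 a2 b1 b2 g f u0 \<delta> N J1 J2 Vh V \<Phi>"
    then interpret discretization T a1 a2 b1 b2 \<delta> D Q g g' g'' f u u0 u_t u_tt u_ttt u_x1 u_x1_2 u_x1_3
      u_x1_4 u_x2 u_x2_2 u_x2_3 u_x2_4 \<zeta>_t \<zeta>_tt \<zeta>_ttt N J1 J2
      by unfold_locales
    note error = scheme_error[OF M K scheme, folded G_def, folded Kr_def C_def]
    show "half_step_error T a1 a2 b1 b2 u N J1 J2 Vh
        \<le> (sqrt G * M + 1) * ((T / real N) powr (3 / 2) + (T / real N) powr (1 / 2) * (mesh_width a1 a2 J1)\<^sup>2
          + (T / real N) powr (1 / 2) * (mesh_width b1 b2 J2)\<^sup>2) \<and>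
      max_error T a1 a2 b1 b2 g u N J1 J2 V \<Phi>
        \<le> (2 * sqrt C + 1) * ((T / real N)\<^sup>2 + (mesh_width a1 a2 J1)\<^sup>2 + (mesh_width b1 b2 J2)\<^sup>2)"
      using half_step_error_bound[OF M K scheme] max_error_bound[OF error]
      unfolding \<tau>_def G_def by blast
  qed
  moreover have "0 < sqrt G * M + 1" "0 < 2 * sqrt C + 1"
    using pos \<open>0 \<le> C\<close> by (simp_all add: add_nonneg_pos)
  ultimately show ?thesis
    using zero_less_one by blast
qed

theorem theorem3p2:
  fixes T a1 a2 b1 b2 \<delta> L :: real
    and D :: "(real \<times> real) set" and Q :: "(real \<times> real \<times> real) set"
    and g g' g'' :: "real \<Rightarrow> real"
    and f u :: "real \<Rightarrow> real \<times> real \<Rightarrow> real"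
    and u0 :: "real \<times> real \<Rightarrow> real"
    and u_t u_tt u_ttt u_x1 u_x1_2 u_x1_3 u_x1_4 u_x2 u_x2_2 u_x2_3 u_x2_4 \<zeta>_t \<zeta>_tt \<zeta>_ttt ::
      "real \<Rightarrow> real \<times> real \<Rightarrow> real"
  assumes "0 < T" and "a1 < a2" and "b1 < b2"
    and "D = {a1..a2} \<times> {b1..b2}"
    and "Q = {0..T} \<times> D"
    and "g 0 = 0"
    and "\<forall>x. (g has_real_derivative g' x) (at x)"
    and "\<forall>x. (g' has_real_derivative g'' x) (at x)"
    and "continuous_on UNIV g''"
    and "continuous_on Q (\<lambda>(t, x). f t x)"
    and "continuous_on D u0"
    and "\<forall>x\<in>frontier D. u0 x = 0"
    and "continuous_on Q (\<lambda>(t, x). u t x)"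
    and "has_partial_t Q u u_t" and "continuous_on Q (\<lambda>(t, x). u_t t x)"
    and "has_partial_x1 Q u u_x1" and "continuous_on Q (\<lambda>(t, x). u_x1 t x)"
    and "has_partial_x1 Q u_x1 u_x1_2" and "continuous_on Q (\<lambda>(t, x). u_x1_2 t x)"
    and "has_partial_x2 Q u u_x2" and "continuous_on Q (\<lambda>(t, x). u_x2 t x)"
    and "has_partial_x2 Q u_x2 u_x2_2" and "continuous_on Q (\<lambda>(t, x). u_x2_2 t x)"
    and "\<forall>(t, x)\<in>Q. u_t t x = (u_x1_2 t x + u_x2_2 t x) + g (u t x) + f t x"
    and "\<forall>t\<in>{0..T}. \<forall>x\<in>frontier D. u t x = 0"
    and "\<forall>x\<in>D. u 0 x = u0 x"
    and "has_partial_t Q u_t u_tt" and "continuous_on Q (\<lambda>(t, x). u_tt t x)"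
    and "has_partial_t Q u_tt u_ttt" and "continuous_on Q (\<lambda>(t, x). u_ttt t x)"
    and "has_partial_x1 Q u_x1_2 u_x1_3"
    and "has_partial_x1 Q u_x1_3 u_x1_4" and "continuous_on Q (\<lambda>(t, x). u_x1_4 t x)"
    and "has_partial_x2 Q u_x2_2 u_x2_3"
    and "has_partial_x2 Q u_x2_3 u_x2_4" and "continuous_on Q (\<lambda>(t, x). u_x2_4 t x)"
    and "has_partial_t Q (\<lambda>t x. g (u t x)) \<zeta>_t" and "continuous_on Q (\<lambda>(t, x). \<zeta>_t t x)"
    and "has_partial_t Q \<zeta>_t \<zeta>_tt" and "continuous_on Q (\<lambda>(t, x). \<zeta>_tt t x)"
    and "has_partial_t Q \<zeta>_tt \<zeta>_ttt" and "continuous_on Q (\<lambda>(t, x). \<zeta>_ttt t x)"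
    and "0 < \<delta>" and "2 * (SUP (t, x)\<in>Q. \<bar>u t x\<bar>) \<le> \<delta>"
    and "L = sqrt ((a2 - a1) * (b2 - b1) / min (a2 - a1) (b2 - b1))"
  shows "(\<exists>C1>0. \<exists>C2>0. \<exists>C3>0. property_P T a1 a2 b1 b2 g f u0 u \<delta> C1 C2 C3) \<and>
    (\<forall>C1>0. \<forall>C2>0. \<forall>C3>0. property_P T a1 a2 b1 b2 g f u0 u \<delta> C1 C2 C3 \<longrightarrow>
      (\<forall>N\<ge>1. \<forall>J1\<ge>1. \<forall>J2\<ge>1. \<forall>Uh U \<Phi>.
        let \<tau> = T / real N; h1 = mesh_width a1 a2 J1; h2 = mesh_width b1 b2 J2
        in \<tau> * C1 \<le> 1 / 2 \<longrightarrow>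
           C3 * L * ((\<tau>\<^sup>2 + h1\<^sup>2 + h2\<^sup>2) / sqrt (h1 + h2)) \<le> \<delta> / 2 \<longrightarrow>
           C2 * L * ((\<tau> powr (3 / 2) + \<tau> powr (1 / 2) * h1\<^sup>2 + \<tau> powr (1 / 2) * h2\<^sup>2)
              / sqrt (h1 + h2)) \<le> \<delta> / 2 \<longrightarrow>
           rfd_scheme T a1 a2 b1 b2 g f u0 N J1 J2 Uh U \<Phi> \<longrightarrow>
           max_error T a1 a2 b1 b2 g u N J1 J2 U \<Phi> \<le> C3 * (\<tau>\<^sup>2 + h1\<^sup>2 + h2\<^sup>2)))"
proof -
  interpret heat_problem T a1 a2 b1 b2 \<delta> D Q g g' g'' f u u0 u_t u_tt u_ttt u_x1 u_x1_2 u_x1_3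
    u_x1_4 u_x2 u_x2_2 u_x2_3 u_x2_4 \<zeta>_t \<zeta>_tt \<zeta>_ttt
    using assms by unfold_locales blast+
  show ?thesis
  proof (intro conjI property_P_exists allI impI)
    fix C1 C2 C3 :: real
    assume P: "property_P T a1 a2 b1 b2 g f u0 u \<delta> C1 C2 C3"
    fix N J1 J2 :: nat and Uh :: grid_fun and U \<Phi> :: "nat \<Rightarrow> grid_fun"
    assume "1 \<le> N" and J: "1 \<le> J1" "1 \<le> J2"
    then interpret discretization T a1 a2 b1 b2 \<delta> D Q g g' g'' f u u0 u_t u_tt u_ttt u_x1 u_x1_2 u_x1_3
      u_x1_4 u_x2 u_x2_2 u_x2_3 u_x2_4 \<zeta>_t \<zeta>_tt \<zeta>_ttt N J1 J2
      by unfold_locales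
    show "let \<tau> = T / real N; h1 = mesh_width a1 a2 J1; h2 = mesh_width b1 b2 J2
      in \<tau> * C1 \<le> 1 / 2 \<longrightarrow>
         C3 * L * ((\<tau>\<^sup>2 + h1\<^sup>2 + h2\<^sup>2) / sqrt (h1 + h2)) \<le> \<delta> / 2 \<longrightarrow>
         C2 * L * ((\<tau> powr (3 / 2) + \<tau> powr (1 / 2) * h1\<^sup>2 + \<tau> powr (1 / 2) * h2\<^sup>2)
            / sqrt (h1 + h2)) \<le> \<delta> / 2 \<longrightarrow>
         rfd_scheme T a1 a2 b1 b2 g f u0 N J1 J2 Uh U \<Phi> \<longrightarrow>
         max_error T a1 a2 b1 b2 g u N J1 J2 U \<Phi> \<le> C3 * (\<tau>\<^sup>2 + h1\<^sup>2 + h2\<^sup>2)"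
      \<comment> \<open>\<open>assms(45)\<close> is the equation for \<open>L\<close>.\<close>
      unfolding Let_def \<tau>_def[symmetric] using rfd_error[OF P J _ assms(45)] by blast
  qed
qed

end
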